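(* Consider loop percolation associated with the simple random walk on $\mathbb{Z}^d$, $d\ge 3$, with percolation probability $\theta(\alpha,\kappa)$ and thresholds $\alpha_c(\kappa)$, $\kappa_c(\alpha)$. Then (1) $\alpha_c(0)>0$; (2) for every $\alpha>0$, $\kappa_c(\alpha)\ge 0$. In contrast, let $G$ be any connected recurrent graph (i.e. the simple random walk on $G$ is recurrent). Then for the loop percolation on $G$ with $\kappa=0$ and any $\alpha>0$, with probability $1$ all the vertices of $G$ are in the same open cluster.
   Context: Let $G=(V,E)$ be an (unweighted, undirected, countable, locally finite) graph and let $Q=(Q^x_y)_{x,y\in V}$ be the transition matrix of simple random walk on $G$ (e.g. $G=\mathbb{Z}^d$ with nearest-neighbour edges). A (non-trivial discrete) based loop is an element $\dot\ell=(x_1,\dots,x_n)\in V^n$, $n\ge 2$, with $x_1\ne x_2,\dots,x_{n-1}\ne x_n,x_n\ne x_1$. Two based loops of the same length are equivalent if they coincide after a circular permutation; equivalence classes are called (discrete) loops. For $\kappa>-1$ put $$\dot\mu_\kappa(\dot\ell)=\frac1n\Big(\frac1{1+\kappa}\Big)^nQ^{x_1}_{x_2}\cdots Q^{x_{n-1}}_{x_n}Q^{x_n}_{x_1},$$ and let $\mu_\kappa$ be the push-forward of $\dot\mu_\kappa$ to the space of loops. For $\alpha>0$, $\mathcal{L}_{\alpha,\kappa}$ is the Poisson point process of loops with intensity measure $\alpha\mu_\kappa$ (law denoted $\mathbb{P}$). An edge is open if it is traversed by at least one loop of $\mathcal{L}_{\alpha,\kappa}$ (a loop $(x_1,\dots,x_n)$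 traverses the edges $\{x_i,x_{i+1}\}$ and $\{x_n,x_1\}$). $\mathcal{C}_{\alpha,\kappa}(x)$ denotes the open cluster of $x$: the set of vertices connected to $x$ by a path of open edges (including $x$ itself). On $\mathbb{Z}^d$: $\theta(\alpha,\kappa)=\mathbb{P}[\#\mathcal{C}_{\alpha,\kappa}(0)=\infty]$, with $\theta(0,\kappa)=0$; $\alpha_c(\kappa)=\inf\{\alpha\ge 0:\theta(\alpha,\kappa)>0\}$; $\kappa_c(\alpha)=\inf\{\kappa>-1:\theta(\alpha,\kappa)=0\}$. *)

theory Defs
  imports "HOL-Probability.Probability"
begin

section \<open>Graphs\<close>

text \<open>A simple undirected graph is a vertex set \<open>V\<close> together with a set \<open>E\<close> of two-element
  subsets of \<open>V\<close>.\<close>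

definition neighbours :: "'a set set \<Rightarrow> 'a \<Rightarrow> 'a set" where
  "neighbours E x = {y. {x, y} \<in> E}"

definition locally_finite_graph :: "'a set \<Rightarrow> 'a set set \<Rightarrow> bool" where
  "locally_finite_graph V E \<longleftrightarrow>
     countable V \<and>
     (\<forall>e\<in>E. \<exists>x\<in>V. \<exists>y\<in>V. x \<noteq> y \<and> e = {x, y}) \<and>
     (\<forall>x\<in>V. finite (neighbours E x))"

definition linked :: "'a set set \<Rightarrow> 'a \<Rightarrow> 'a \<Rightarrow> bool" where
  "linked E = (\<lambda>x y. {x, y} \<in> E)\<^sup>*\<^sup>*"

definition connected_graph :: "'a set \<Rightarrow> 'a set set \<Rightarrow> bool" where
  "connected_graph V E \<longleftrightarrow> (\<forall>x\<in>V. \<forall>y\<in>V. linked E x y)"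

definition zd_edges :: "(int ^ 'd::finite) set set" where
  "zd_edges = {{x, y} | x y. (\<Sum>i\<in>UNIV. \<bar>x $ i - y $ i\<bar>) = 1}"


section \<open>Simple random walk\<close>

text \<open>At an isolated vertex, where the simple random walk is not defined, the walk stays put.
  In a connected graph this concerns only the graph with a single vertex.\<close>

definition walk_step :: "'a set set \<Rightarrow> 'a \<Rightarrow> 'a pmf" where
  "walk_step E x =
     (if neighbours E x = {} then return_pmf x else pmf_of_set (neighbours E x))"

definition transition :: "'a set set \<Rightarrow> 'a \<Rightarrow> 'a \<Rightarrow> real" where
  "transition E x y = pmf (walk_step E x) y"

text \<open>The law, on trajectories \<open>nat \<Rightarrow> 'a\<close>, of the simple random walk started at \<open>x\<close>: the
  Ionescu-Tulcea extension of the kernels giving the law of position \<open>n\<close> from the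
  positions at times \<open>0, \<dots>, n - 1\<close>.\<close>

definition walk_kernel :: "'a set set \<Rightarrow> 'a \<Rightarrow> nat \<Rightarrow> (nat \<Rightarrow> 'a) \<Rightarrow> 'a measure" where
  "walk_kernel E x n \<omega> =
     measure_pmf (case n of 0 \<Rightarrow> return_pmf x | Suc m \<Rightarrow> walk_step E (\<omega> m))"

definition random_walk :: "'a set set \<Rightarrow> 'a \<Rightarrow> (nat \<Rightarrow> 'a) measure" where
  "random_walk E x =
     projective_family.lim UNIV
       (Ionescu_Tulcea.CI (walk_kernel E x) (\<lambda>_. count_space UNIV)) (\<lambda>_. count_space UNIV)"

lemma walk_kernel_Ionescu_Tulcea: "Ionescu_Tulcea (walk_kernel E x) (\<lambda>_. count_space UNIV)"
proof (rule Ionescu_Tulcea.intro)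
  fix i
  show "walk_kernel E x i \<in> measurable (PiM {0..<i} (\<lambda>_. count_space UNIV)) (subprob_algebra (count_space UNIV))"
  proof (cases i)
    case (Suc m)
    have c: "(\<lambda>\<omega>. \<omega> m) \<in> measurable (PiM {0..<i} (\<lambda>_. count_space UNIV)) (count_space UNIV)"
      using Suc by (intro measurable_component_singleton) auto
    have "(\<lambda>\<omega>. measure_pmf (walk_step E (\<omega> m))) \<in>
        measurable (PiM {0..<i} (\<lambda>_. count_space UNIV)) (subprob_algebra (count_space UNIV))"
      by (rule measurable_compose[OF c]) (simp add: measure_pmf_in_subprob_algebra[simplified] Pi_def)
    then show ?thesis using Suc by (simp add: walk_kernel_def[abs_def])
  qed (simp add: walk_kernel_def[abs_def])
qed (simp add: walk_kernel_def measure_pmf.prob_space_axioms)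

lemma random_walk_cylinder:
  "measure (random_walk E x) {\<omega>. \<forall>i\<le>n. \<omega> i = xs i} =
     (if xs 0 = x then \<Prod>i<n. transition E (xs i) (xs (Suc i)) else 0)"
proof -
  interpret Ionescu_Tulcea "walk_kernel E x" "\<lambda>_. count_space (UNIV :: 'a set)"
    by (rule walk_kernel_Ionescu_Tulcea)
  let ?M = "\<lambda>m. PiM {0..<m} (\<lambda>_. count_space (UNIV :: 'a set))"
  have sing: "{restrict xs {0..<m}} = PiE {0..<m} (\<lambda>i. {xs i})" for m
    by (simp add: PiE_singleton[symmetric] PiE_def extensional_def Pi_def) (auto simp: fun_eq_iff restrict_def)
  have sing_sets [measurable]: "{restrict xs {0..<m}} \<in> sets (?M m)" for m
    unfolding sing by (intro sets_PiM_I_finite) auto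
  have u: "(\<lambda>_. undefined) \<in> space (PiM {0..<0} (\<lambda>_. count_space (UNIV :: 'a set)))"
    by (simp add: space_PiM PiE_def extensional_def)
  have C: "emeasure (C 0 m (\<lambda>_. undefined)) {restrict xs {0..<m}} =
      (\<Prod>i<m. emeasure (walk_kernel E x i xs) {xs i})" for m
  proof (induction m)
    case 0
    show ?case
      using emeasure_return[OF sing_sets[of 0], of "\<lambda>_. undefined"] by (simp add: restrict_def)
  next
    case (Suc m)
    have "emeasure (C 0 (Suc m) (\<lambda>_. undefined)) {restrict xs {0..<Suc m}} =
      (\<integral>\<^sup>+\<omega>. emeasure (eP m \<omega>) {restrict xs {0..<Suc m}} \<partial>C 0 m (\<lambda>_. undefined))"
      using measurable_eP[of m] sing_sets[of "Suc m"] u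
      by (simp add: emeasure_bind[where N="?M (Suc m)"] space_C measurable_cong_sets[OF sets_C[OF u] refl]
          del: space_PiM_empty)
    also have "\<dots> = (\<integral>\<^sup>+\<omega>. emeasure (walk_kernel E x m xs) {xs m} * indicator {restrict xs {0..<m}} \<omega> \<partial>C 0 m (\<lambda>_. undefined))"
    proof (intro nn_integral_cong)
      fix \<omega> assume "\<omega> \<in> space (C 0 m (\<lambda>_. undefined))"
      then have \<omega>: "\<omega> \<in> space (?M m)" using space_C[OF u, of m] by simp
      then have ext: "\<omega> \<in> extensional {0..<m}" by (auto simp: space_PiM PiE_def)
      have "emeasure (eP m \<omega>) {restrict xs {0..<Suc m}} =
        emeasure (walk_kernel E x m \<omega>) {y. fun_upd \<omega> m y = restrict xs {0..<Suc m}}"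
        using emeasure_eP[OF \<omega> sing_sets[of "Suc m"]] by (simp add: vimage_def)
      also have "{y. fun_upd \<omega> m y = restrict xs {0..<Suc m}} = (if \<omega> = restrict xs {0..<m} then {xs m} else {})"
        using ext by (auto simp: fun_eq_iff restrict_def extensional_def)
      also have "emeasure (walk_kernel E x m \<omega>) \<dots> =
         emeasure (walk_kernel E x m xs) {xs m} * indicator {restrict xs {0..<m}} \<omega>"
        by (auto simp: walk_kernel_def split: nat.splits)
      finally show "emeasure (eP m \<omega>) {restrict xs {0..<Suc m}} =
         emeasure (walk_kernel E x m xs) {xs m} * indicator {restrict xs {0..<m}} \<omega>" .
    qed
    also have "\<dots> = emeasure (walk_kernel E x m xs) {xs m} * emeasure (C 0 m (\<lambda>_. undefined)) {restrict xs {0..<m}}"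
      using sing_sets[of m] sets_C[OF u, of m] by (subst nn_integral_cmult_indicator) auto
    finally show ?case by (simp only: Suc.IH prod.lessThan_Suc mult.commute)
  qed
  have "emeasure (random_walk E x) {\<omega>. \<forall>i\<le>n. \<omega> i = xs i} =
     emeasure PF.lim (PF.emb UNIV {0..<Suc n} {restrict xs {0..<Suc n}})"
  proof -
    have "restrict \<omega> {0..<Suc n} = restrict xs {0..<Suc n} \<longleftrightarrow> (\<forall>i\<le>n. \<omega> i = xs i)" for \<omega> :: "nat \<Rightarrow> 'a"
    proof
      assume eq: "restrict \<omega> {0..<Suc n} = restrict xs {0..<Suc n}"
      show "\<forall>i\<le>n. \<omega> i = xs i"
      proof (intro allI impI)
        fix i assume "i \<le> n"
        then show "\<omega> i = xs i" using fun_cong[OF eq, of i] by simp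
      qed
    qed auto
    then show ?thesis
      unfolding random_walk_def by (simp add: prod_emb_def space_PiM vimage_def)
  qed
  also have "\<dots> = emeasure (CI {0..<Suc n}) {restrict xs {0..<Suc n}}"
    by (rule lim) (auto intro: sing_sets)
  also have "\<dots> = emeasure (C 0 (Suc n) (\<lambda>_. undefined)) {restrict xs {0..<Suc n}}"
  proof (subst emeasure_CI[OF order_refl sing_sets])
    have "PF.emb {0..<Suc n} {0..<Suc n} {restrict xs {0..<Suc n}} = {restrict xs {0..<Suc n}}"
      unfolding sing by (subst prod_emb_PiE_same_index) auto
    then show "emeasure (C 0 (Suc n) (\<lambda>_. undefined)) (PF.emb {0..<Suc n} {0..<Suc n} {restrict xs {0..<Suc n}}) =
      emeasure (C 0 (Suc n) (\<lambda>_. undefined)) {restrict xs {0..<Suc n}}" by (rule arg_cong)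
  qed
  also have "\<dots> = (\<Prod>i<Suc n. emeasure (walk_kernel E x i xs) {xs i})" by (rule C)
  also have "\<dots> = emeasure (walk_kernel E x 0 xs) {xs 0} * (\<Prod>i<n. emeasure (walk_kernel E x (Suc i) xs) {xs (Suc i)})"
    by (rule prod.lessThan_Suc_shift)
  also have "\<dots> = ennreal (if xs 0 = x then \<Prod>i<n. transition E (xs i) (xs (Suc i)) else 0)"
    by (simp add: walk_kernel_def transition_def emeasure_pmf_single prod_ennreal)
  finally show ?thesis
    by (simp add: measure_def transition_def prod_nonneg)
qed

definition recurrent_graph :: "'a set \<Rightarrow> 'a set set \<Rightarrow> bool" where
  "recurrent_graph V E \<longleftrightarrow> (\<forall>x\<in>V. AE \<omega> in random_walk E x. \<exists>n\<ge>1. \<omega> n = x)"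


section \<open>Loops and the loop measure\<close>

definition based_loops :: "'a set \<Rightarrow> 'a list set" where
  "based_loops V =
     {xs. set xs \<subseteq> V \<and> 2 \<le> length xs \<and>
          (\<forall>i<length xs. xs ! i \<noteq> xs ! (Suc i mod length xs))}"

definition rotation_equiv :: "'a set \<Rightarrow> ('a list \<times> 'a list) set" where
  "rotation_equiv V =
     {(xs, ys). xs \<in> based_loops V \<and> ys \<in> based_loops V \<and> (\<exists>k. ys = rotate k xs)}"

definition loops :: "'a set \<Rightarrow> 'a list set set" where
  "loops V = based_loops V // rotation_equiv V"

definition loop_weight :: "'a set set \<Rightarrow> real \<Rightarrow> 'a list \<Rightarrow> real" where
  "loop_weight E \<kappa> xs =
     1 / real (length xs) * (1 / (1 + \<kappa>)) ^ length xs *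
     (\<Prod>i<length xs. transition E (xs ! i) (xs ! (Suc i mod length xs)))"

definition based_loop_measure :: "'a set \<Rightarrow> 'a set set \<Rightarrow> real \<Rightarrow> 'a list measure" where
  "based_loop_measure V E \<kappa> = point_measure (based_loops V) (\<lambda>xs. ennreal (loop_weight E \<kappa> xs))"

definition loop_measure :: "'a set \<Rightarrow> 'a set set \<Rightarrow> real \<Rightarrow> 'a list set measure" where
  "loop_measure V E \<kappa> =
     distr (based_loop_measure V E \<kappa>) (count_space (loops V)) (\<lambda>xs. rotation_equiv V `` {xs})"


lemma countable_loops: "countable V \<Longrightarrow> countable (loops V)"
proof -
  assume "countable V"
  then have "countable (based_loops V)"
    by (intro countable_subset[OF _ countable_lists[of V]]) (auto simp: based_loops_def lists_eq_set)
  then show ?thesis by (auto simp: loops_def quotient_def)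
qed

lemma rotation_equiv: "equiv (based_loops V) (rotation_equiv V)"
proof (rule equivI)
  show "rotation_equiv V \<subseteq> based_loops V \<times> based_loops V" by (auto simp: rotation_equiv_def)
  show "refl_on (based_loops V) (rotation_equiv V)"
    by (auto simp: refl_on_def rotation_equiv_def intro: exI[of _ 0])
  show "trans (rotation_equiv V)"
    by (auto simp: trans_def rotation_equiv_def rotate_rotate)
  show "sym (rotation_equiv V)"
  proof (rule symI)
    fix xs ys assume a: "(xs, ys) \<in> rotation_equiv V"
    then obtain k where k: "ys = rotate k xs" by (auto simp: rotation_equiv_def)
    have "length xs \<noteq> 0" using a by (auto simp: rotation_equiv_def based_loops_def)
    then have "(length xs - k mod length xs + k) mod length xs = 0"
      by (metis add.commute le_add_diff_inverse mod_add_left_eq mod_le_divisor mod_less_divisor mod_self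
          less_imp_le neq0_conv)
    then have "rotate (length xs - k mod length xs) ys = xs"
      unfolding k rotate_rotate by (metis rotate0 id_apply rotate_conv_mod)
    then have "\<exists>m. xs = rotate m ys" by metis
    then show "(ys, xs) \<in> rotation_equiv V" using a by (simp add: rotation_equiv_def)
  qed
qed

lemma loop_measure_atom:
  assumes "l \<in> loops V"
  shows "emeasure (loop_measure V E \<kappa>) {l} = (\<Sum>xs\<in>l. ennreal (loop_weight E \<kappa> xs))"
    and "finite l"
proof -
  note eq = rotation_equiv[of V]
  have l: "l \<subseteq> based_loops V" using assms eq unfolding loops_def by (metis in_quotient_imp_subset)
  obtain xs where xs: "xs \<in> based_loops V" "l = rotation_equiv V `` {xs}"
    using assms by (auto simp: loops_def elim: quotientE)
  have "l \<subseteq> {ys. set ys \<subseteq> set xs \<and> length ys = length xs}"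
    using xs by (auto simp: rotation_equiv_def)
  then show fin: "finite l" by (rule finite_subset) (simp add: finite_lists_length_eq)
  have "emeasure (loop_measure V E \<kappa>) {l} =
     emeasure (based_loop_measure V E \<kappa>) ((\<lambda>xs. rotation_equiv V `` {xs}) -` {l} \<inter> based_loops V)"
    unfolding loop_measure_def using assms
    by (subst emeasure_distr) (auto simp: based_loop_measure_def space_point_measure loops_def quotientI)
  also have "(\<lambda>xs. rotation_equiv V `` {xs}) -` {l} \<inter> based_loops V = l"
    using eq assms l unfolding loops_def
    by (auto simp: equiv_class_eq_iff elim!: quotientE intro: equiv_class_self)
  also have "emeasure (based_loop_measure V E \<kappa>) l = (\<Sum>xs\<in>l. ennreal (loop_weight E \<kappa> xs))"
    unfolding based_loop_measure_def using l fin by (intro emeasure_point_measure_finite2) auto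
  finally show "emeasure (loop_measure V E \<kappa>) {l} = (\<Sum>xs\<in>l. ennreal (loop_weight E \<kappa> xs))" .
qed


section \<open>Poisson point processes on countable discrete spaces\<close>

text \<open>A point configuration is identified with its multiplicity function \<open>\<omega>\<close>; the number of its
  points in \<open>A\<close>, possibly infinite, is \<open>count_points A \<omega>\<close>.\<close>

definition count_points :: "'l set \<Rightarrow> ('l \<Rightarrow> nat) \<Rightarrow> ennreal" where
  "count_points A \<omega> = (\<integral>\<^sup>+x. of_nat (\<omega> x) \<partial>count_space A)"

text \<open>The library's \<^const>\<open>poisson_pmf\<close> is only specified for positive rates.\<close>

definition poisson :: "real \<Rightarrow> nat pmf" where
  "poisson r = (if 0 < r then poisson_pmf r else return_pmf 0)"

definition is_poisson_process :: "'l measure \<Rightarrow> ('l \<Rightarrow> nat) measure \<Rightarrow> bool" where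
  "is_poisson_process \<nu> P \<longleftrightarrow>
     prob_space P \<and>
     sets P = sets (\<Pi>\<^sub>M x\<in>space \<nu>. count_space (UNIV :: nat set)) \<and>
     (\<forall>A\<in>sets \<nu>. emeasure \<nu> A < \<infinity> \<longrightarrow>
        (\<forall>k. measure P {\<omega>\<in>space P. count_points A \<omega> = of_nat k} = pmf (poisson (measure \<nu> A)) k)) \<and>
     (\<forall>A\<in>sets \<nu>. emeasure \<nu> A = \<infinity> \<longrightarrow> (AE \<omega> in P. count_points A \<omega> = \<infinity>)) \<and>
     (\<forall>\<A>\<subseteq>sets \<nu>. disjoint \<A> \<longrightarrow> prob_space.indep_vars P (\<lambda>_. borel) count_points \<A>)"

text \<open>For an intensity measure on a countable discrete space with finite atoms, the Poisson point
  process is realised by independent Poisson multiplicities of the atoms.\<close>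

definition poisson_process :: "'l measure \<Rightarrow> ('l \<Rightarrow> nat) measure" where
  "poisson_process \<nu> = (\<Pi>\<^sub>M x\<in>space \<nu>. measure_pmf (poisson (measure \<nu> {x})))"


lemma pmf_poisson_eq: "0 \<le> r \<Longrightarrow> pmf (poisson r) k = r ^ k / fact k * exp (- r)"
  by (cases "r = 0") (auto simp: poisson_def pmf_return power_0_left)

lemma poisson_convolution:
  assumes "0 \<le> a" "0 \<le> b"
  shows "(\<Sum>j\<le>k. pmf (poisson a) j * pmf (poisson b) (k - j)) = pmf (poisson (a + b)) k"
proof -
  have "(\<Sum>j\<le>k. pmf (poisson a) j * pmf (poisson b) (k - j)) =
        (\<Sum>j\<le>k. (real (k choose j) * a ^ j * b ^ (k - j)) / fact k * exp (- (a + b)))"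
    using assms by (intro sum.cong refl)
      (simp add: pmf_poisson_eq binomial_fact mult_exp_exp algebra_simps field_split_simps)
  also have "\<dots> = (a + b) ^ k / fact k * exp (- (a + b))"
    by (simp add: binomial_ring sum_divide_distrib sum_distrib_right)
  finally show ?thesis using assms by (simp add: pmf_poisson_eq)
qed

locale discrete_intensity =
  fixes \<nu> :: "'l measure"
  assumes sets_nu: "sets \<nu> = Pow (space \<nu>)"
    and countable_nu: "countable (space \<nu>)"
    and atoms: "x \<in> space \<nu> \<Longrightarrow> emeasure \<nu> {x} < \<infinity>"
begin

abbreviation "P \<equiv> poisson_process \<nu>"

sublocale PP: product_prob_space "\<lambda>x. measure_pmf (poisson (measure \<nu> {x}))" "space \<nu>"
  by unfold_locales

lemma prob_space_P: "prob_space P"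
  unfolding poisson_process_def by (rule PP.prob_space_axioms)

sublocale P: prob_space P by (rule prob_space_P)

lemma sets_P: "sets P = sets (\<Pi>\<^sub>M x\<in>space \<nu>. count_space UNIV)"
  unfolding poisson_process_def by (intro sets_PiM_cong) auto

lemma coord_measurable [measurable]: "x \<in> space \<nu> \<Longrightarrow> (\<lambda>\<omega>. \<omega> x) \<in> measurable P (count_space UNIV)"
  by (subst measurable_cong_sets[OF sets_P refl]) (rule measurable_component_singleton)

lemma distr_coord: "x \<in> space \<nu> \<Longrightarrow>
    distr P (count_space UNIV) (\<lambda>\<omega>. \<omega> x) = measure_pmf (poisson (measure \<nu> {x}))"
  using PP.PiM_component[of x] unfolding poisson_process_def
  by (metis (no_types, lifting) distr_cong sets_measure_pmf_count_space)

lemma indep_coords: "P.indep_vars (\<lambda>_. count_space UNIV) (\<lambda>x \<omega>. \<omega> x) (space \<nu>)"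
proof (cases "space \<nu> = {}")
  case True
  then show ?thesis unfolding P.indep_vars_def2 P.indep_sets_def by auto
next
  case False
  show ?thesis
  proof (subst P.indep_vars_iff_distr_eq_PiM'[OF False])
    have "distr P (Pi\<^sub>M (space \<nu>) (\<lambda>i. count_space UNIV)) (\<lambda>x. \<lambda>i\<in>space \<nu>. x i) =
          distr P P (\<lambda>x. x)"
      by (intro distr_cong refl sets_P[symmetric])
         (auto simp: poisson_process_def space_PiM PiE_restrict)
    also have "\<dots> = P" by (rule distr_id)
    also have "P = Pi\<^sub>M (space \<nu>) (\<lambda>i. distr P (count_space UNIV) (\<lambda>x. x i))"
      unfolding poisson_process_def[of \<nu>] 
      by (intro PiM_cong refl) (simp add: distr_coord[symmetric] poisson_process_def[of \<nu>, symmetric])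
    finally show "distr P (Pi\<^sub>M (space \<nu>) (\<lambda>i. count_space UNIV)) (\<lambda>x. \<lambda>i\<in>space \<nu>. x i) =
      Pi\<^sub>M (space \<nu>) (\<lambda>i. distr P (count_space UNIV) (\<lambda>x. x i))" .
  qed simp
qed

lemma finite_sum_poisson:
  assumes "finite F" "F \<subseteq> space \<nu>"
  shows "P.prob {\<omega>\<in>space P. (\<Sum>x\<in>F. \<omega> x) = k} = pmf (poisson (measure \<nu> F)) k"
  using assms
proof (induction F arbitrary: k rule: finite_induct)
  case empty
  then show ?case by (cases "k = 0") (auto simp: poisson_def P.prob_space)
next
  case (insert x F)
  have x: "x \<in> space \<nu>" and F: "F \<subseteq> space \<nu>" using insert.prems by auto
  have ind: "P.indep_vars (\<lambda>i. PiM (case_bool {x} F i) (\<lambda>_. count_space UNIV))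
      (\<lambda>i \<omega>. restrict (\<lambda>y. \<omega> y) (case_bool {x} F i)) UNIV"
    using insert.hyps insert.prems
    by (intro P.indep_vars_restrict[OF indep_coords])
       (auto simp: disjoint_family_on_def split: bool.splits)
  have ind2: "P.indep_vars (\<lambda>i. count_space UNIV)
      (\<lambda>i \<omega>. \<Sum>y\<in>case_bool {x} F i. restrict (\<lambda>y. \<omega> y) (case_bool {x} F i) y) (UNIV :: bool set)"
    by (rule P.indep_vars_compose2[OF ind]) (auto split: bool.splits)
  have prod: "P.prob {\<omega>\<in>space P. \<omega> x = j \<and> (\<Sum>y\<in>F. \<omega> y) = m} =
     P.prob {\<omega>\<in>space P. \<omega> x = j} * P.prob {\<omega>\<in>space P. (\<Sum>y\<in>F. \<omega> y) = m}" for j m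
  proof -
    have [simp]: "(\<Sum>y\<in>F. restrict \<omega> F y) = (\<Sum>y\<in>F. \<omega> y)" for \<omega> :: "'l \<Rightarrow> nat" by simp
    have "P.prob (\<Inter>i\<in>UNIV. (\<lambda>\<omega>. \<Sum>y\<in>case_bool {x} F i. restrict (\<lambda>y. \<omega> y) (case_bool {x} F i) y) -` case_bool {j} {m} i \<inter> space P)
      = (\<Prod>i\<in>UNIV. P.prob ((\<lambda>\<omega>. \<Sum>y\<in>case_bool {x} F i. restrict (\<lambda>y. \<omega> y) (case_bool {x} F i) y) -` case_bool {j} {m} i \<inter> space P))"
      by (rule P.indep_varsD_finite[OF ind2]) auto
    then show ?thesis
      by (simp add: UNIV_bool vimage_def Int_def conj_ac mult.commute)
  qed
  have 1: "P.prob {\<omega>\<in>space P. \<omega> x = j} = pmf (poisson (measure \<nu> {x})) j" for j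
  proof -
    have "pmf (poisson (measure \<nu> {x})) j = measure (distr P (count_space UNIV) (\<lambda>\<omega>. \<omega> x)) {j}"
      using x by (simp add: distr_coord pmf.rep_eq)
    also have "\<dots> = P.prob {\<omega>\<in>space P. \<omega> x = j}"
      using x by (subst measure_distr) (auto simp: vimage_def Int_def conj_commute)
    finally show ?thesis by simp
  qed
  have sumF[measurable]: "(\<lambda>\<omega>. \<Sum>y\<in>F. \<omega> y) \<in> measurable P (count_space UNIV)"
    by measurable (use F in auto)
  have "{\<omega>\<in>space P. (\<Sum>y\<in>insert x F. \<omega> y) = k} =
        (\<Union>j\<in>{..k}. {\<omega>\<in>space P. \<omega> x = j \<and> (\<Sum>y\<in>F. \<omega> y) = k - j})"
    using insert.hyps by auto
  also have "P.prob \<dots> = (\<Sum>j\<le>k. P.prob {\<omega>\<in>space P. \<omega> x = j \<and> (\<Sum>y\<in>F. \<omega> y) = k - j})"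
    using x by (intro P.finite_measure_finite_Union) (auto simp: disjoint_family_on_def)
  also have "\<dots> = (\<Sum>j\<le>k. pmf (poisson (measure \<nu> {x})) j * pmf (poisson (measure \<nu> F)) (k - j))"
    using insert.IH[OF F] by (simp add: prod 1)
  also have "\<dots> = pmf (poisson (measure \<nu> {x} + measure \<nu> F)) k"
    by (rule poisson_convolution) auto
  also have "measure \<nu> {x} + measure \<nu> F = measure \<nu> (insert x F)"
  proof -
    have "emeasure \<nu> F = (\<Sum>y\<in>F. emeasure \<nu> {y})"
      using F insert.hyps by (intro emeasure_eq_sum_singleton) (auto simp: sets_nu)
    then have "emeasure \<nu> F \<noteq> \<infinity>" using atoms F insert.hyps by (auto simp: less_top ennreal_sum_less_top)
    then show ?thesis using x F insert.hyps atoms[OF x] measure_Union[of \<nu> "{x}" F]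
      by (auto simp: sets_nu)
  qed
  finally show ?case .
qed

definition enum_part :: "'l set \<Rightarrow> nat \<Rightarrow> 'l set" where
  "enum_part A n = (if A = {} then {} else from_nat_into A ` {..<n})"

lemma enum_part:
  assumes "A \<subseteq> space \<nu>"
  shows "finite (enum_part A n)" "enum_part A n \<subseteq> A" "incseq (enum_part A)" "(\<Union>n. enum_part A n) = A"
proof -
  have c: "countable A" using assms countable_nu countable_subset by blast
  show "finite (enum_part A n)" by (simp add: enum_part_def)
  show "enum_part A n \<subseteq> A" using from_nat_into[of A] by (auto simp: enum_part_def simp del: ex_in_conv)
  show "incseq (enum_part A)" by (auto simp: enum_part_def incseq_def)
  have "(\<Union>n. from_nat_into A ` {..<n}) = range (from_nat_into A)" by auto
  then show "(\<Union>n. enum_part A n) = A"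
    using c by (auto simp: enum_part_def range_from_nat_into)
qed

lemma count_points_SUP:
  assumes "A \<subseteq> space \<nu>"
  shows "count_points A \<omega> = (SUP n. of_nat (\<Sum>x\<in>enum_part A n. \<omega> x))"
proof -
  note ap = enum_part[OF assms]
  have "count_points A \<omega> = (\<integral>\<^sup>+x. (SUP n. of_nat (\<omega> x) * indicator (enum_part A n) x) \<partial>count_space A)"
    unfolding count_points_def
  proof (intro nn_integral_cong antisym)
    fix x assume "x \<in> space (count_space A)"
    then obtain n where "x \<in> enum_part A n" using ap(4) by auto
    then show "of_nat (\<omega> x) \<le> (SUP n. of_nat (\<omega> x) * indicator (enum_part A n) x :: ennreal)"
      by (intro SUP_upper2[of n]) auto
  qed (auto intro!: SUP_least simp: indicator_def)
  also have "\<dots> = (SUP n. \<integral>\<^sup>+x. of_nat (\<omega> x) * indicator (enum_part A n) x \<partial>count_space A)"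
    using ap(3) by (intro nn_integral_monotone_convergence_SUP)
      (auto simp: incseq_def le_fun_def indicator_def)
  also have "\<dots> = (SUP n. of_nat (\<Sum>x\<in>enum_part A n. \<omega> x))"
  proof (intro SUP_cong refl)
    fix n
    have "(\<integral>\<^sup>+x. of_nat (\<omega> x) * indicator (enum_part A n) x \<partial>count_space A) =
          (\<Sum>x\<in>enum_part A n. of_nat (\<omega> x) * indicator (enum_part A n) x)"
      using ap(1,2) by (intro nn_integral_count_space') auto
    then show "(\<integral>\<^sup>+x. of_nat (\<omega> x) * indicator (enum_part A n) x \<partial>count_space A) =
       of_nat (\<Sum>x\<in>enum_part A n. \<omega> x)" by simp
  qed
  finally show ?thesis .
qed

lemma sum_enum_part_measurable [measurable]:
  assumes "A \<subseteq> space \<nu>"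
  shows "(\<lambda>\<omega>. \<Sum>x\<in>enum_part A n. \<omega> x) \<in> measurable P (count_space UNIV)"
  by measurable (use enum_part(2)[OF assms] assms in auto)

lemma count_points_measurable [measurable]:
  assumes "A \<subseteq> space \<nu>"
  shows "count_points A \<in> borel_measurable P"
proof -
  have [measurable]: "(\<lambda>\<omega>. of_nat (\<Sum>x\<in>enum_part A n. \<omega> x) :: ennreal) \<in> borel_measurable P" for n
    by (rule measurable_compose[OF sum_enum_part_measurable[OF assms]]) simp
  show ?thesis
    by (subst measurable_cong[OF count_points_SUP[OF assms]]) measurable
qed

lemma indep_counts:
  assumes "\<A> \<subseteq> sets \<nu>" "disjoint \<A>"
  shows "P.indep_vars (\<lambda>_. borel) count_points \<A>"
proof -
  have "P.indep_vars (\<lambda>A. PiM A (\<lambda>_. count_space UNIV)) (\<lambda>A \<omega>. restrict (\<lambda>y. \<omega> y) A) \<A>"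
    using assms
    by (intro P.indep_vars_restrict[OF indep_coords])
       (auto simp: disjoint_family_on_disjoint_image sets_nu disjoint_def disjoint_family_on_def)
  then have "P.indep_vars (\<lambda>_. borel) (\<lambda>A \<omega>. count_points A (restrict (\<lambda>y. \<omega> y) A)) \<A>"
  proof (rule P.indep_vars_compose2)
    fix A assume "A \<in> \<A>"
    then have A: "A \<subseteq> space \<nu>" using assms by (auto simp: sets_nu)
    have s: "(\<lambda>\<omega>. \<Sum>x\<in>enum_part A n. \<omega> x) \<in> measurable (PiM A (\<lambda>_. count_space (UNIV :: nat set))) (count_space UNIV)" for n
      by measurable (use enum_part(2)[OF A] in auto)
    have [measurable]: "(\<lambda>\<omega>. of_nat (\<Sum>x\<in>enum_part A n. \<omega> x) :: ennreal) \<in> borel_measurable (PiM A (\<lambda>_. count_space UNIV))" for n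
      by (rule measurable_compose[OF s]) simp
    show "count_points A \<in> borel_measurable (PiM A (\<lambda>_. count_space UNIV))"
      by (subst measurable_cong[OF count_points_SUP[OF A]]) measurable
  qed
  moreover have "(\<lambda>A \<omega>. count_points A (restrict (\<lambda>y. \<omega> y) A)) = (count_points :: 'l set \<Rightarrow> _)"
    unfolding count_points_def by (intro ext nn_integral_cong) auto
  ultimately show ?thesis by simp
qed

definition pcdf :: "real \<Rightarrow> nat \<Rightarrow> real" where
  "pcdf r k = (\<Sum>j\<le>k. r ^ j / fact j * exp (- r))"

lemma prob_le_limit:
  assumes A: "A \<subseteq> space \<nu>"
  shows "(\<lambda>n. pcdf (measure \<nu> (enum_part A n)) k) \<longlonglongrightarrow> P.prob {\<omega>\<in>space P. count_points A \<omega> \<le> of_nat k}"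
proof -
  note ap = enum_part[OF A]
  have fin: "finite (enum_part A n)" "enum_part A n \<subseteq> space \<nu>" for n using ap A by auto
  define B where "B n = {\<omega>\<in>space P. (\<Sum>x\<in>enum_part A n. \<omega> x) \<le> k}" for n
  have Bm: "B n \<in> sets P" for n
    unfolding B_def using sum_enum_part_measurable[OF A, of n] by measurable
  have pB: "P.prob (B n) = pcdf (measure \<nu> (enum_part A n)) k" for n
  proof -
    have "B n = (\<Union>j\<in>{..k}. {\<omega>\<in>space P. (\<Sum>x\<in>enum_part A n. \<omega> x) = j})" by (auto simp: B_def)
    also have "P.prob \<dots> = (\<Sum>j\<le>k. P.prob {\<omega>\<in>space P. (\<Sum>x\<in>enum_part A n. \<omega> x) = j})"
      using sum_enum_part_measurable[OF A, of n]
      by (intro P.finite_measure_finite_Union) (auto simp: disjoint_family_on_def)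
    finally show ?thesis
      by (simp add: finite_sum_poisson[OF fin] pmf_poisson_eq pcdf_def)
  qed
  have "decseq B"
    unfolding B_def decseq_def
    using ap(1) incseqD[OF ap(3)] by (safe, elim order_trans[rotated]) (intro sum_mono2, auto)
  then have "(\<lambda>n. P.prob (B n)) \<longlonglongrightarrow> P.prob (\<Inter>n. B n)"
    using Bm by (intro P.finite_Lim_measure_decseq) auto
  also have "(\<Inter>n. B n) = {\<omega>\<in>space P. count_points A \<omega> \<le> of_nat k}"
    by (auto simp: B_def count_points_SUP[OF A] SUP_le_iff simp del: of_nat_sum)
  finally show ?thesis by (simp add: pB)
qed

lemma tendsto_measure_enum_part:
  assumes A: "A \<subseteq> space \<nu>"
  shows "(\<lambda>n. emeasure \<nu> (enum_part A n)) \<longlonglongrightarrow> emeasure \<nu> A"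
proof -
  have "range (enum_part A) \<subseteq> sets \<nu>" using enum_part(2)[OF A] A by (auto simp: sets_nu)
  then show ?thesis using Lim_emeasure_incseq[of "enum_part A" \<nu>] enum_part[OF A] by simp
qed

lemma finite_enum_part:
  assumes A: "A \<subseteq> space \<nu>"
  shows "emeasure \<nu> (enum_part A n) < \<infinity>"
proof -
  have "emeasure \<nu> (enum_part A n) = (\<Sum>y\<in>enum_part A n. emeasure \<nu> {y})"
    using enum_part[OF A] A by (intro emeasure_eq_sum_singleton) (auto simp: sets_nu)
  then show ?thesis using atoms enum_part(1,2)[OF A, of n] A by (auto simp: ennreal_sum_less_top)
qed

lemma prob_le_finite:
  assumes A: "A \<subseteq> space \<nu>" and f: "emeasure \<nu> A < \<infinity>"
  shows "P.prob {\<omega>\<in>space P. count_points A \<omega> \<le> of_nat k} = pcdf (measure \<nu> A) k"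
proof -
  have "(\<lambda>n. measure \<nu> (enum_part A n)) \<longlonglongrightarrow> measure \<nu> A"
    unfolding measure_def
    using tendsto_measure_enum_part[OF A] f by (intro tendsto_enn2real) (auto simp: less_top)
  then have "(\<lambda>n. pcdf (measure \<nu> (enum_part A n)) k) \<longlonglongrightarrow> pcdf (measure \<nu> A) k"
    unfolding pcdf_def by (intro tendsto_intros) auto
  then show ?thesis using prob_le_limit[OF A] LIMSEQ_unique by blast
qed

lemma count_points_nat_or_top:
  assumes A: "A \<subseteq> space \<nu>" and "count_points A \<omega> < \<infinity>"
  obtains k where "count_points A \<omega> = of_nat k"
proof -
  have *: "incseq (\<lambda>n. \<Sum>x\<in>enum_part A n. \<omega> x)"
    using enum_part(1)[OF A] incseqD[OF enum_part(3)[OF A]] by (auto simp: incseq_def intro!: sum_mono2)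
  obtain m :: nat where m: "count_points A \<omega> \<le> of_nat m"
    using assms(2) by (metis infinity_ennreal_def ennreal_Ex_less_of_nat less_imp_le)
  then have bd: "(\<Sum>x\<in>enum_part A n. \<omega> x) \<le> m" for n
    using count_points_SUP[OF A, of \<omega>] by (simp add: SUP_le_iff del: of_nat_sum)
  define k where "k = Max (range (\<lambda>n. \<Sum>x\<in>enum_part A n. \<omega> x))"
  have fin: "finite (range (\<lambda>n. \<Sum>x\<in>enum_part A n. \<omega> x))"
    by (rule finite_subset[of _ "{..m}"]) (use bd in blast, simp)
  then have "k \<in> range (\<lambda>n. \<Sum>x\<in>enum_part A n. \<omega> x)" unfolding k_def by (intro Max_in) auto
  then obtain n where n: "k = (\<Sum>x\<in>enum_part A n. \<omega> x)" by auto
  have "count_points A \<omega> = of_nat k"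
    unfolding count_points_SUP[OF A]
  proof (rule antisym)
    show "(SUP n. of_nat (\<Sum>x\<in>enum_part A n. \<omega> x)) \<le> (of_nat k :: ennreal)"
      using fin by (intro SUP_least) (auto simp: k_def simp del: of_nat_sum intro!: Max_ge)
    show "(of_nat k :: ennreal) \<le> (SUP n. of_nat (\<Sum>x\<in>enum_part A n. \<omega> x))"
      unfolding n by (rule SUP_upper) simp
  qed
  then show ?thesis by (rule that)
qed

lemma prob_eq_finite:
  assumes A: "A \<subseteq> space \<nu>" and f: "emeasure \<nu> A < \<infinity>"
  shows "P.prob {\<omega>\<in>space P. count_points A \<omega> = of_nat k} = pmf (poisson (measure \<nu> A)) k"
proof (cases k)
  case 0
  have "{\<omega>\<in>space P. count_points A \<omega> = of_nat k} = {\<omega>\<in>space P. count_points A \<omega> \<le> of_nat 0}"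
    using 0 by auto
  then show ?thesis using 0 prob_le_finite[OF A f, of 0] by (simp add: pcdf_def pmf_poisson_eq)
next
  case (Suc j)
  have eq: "{\<omega>\<in>space P. count_points A \<omega> = of_nat k} =
     {\<omega>\<in>space P. count_points A \<omega> \<le> of_nat k} - {\<omega>\<in>space P. count_points A \<omega> \<le> of_nat j}"
  proof (safe)
    fix \<omega> assume "count_points A \<omega> = of_nat k" "count_points A \<omega> \<le> of_nat j"
    then show False using Suc by (simp del: of_nat_Suc)
  next
    fix \<omega> assume a: "count_points A \<omega> \<le> of_nat k" "\<not> count_points A \<omega> \<le> of_nat j"
    have "count_points A \<omega> < \<infinity>" using a(1) by (rule le_less_trans) (simp add: of_nat_less_top)
    then obtain i where i: "count_points A \<omega> = of_nat i" using count_points_nat_or_top[OF A] by blast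
    with a Suc have "i = k" by (simp del: of_nat_Suc)
    with i show "count_points A \<omega> = of_nat k" by simp
  qed auto
  have [measurable]: "count_points A \<in> borel_measurable P" using A by measurable
  have "P.prob {\<omega>\<in>space P. count_points A \<omega> = of_nat k} = pcdf (measure \<nu> A) k - pcdf (measure \<nu> A) j"
    unfolding eq
  proof (subst P.finite_measure_Diff)
    have "(of_nat j :: ennreal) \<le> of_nat k" using Suc by (simp del: of_nat_Suc)
    then show "{\<omega>\<in>space P. count_points A \<omega> \<le> of_nat j} \<subseteq> {\<omega>\<in>space P. count_points A \<omega> \<le> of_nat k}"
      using order_trans by blast
  qed (simp_all add: prob_le_finite[OF A f])
  then show ?thesis using Suc by (simp add: pcdf_def pmf_poisson_eq)
qed

lemma infinite_count:
  assumes A: "A \<subseteq> space \<nu>" and f: "emeasure \<nu> A = \<infinity>"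
  shows "AE \<omega> in P. count_points A \<omega> = \<infinity>"
proof -
  have [measurable]: "count_points A \<in> borel_measurable P" using A by measurable
  have "filterlim (\<lambda>n. measure \<nu> (enum_part A n)) at_top sequentially"
  proof (rule filterlim_at_top[THEN iffD2], intro allI)
    fix Z :: real
    have "eventually (\<lambda>n. ennreal Z < emeasure \<nu> (enum_part A n)) sequentially"
      using order_tendstoD(1)[OF tendsto_measure_enum_part[OF A], of "ennreal Z"] f by simp
    then show "eventually (\<lambda>n. Z \<le> measure \<nu> (enum_part A n)) sequentially"
    proof eventually_elim
      case (elim n)
      have "emeasure \<nu> (enum_part A n) = ennreal (measure \<nu> (enum_part A n))"
        using finite_enum_part[OF A, of n] by (intro emeasure_eq_ennreal_measure) auto
      with elim show ?case by (metis ennreal_less_iff less_imp_le not_less ennreal_leI linorder_not_le)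
    qed
  qed
  moreover have "((\<lambda>r. pcdf r k) \<longlongrightarrow> 0) at_top" for k
  proof -
    have "((\<lambda>r::real. \<Sum>j\<le>k. r ^ j / fact j * exp (- r)) \<longlongrightarrow> (\<Sum>j\<le>k. 0)) at_top"
    proof (intro tendsto_sum)
      fix j
      have "((\<lambda>r::real. (r ^ j / exp r) / fact j) \<longlongrightarrow> 0 / fact j) at_top"
        by (intro tendsto_divide tendsto_power_div_exp_0 tendsto_const) auto
      then show "((\<lambda>r::real. r ^ j / fact j * exp (- r)) \<longlongrightarrow> 0) at_top"
        by (simp add: exp_minus field_simps)
    qed
    then show ?thesis by (simp add: pcdf_def)
  qed
  ultimately have "(\<lambda>n. pcdf (measure \<nu> (enum_part A n)) k) \<longlonglongrightarrow> 0" for k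
    using filterlim_compose by blast
  then have "P.prob {\<omega>\<in>space P. count_points A \<omega> \<le> of_nat k} = 0" for k
    using prob_le_limit[OF A] LIMSEQ_unique by blast
  then have "AE \<omega> in P. \<not> count_points A \<omega> \<le> of_nat k" for k
    by (subst AE_iff_measurable[OF _ refl]) (auto simp: P.emeasure_eq_measure)
  then have "AE \<omega> in P. \<forall>k. \<not> count_points A \<omega> \<le> of_nat k"
    by (simp add: AE_all_countable)
  then show ?thesis
  proof eventually_elim
    case (elim \<omega>)
    show ?case
    proof (rule ccontr)
      assume "count_points A \<omega> \<noteq> \<infinity>"
      then have "count_points A \<omega> < \<infinity>" by (simp add: less_top)
      then show False using elim count_points_nat_or_top[OF A] by (metis order_refl)
    qed
  qed
qed

lemma is_poisson_process: "is_poisson_process \<nu> P"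
  unfolding is_poisson_process_def
  using prob_space_P sets_P prob_eq_finite infinite_count indep_counts by (auto simp: sets_nu)

end


section \<open>Loop percolation\<close>

definition loop_soup ::
    "'a set \<Rightarrow> 'a set set \<Rightarrow> real \<Rightarrow> real \<Rightarrow> ('a list set \<Rightarrow> nat) measure" where
  "loop_soup V E \<alpha> \<kappa> = poisson_process (scale_measure (ennreal \<alpha>) (loop_measure V E \<kappa>))"

lemma loop_soup_is_poisson_process:
  assumes "countable V"
  shows "is_poisson_process (scale_measure (ennreal \<alpha>) (loop_measure V E \<kappa>)) (loop_soup V E \<alpha> \<kappa>)"
proof -
  have sp: "space (loop_measure V E \<kappa>) = loops V" by (simp add: loop_measure_def)
  interpret discrete_intensity "scale_measure (ennreal \<alpha>) (loop_measure V E \<kappa>)"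
  proof
    show "sets (scale_measure (ennreal \<alpha>) (loop_measure V E \<kappa>)) =
        Pow (space (scale_measure (ennreal \<alpha>) (loop_measure V E \<kappa>)))"
      by (simp add: loop_measure_def space_scale_measure)
    show "countable (space (scale_measure (ennreal \<alpha>) (loop_measure V E \<kappa>)))"
      using countable_loops[OF assms] by (simp add: sp space_scale_measure)
    fix l assume "l \<in> space (scale_measure (ennreal \<alpha>) (loop_measure V E \<kappa>))"
    then have "l \<in> loops V" by (simp add: sp space_scale_measure)
    then show "emeasure (scale_measure (ennreal \<alpha>) (loop_measure V E \<kappa>)) {l} < \<infinity>"
      by (simp add: loop_measure_atom ennreal_mult_less_top)
  qed
  show ?thesis unfolding loop_soup_def by (rule is_poisson_process)
qed

definition traversed_edges :: "'a list set \<Rightarrow> 'a set set" where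
  "traversed_edges l = {{xs ! i, xs ! (Suc i mod length xs)} | xs i. xs \<in> l \<and> i < length xs}"

definition open_edges :: "'a set \<Rightarrow> 'a set set \<Rightarrow> ('a list set \<Rightarrow> nat) \<Rightarrow> 'a set set" where
  "open_edges V E \<omega> = {e\<in>E. \<exists>l\<in>loops V. 0 < \<omega> l \<and> e \<in> traversed_edges l}"

definition open_cluster ::
    "'a set \<Rightarrow> 'a set set \<Rightarrow> ('a list set \<Rightarrow> nat) \<Rightarrow> 'a \<Rightarrow> 'a set" where
  "open_cluster V E \<omega> x = {y. linked (open_edges V E \<omega>) x y}"

definition theta :: "'d::finite itself \<Rightarrow> real \<Rightarrow> real \<Rightarrow> real" where
  "theta d \<alpha> \<kappa> =
     (if \<alpha> = 0 then 0
      else let E = zd_edges :: (int ^ 'd) set set; P = loop_soup UNIV E \<alpha> \<kappa>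
           in measure P {\<omega>\<in>space P. infinite (open_cluster UNIV E \<omega> 0)})"

text \<open>The thresholds are extended reals, so that the infimum of the empty set is \<open>\<infinity>\<close>.\<close>

definition alpha_c :: "'d::finite itself \<Rightarrow> real \<Rightarrow> ereal" where
  "alpha_c d \<kappa> = Inf {ereal \<alpha> | \<alpha>. 0 \<le> \<alpha> \<and> 0 < theta d \<alpha> \<kappa>}"

definition kappa_c :: "'d::finite itself \<Rightarrow> real \<Rightarrow> ereal" where
  "kappa_c d \<alpha> = Inf {ereal \<kappa> | \<kappa>. -1 < \<kappa> \<and> theta d \<alpha> \<kappa> = 0}"

end

theory Submission
  imports Defs "HOL-Real_Asymp.Real_Asymp"
begin

text \<open>
  Recurrent graphs: rerooting loops at their visits to \<open>x\<close> shows that the loops with \<open>N\<close> visits to \<open>x\<close>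
  that traverse a fixed edge at \<open>x\<close> have mass at least \<open>c / N\<close>, because the first return loops at \<open>x\<close>
  have total weight 1. Summing over \<open>N\<close>, the loops through each edge have infinite mass, so every
  edge is open almost surely. For \<open>\<kappa> < 0\<close> the same conclusion holds on the lattice because the return
  probability decays only polynomially, whereas the weights grow exponentially with the length.

  In dimension at least 3 the loops that meet a box of side \<open>s\<close> and have diameter more than \<open>s\<close> have mass
  at most a constant \<open>C\<close>, uniformly in \<open>s\<close>. If no loop of diameter more than \<open>r\<close> is present near the box,
  then a crossing of the annulus at scale \<open>12 r\<close> contains two crossings at scale \<open>r\<close> that depend on
  disjoint sets of loops. Hence the crossing probabilities obey \<open>q (12 r) \<le> N (\<alpha> C) + N\<^sup>2 (q r)\<^sup>2\<close> for a
  constant \<open>N\<close>, and they stay small at all scales once \<open>\<alpha>\<close> is small. So an infinite cluster exists with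
  probability less than 1, and by the zero-one law with probability 0.

  The heat kernel bound behind \<open>C\<close> comes from projecting the walk to a discrete torus of side of order
  \<open>sqrt n\<close>, where the return probability is a finite sum over characters.
\<close>


section \<open>Paths of the walk and weights of loops\<close>

text \<open>The obstacle is dependence at all distances: one large loop can join regions that are
  far apart, and the bound on the mass of such loops near a box does not improve with the side s.
  Hence the renormalization inequality carries an additive term of the same size at every scale. It
  keeps crossing probabilities small but does not send them to 0, and this is why a zero-one law has
  to finish the argument. The dimension d enters through that mass. Closed paths of length n that
  meet a box of side s contribute about (1/n) n^(-d/2) (n s^(d-2)), where n s^(d-2) is the hitting
  probability summed over all roots; over n >= s^2 this adds up to a constant exactly when d >= 3. A
  loop shorter than s^2 has diameter above s only through an untypical excursion, whose cost comes
  from Gaussian tails; such loops add one more constant.\<close>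

primrec path_pmf :: "'a set set \<Rightarrow> nat \<Rightarrow> 'a \<Rightarrow> 'a list pmf" where
  "path_pmf E 0 x = return_pmf [x]"
| "path_pmf E (Suc n) x = bind_pmf (walk_step E x) (\<lambda>y. map_pmf ((#) x) (path_pmf E n y))"

text \<open>A list with at most one vertex has weight 1. A loop does not repeat its root, so its
  transitions are those of the path \<open>xs @ [hd xs]\<close>.\<close>

fun path_weight :: "'a set set \<Rightarrow> 'a list \<Rightarrow> real" where
  "path_weight E (a # b # w) = transition E a b * path_weight E (b # w)"
| "path_weight E w = 1"

lemma path_weight_nonneg: "0 \<le> path_weight E w"
  by (induction E w rule: path_weight.induct) (auto simp: transition_def)

text \<open>Both factors contain the vertex \<open>a\<close>, so every transition is counted once.
  Concatenation, rotation and reversal of loops rest on this.\<close>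

lemma path_weight_append: "path_weight E (u @ a # v) = path_weight E (u @ [a]) * path_weight E (a # v)"
proof (induction u)
  case (Cons b u)
  then show ?case by (cases u) auto
qed simp

lemma path_weight_conv_prod:
  "path_weight E w = (\<Prod>i<length w - 1. transition E (w ! i) (w ! Suc i))"
proof (induction E w rule: path_weight.induct)
  case (1 E a b w)
  then show ?case by (simp add: prod.lessThan_Suc_shift del: prod.lessThan_Suc)
qed auto

lemma pmf_path_pmf:
  "pmf (path_pmf E n x) w = (if length w = Suc n \<and> hd w = x then path_weight E w else 0)"
proof (induction n arbitrary: x w)
  case 0
  show ?case
    by (cases w) (auto simp: pmf_return)
next
  case (Suc n)
  show ?case
  proof (cases "length w = Suc (Suc n) \<and> hd w = x")
    case False
    have "w \<notin> set_pmf (path_pmf E (Suc n) x)"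
    proof
      assume "w \<in> set_pmf (path_pmf E (Suc n) x)"
      then obtain y v where "v \<in> set_pmf (path_pmf E n y)" "w = x # v" by auto
      then show False using False Suc.IH[of y v] by (auto simp: set_pmf_iff split: if_splits)
    qed
    then have "pmf (path_pmf E (Suc n) x) w = 0" by (simp only: set_pmf_iff not_not)
    then show ?thesis using False by (simp only: if_False)
  next
    case True
    then obtain b v where w: "w = x # b # v" "length v = n"
      by (cases w; cases "tl w") auto
    have "pmf (map_pmf ((#) x) (path_pmf E n y)) w = indicator {b} y * path_weight E (b # v)" for y
      using Suc.IH[of y "b # v"] w pmf_map_inj'[of "(#) x" "path_pmf E n y" "b # v"]
      by (auto simp: indicator_def)
    then have "pmf (path_pmf E (Suc n) x) w = (\<integral>y. indicator {b} y * path_weight E (b # v) \<partial>walk_step E x)"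
      by (simp add: pmf_bind)
    also have "\<dots> = transition E x b * path_weight E (b # v)"
      by (simp add: transition_def measure_pmf_single)
    finally show ?thesis using w by simp
  qed
qed

lemma set_path_pmf_length: "w \<in> set_pmf (path_pmf E n x) \<Longrightarrow> length w = Suc n \<and> hd w = x"
  by (auto simp: set_pmf_iff pmf_path_pmf split: if_splits)

text \<open>Markov property at time \<open>m\<close>: the walk restarts at \<open>last w\<close>,
  and \<open>tl\<close> drops that vertex from the second piece because it already ends the
  first.\<close>

lemma path_pmf_add:
  "path_pmf E (m + n) x =
     bind_pmf (path_pmf E m x) (\<lambda>w. map_pmf (\<lambda>v. w @ tl v) (path_pmf E n (last w)))"
proof (induction m arbitrary: x)
  case 0
  have "map_pmf (\<lambda>v. x # tl v) (path_pmf E n x) = map_pmf (\<lambda>v. v) (path_pmf E n x)"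
  proof (rule map_pmf_cong[OF refl])
    fix v assume "v \<in> set_pmf (path_pmf E n x)"
    from set_path_pmf_length[OF this] show "x # tl v = v" by (cases v) auto
  qed
  then show ?case by (simp add: bind_return_pmf)
next
  case (Suc m)
  have "map_pmf (\<lambda>v. (x # w) @ tl v) (path_pmf E n (last (x # w))) =
      map_pmf ((#) x) (map_pmf (\<lambda>v. w @ tl v) (path_pmf E n (last w)))"
    if "w \<in> set_pmf (path_pmf E m y)" for w y
    using set_path_pmf_length[OF that] by (auto simp: map_pmf_comp)
  then show ?case
    by (simp add: Suc.IH bind_assoc_pmf map_bind_pmf bind_map_pmf cong: bind_pmf_cong)
qed

lemma loop_weight_conv_path_weight:
  assumes "xs \<noteq> []"
  shows "loop_weight E \<kappa> xs =
     1 / real (length xs) * (1 / (1 + \<kappa>)) ^ length xs * path_weight E (xs @ [hd xs])"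
proof -
  have "(\<Prod>i<length xs. transition E (xs ! i) (xs ! (Suc i mod length xs))) =
      (\<Prod>i<length xs. transition E ((xs @ [hd xs]) ! i) ((xs @ [hd xs]) ! Suc i))"
  proof (rule prod.cong[OF refl])
    fix i assume "i \<in> {..<length xs}"
    then have i: "i < length xs" by simp
    show "transition E (xs ! i) (xs ! (Suc i mod length xs)) =
        transition E ((xs @ [hd xs]) ! i) ((xs @ [hd xs]) ! Suc i)"
    proof (cases "Suc i = length xs")
      case True
      then show ?thesis using i assms by (simp add: nth_append hd_conv_nth)
    next
      case False
      then show ?thesis using i by (simp add: nth_append)
    qed
  qed
  then show ?thesis by (simp add: loop_weight_def path_weight_conv_prod)
qed

lemma emeasure_based_loop_measure:
  assumes "A \<subseteq> based_loops V"
  shows "emeasure (based_loop_measure V E \<kappa>) A = (\<integral>\<^sup>+xs. ennreal (loop_weight E \<kappa> xs) \<partial>count_space A)"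
proof -
  have "emeasure (based_loop_measure V E \<kappa>) A =
      (\<integral>\<^sup>+xs. ennreal (loop_weight E \<kappa> xs) * indicator A xs \<partial>count_space (based_loops V))"
    unfolding based_loop_measure_def point_measure_def using assms by (subst emeasure_density) auto
  also have "\<dots> = (\<integral>\<^sup>+xs. ennreal (loop_weight E \<kappa> xs) \<partial>count_space A)"
    using assms
    by (subst nn_integral_count_space_indicator, simp)
       (auto simp: nn_integral_count_space_indicator indicator_def intro!: nn_integral_cong)
  finally show ?thesis .
qed

lemma emeasure_path_pmf_closed:
  assumes A: "\<And>xs. xs \<in> A \<Longrightarrow> length xs = n \<and> hd xs = x" and n: "0 < n"
  shows "emeasure (path_pmf E n x) {xs @ [x] | xs. xs \<in> A} =
    (\<integral>\<^sup>+xs. ennreal (path_weight E (xs @ [hd xs])) \<partial>count_space A)"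
proof -
  have "bij_betw (\<lambda>xs. xs @ [x]) A {xs @ [x] | xs. xs \<in> A}"
    by (auto simp: bij_betw_def inj_on_def)
  then have "(\<integral>\<^sup>+w. ennreal (pmf (path_pmf E n x) w) \<partial>count_space {xs @ [x] | xs. xs \<in> A}) =
      (\<integral>\<^sup>+xs. ennreal (pmf (path_pmf E n x) (xs @ [x])) \<partial>count_space A)"
    by (rule nn_integral_bij_count_space[symmetric])
  also have "\<dots> = (\<integral>\<^sup>+xs. ennreal (path_weight E (xs @ [hd xs])) \<partial>count_space A)"
  proof (rule nn_integral_cong)
    fix xs assume "xs \<in> space (count_space A)"
    then have "length xs = n" "hd xs = x" "xs \<noteq> []" using A[of xs] n by auto
    then show "ennreal (pmf (path_pmf E n x) (xs @ [x])) = ennreal (path_weight E (xs @ [hd xs]))"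
      by (simp add: pmf_path_pmf)
  qed
  finally show ?thesis by (simp add: nn_integral_pmf)
qed

text \<open>For a fixed root and length the factor in front of the transitions is constant, so a
  mass of loops becomes a probability that the walk returns. The lattice estimates pass through this
  identity.\<close>

lemma emeasure_based_loop_measure_rooted:
  assumes A: "A \<subseteq> based_loops V" "\<And>xs. xs \<in> A \<Longrightarrow> length xs = n \<and> hd xs = x"
    and n: "0 < n" and \<kappa>: "-1 < \<kappa>"
  shows "emeasure (based_loop_measure V E \<kappa>) A =
    ennreal (1 / real n * (1 / (1 + \<kappa>)) ^ n) * emeasure (path_pmf E n x) {xs @ [x] | xs. xs \<in> A}"
proof -
  have "emeasure (based_loop_measure V E \<kappa>) A =
    (\<integral>\<^sup>+xs. ennreal (1 / real n * (1 / (1 + \<kappa>)) ^ n) * ennreal (path_weight E (xs @ [hd xs])) \<partial>count_space A)"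
    unfolding emeasure_based_loop_measure[OF A(1)]
  proof (rule nn_integral_cong)
    fix xs assume "xs \<in> space (count_space A)"
    then have l: "length xs = n" using A(2) by auto
    then have ne: "xs \<noteq> []" using n by auto
    show "ennreal (loop_weight E \<kappa> xs) =
      ennreal (1 / real n * (1 / (1 + \<kappa>)) ^ n) * ennreal (path_weight E (xs @ [hd xs]))"
      unfolding loop_weight_conv_path_weight[OF ne] l using \<kappa>
      by (intro ennreal_mult) (auto simp: path_weight_nonneg)
  qed
  also have "\<dots> = ennreal (1 / real n * (1 / (1 + \<kappa>)) ^ n) * (\<integral>\<^sup>+xs. ennreal (path_weight E (xs @ [hd xs])) \<partial>count_space A)"
    by (rule nn_integral_cmult) simp
  finally show ?thesis by (simp add: emeasure_path_pmf_closed[OF A(2) n])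
qed

section \<open>The loop soup as a percolation model\<close>

lemma discrete_intensity_loop_measure:
  assumes "countable V"
  shows "discrete_intensity (scale_measure (ennreal \<alpha>) (loop_measure V E \<kappa>))"
proof
  show "sets (scale_measure (ennreal \<alpha>) (loop_measure V E \<kappa>)) =
      Pow (space (scale_measure (ennreal \<alpha>) (loop_measure V E \<kappa>)))"
    by (simp add: loop_measure_def space_scale_measure)
  show "countable (space (scale_measure (ennreal \<alpha>) (loop_measure V E \<kappa>)))"
    using countable_loops[OF assms] by (simp add: loop_measure_def space_scale_measure)
  fix l assume "l \<in> space (scale_measure (ennreal \<alpha>) (loop_measure V E \<kappa>))"
  then have "l \<in> loops V" by (simp add: loop_measure_def space_scale_measure)
  then show "emeasure (scale_measure (ennreal \<alpha>) (loop_measure V E \<kappa>)) {l} < \<infinity>"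
    by (simp add: loop_measure_atom ennreal_mult_less_top)
qed

lemma space_loop_measure: "space (loop_measure V E \<kappa>) = loops V"
  by (simp add: loop_measure_def)

lemma emeasure_loop_measure:
  assumes "S \<subseteq> loops V"
  shows "emeasure (loop_measure V E \<kappa>) S =
    emeasure (based_loop_measure V E \<kappa>) {xs\<in>based_loops V. rotation_equiv V `` {xs} \<in> S}"
proof -
  have "emeasure (loop_measure V E \<kappa>) S =
     emeasure (based_loop_measure V E \<kappa>) ((\<lambda>xs. rotation_equiv V `` {xs}) -` S \<inter> based_loops V)"
    unfolding loop_measure_def using assms
    by (subst emeasure_distr) (auto simp: based_loop_measure_def space_point_measure loops_def quotientI)
  also have "(\<lambda>xs. rotation_equiv V `` {xs}) -` S \<inter> based_loops V =
      {xs\<in>based_loops V. rotation_equiv V `` {xs} \<in> S}" by auto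
  finally show ?thesis .
qed

lemma prob_space_loop_soup: "countable V \<Longrightarrow> prob_space (loop_soup V E \<alpha> \<kappa>)"
  using discrete_intensity.prob_space_P[OF discrete_intensity_loop_measure] by (simp add: loop_soup_def)

lemma loop_soup_component_measurable:
  assumes "countable V" "l \<in> loops V"
  shows "(\<lambda>\<omega>. \<omega> l) \<in> measurable (loop_soup V E \<alpha> \<kappa>) (count_space UNIV)"
  unfolding loop_soup_def
  using assms by (intro discrete_intensity.coord_measurable[OF discrete_intensity_loop_measure])
    (auto simp: space_loop_measure space_scale_measure)

lemma count_points_eq_0_iff: "count_points S \<omega> = 0 \<longleftrightarrow> (\<forall>l\<in>S. \<omega> l = 0)"
  unfolding count_points_def by (subst nn_integral_0_iff) (auto simp: emeasure_count_space_eq_0)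

lemma AE_loop_soup_present:
  assumes V: "countable V" and S: "S \<subseteq> loops V" and \<alpha>: "0 < \<alpha>"
    and inf: "emeasure (loop_measure V E \<kappa>) S = \<infinity>"
  shows "AE \<omega> in loop_soup V E \<alpha> \<kappa>. \<exists>l\<in>S. 0 < \<omega> l"
proof -
  interpret discrete_intensity "scale_measure (ennreal \<alpha>) (loop_measure V E \<kappa>)"
    by (rule discrete_intensity_loop_measure[OF V])
  have "AE \<omega> in loop_soup V E \<alpha> \<kappa>. count_points S \<omega> = \<infinity>"
    unfolding loop_soup_def using S \<alpha> inf
    by (intro infinite_count) (auto simp: space_scale_measure space_loop_measure ennreal_mult_eq_top_iff)
  then show ?thesis
  proof eventually_elim
    case (elim \<omega>)
    then have "count_points S \<omega> \<noteq> 0" by simp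
    then show ?case by (auto simp: count_points_eq_0_iff)
  qed
qed

lemma present_in_sets:
  assumes "countable V" "S \<subseteq> loops V"
  shows "{\<omega>\<in>space (loop_soup V E \<alpha> \<kappa>). \<exists>l\<in>S. 0 < \<omega> l} \<in> sets (loop_soup V E \<alpha> \<kappa>)"
proof -
  have c: "countable S" using assms countable_loops countable_subset by blast
  have "(\<lambda>\<omega>. \<omega> l) \<in> measurable (loop_soup V E \<alpha> \<kappa>) (count_space UNIV)" if "l \<in> S" for l
    using assms that by (intro loop_soup_component_measurable) auto
  then have "{\<omega>\<in>space (loop_soup V E \<alpha> \<kappa>). 0 < \<omega> l} \<in> sets (loop_soup V E \<alpha> \<kappa>)" if "l \<in> S" for l
    using that by measurable
  then have "(\<Union>l\<in>S. {\<omega>\<in>space (loop_soup V E \<alpha> \<kappa>). 0 < \<omega> l}) \<in> sets (loop_soup V E \<alpha> \<kappa>)"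
    using c by blast
  moreover have "(\<Union>l\<in>S. {\<omega>\<in>space (loop_soup V E \<alpha> \<kappa>). 0 < \<omega> l}) =
      {\<omega>\<in>space (loop_soup V E \<alpha> \<kappa>). \<exists>l\<in>S. 0 < \<omega> l}" by auto
  ultimately show ?thesis by simp
qed

text \<open>The number of points in \<open>S\<close> is Poisson, so some loop of \<open>S\<close> is
  present with probability 1 - exp(-m) <= m, where m is the intensity of \<open>S\<close>.\<close>

lemma prob_loop_soup_present_le:
  assumes V: "countable V" and S: "S \<subseteq> loops V" and \<alpha>: "0 \<le> \<alpha>"
    and c: "emeasure (loop_measure V E \<kappa>) S \<le> ennreal c" "0 \<le> c"
  shows "measure (loop_soup V E \<alpha> \<kappa>) {\<omega>\<in>space (loop_soup V E \<alpha> \<kappa>). \<exists>l\<in>S. 0 < \<omega> l} \<le> \<alpha> * c"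
proof -
  let ?\<nu> = "scale_measure (ennreal \<alpha>) (loop_measure V E \<kappa>)"
  let ?P = "loop_soup V E \<alpha> \<kappa>"
  interpret discrete_intensity ?\<nu>
    by (rule discrete_intensity_loop_measure[OF V])
  have le: "emeasure ?\<nu> S \<le> ennreal (\<alpha> * c)"
    using c \<alpha> by (simp add: ennreal_mult mult_left_mono)
  then have fin: "emeasure ?\<nu> S < \<infinity>" by (simp add: le_less_trans)
  have m: "measure ?\<nu> S \<le> \<alpha> * c"
    unfolding measure_def using le \<alpha> c by (intro enn2real_leI) auto
  have "measure ?P {\<omega>\<in>space ?P. count_points S \<omega> = of_nat 0} = pmf (poisson (measure ?\<nu> S)) 0"
    unfolding loop_soup_def using S fin
    by (intro prob_eq_finite) (auto simp: space_scale_measure space_loop_measure)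
  then have z: "measure ?P {\<omega>\<in>space ?P. \<forall>l\<in>S. \<omega> l = 0} = exp (- measure ?\<nu> S)"
    by (simp add: pmf_poisson_eq count_points_eq_0_iff)
  interpret Q: prob_space ?P by (rule prob_space_loop_soup[OF V])
  have "{\<omega>\<in>space ?P. \<forall>l\<in>S. \<omega> l = 0} = space ?P - {\<omega>\<in>space ?P. \<exists>l\<in>S. 0 < \<omega> l}" by auto
  then have "measure ?P {\<omega>\<in>space ?P. \<exists>l\<in>S. 0 < \<omega> l} = 1 - exp (- measure ?\<nu> S)"
    using z Q.prob_compl[OF present_in_sets[OF V S, of E \<alpha> \<kappa>]] by simp
  also have "\<dots> \<le> measure ?\<nu> S" using exp_ge_add_one_self[of "- measure ?\<nu> S"] by linarith
  finally show ?thesis using m by simp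
qed

section \<open>Edges opened by part of the loops: measurability and independence\<close>

definition edges_from :: "'a set set \<Rightarrow> 'a list set set \<Rightarrow> ('a list set \<Rightarrow> nat) \<Rightarrow> 'a set set" where
  "edges_from E S \<omega> = {e\<in>E. \<exists>l\<in>S. 0 < \<omega> l \<and> e \<in> traversed_edges l}"

lemma open_edges_conv_edges_from: "open_edges V E = edges_from E (loops V)"
  by (auto simp: open_edges_def edges_from_def fun_eq_iff)

lemma edges_from_mono: "S \<subseteq> T \<Longrightarrow> edges_from E S \<omega> \<subseteq> edges_from E T \<omega>"
  by (auto simp: edges_from_def)

lemma edges_from_cong: "(\<And>l. l \<in> S \<Longrightarrow> \<omega> l = \<omega>' l) \<Longrightarrow> edges_from E S \<omega> = edges_from E S \<omega>'"
  by (auto simp: edges_from_def)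

lemma linked_mono: "F \<subseteq> F' \<Longrightarrow> linked F x y \<Longrightarrow> linked F' x y"
  unfolding linked_def by (erule rtranclp_mono[THEN predicate2D, rotated]) auto

lemma edge_measurable:
  assumes S: "countable S" "\<And>l. l \<in> S \<Longrightarrow> (\<lambda>\<omega>. \<omega> l) \<in> measurable M (count_space UNIV)"
  shows "Measurable.pred M (\<lambda>\<omega>. e \<in> edges_from E S \<omega>)"
proof -
  have "{\<omega>\<in>space M. 0 < \<omega> l \<and> e \<in> traversed_edges l} \<in> sets M" if "l \<in> S" for l
    using S(2)[OF that] by measurable
  then have "(\<Union>l\<in>S. {\<omega>\<in>space M. 0 < \<omega> l \<and> e \<in> traversed_edges l}) \<in> sets M"
    using S(1) by blast
  moreover have "{\<omega>\<in>space M. e \<in> edges_from E S \<omega>} =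
     (if e \<in> E then (\<Union>l\<in>S. {\<omega>\<in>space M. 0 < \<omega> l \<and> e \<in> traversed_edges l}) else {})"
    by (auto simp: edges_from_def)
  ultimately show ?thesis by (auto simp: pred_def)
qed

text \<open>Being linked is a union over the number of edges, and each further edge a union over one
  intermediate vertex; both are countable. \<open>M\<close> is left open because the lemma serves
  the soup, products over part of the coordinates and tail sigma-algebras.\<close>

lemma linked_measurable:
  fixes E :: "'a::countable set set"
  assumes S: "countable S" "\<And>l. l \<in> S \<Longrightarrow> (\<lambda>\<omega>. \<omega> l) \<in> measurable M (count_space UNIV)"
  shows "Measurable.pred M (\<lambda>\<omega>. linked (edges_from E S \<omega>) x y)"
proof -
  have [measurable]: "Measurable.pred M (\<lambda>\<omega>. ((\<lambda>u v. {u, v} \<in> edges_from E S \<omega>) ^^ n) x z)" for n z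
  proof (induction n arbitrary: z)
    case (Suc n)
    note [measurable] = Suc edge_measurable[OF S]
    show ?case by (simp add: relcompp_apply) measurable
  qed simp
  have "(\<lambda>\<omega>. linked (edges_from E S \<omega>) x y) =
     (\<lambda>\<omega>. \<exists>n. ((\<lambda>u v. {u, v} \<in> edges_from E S \<omega>) ^^ n) x y)"
    by (simp add: linked_def rtranclp_power fun_eq_iff)
  then show ?thesis by simp
qed

lemma infinite_cluster_measurable:
  fixes E :: "'a::countable set set"
  assumes S: "countable S" "\<And>l. l \<in> S \<Longrightarrow> (\<lambda>\<omega>. \<omega> l) \<in> measurable M (count_space UNIV)"
  shows "Measurable.pred M (\<lambda>\<omega>. infinite {y. linked (edges_from E S \<omega>) x y})"
proof -
  note [measurable] = linked_measurable[OF S]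
  have "infinite {y. linked (edges_from E S \<omega>) x y} \<longleftrightarrow>
     (\<forall>n. \<exists>y. n \<le> to_nat y \<and> linked (edges_from E S \<omega>) x y)" for \<omega>
  proof -
    have "infinite {y. linked (edges_from E S \<omega>) x y} \<longleftrightarrow>
       infinite (to_nat ` {y. linked (edges_from E S \<omega>) x y})"
      by (simp add: finite_image_iff)
    also have "\<dots> \<longleftrightarrow> (\<forall>n. \<exists>m\<ge>n. m \<in> to_nat ` {y. linked (edges_from E S \<omega>) x y})"
      by (rule infinite_nat_iff_unbounded_le)
    also have "\<dots> \<longleftrightarrow> (\<forall>n. \<exists>y. n \<le> to_nat y \<and> linked (edges_from E S \<omega>) x y)" by blast
    finally show ?thesis .
  qed
  then show ?thesis by simp
qed

text \<open>Invariance under \<open>restrict\<close> expresses that \<open>P1\<close> and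
  \<open>P2\<close> depend only on the multiplicities of the loops in \<open>S1\<close> and
  \<open>S2\<close>; disjoint blocks of independent coordinates are independent.\<close>

lemma indep_disjoint_loops:
  assumes V: "countable V" and S: "S1 \<subseteq> loops V" "S2 \<subseteq> loops V" "S1 \<inter> S2 = {}"
    and P1: "Measurable.pred (PiM S1 (\<lambda>_. count_space UNIV)) P1" "\<And>\<omega>. P1 (restrict \<omega> S1) \<longleftrightarrow> P1 \<omega>"
    and P2: "Measurable.pred (PiM S2 (\<lambda>_. count_space UNIV)) P2" "\<And>\<omega>. P2 (restrict \<omega> S2) \<longleftrightarrow> P2 \<omega>"
  shows "measure (loop_soup V E \<alpha> \<kappa>) {\<omega>\<in>space (loop_soup V E \<alpha> \<kappa>). P1 \<omega> \<and> P2 \<omega>} =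
    measure (loop_soup V E \<alpha> \<kappa>) {\<omega>\<in>space (loop_soup V E \<alpha> \<kappa>). P1 \<omega>} *
    measure (loop_soup V E \<alpha> \<kappa>) {\<omega>\<in>space (loop_soup V E \<alpha> \<kappa>). P2 \<omega>}"
proof -
  let ?\<nu> = "scale_measure (ennreal \<alpha>) (loop_measure V E \<kappa>)"
  interpret discrete_intensity ?\<nu>
    by (rule discrete_intensity_loop_measure[OF V])
  have sp: "space ?\<nu> = loops V" by (simp add: space_scale_measure space_loop_measure)
  have ind: "P.indep_vars (\<lambda>i. PiM (case_bool S1 S2 i) (\<lambda>_. count_space UNIV))
      (\<lambda>i \<omega>. restrict (\<lambda>y. \<omega> y) (case_bool S1 S2 i)) UNIV"
    using S by (intro P.indep_vars_restrict[OF indep_coords])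
       (auto simp: disjoint_family_on_def sp split: bool.splits)
  have "P.indep_vars (\<lambda>i. count_space (UNIV :: bool set))
      (\<lambda>i \<omega>. case_bool P1 P2 i (restrict (\<lambda>y. \<omega> y) (case_bool S1 S2 i))) (UNIV :: bool set)"
    by (rule P.indep_vars_compose2[OF ind]) (use P1(1) P2(1) in \<open>auto split: bool.splits simp: measurable_def pred_def\<close>)
  then have "P.prob (\<Inter>i\<in>UNIV. (\<lambda>\<omega>. case_bool P1 P2 i (restrict (\<lambda>y. \<omega> y) (case_bool S1 S2 i))) -` {True} \<inter> space P)
      = (\<Prod>i\<in>UNIV. P.prob ((\<lambda>\<omega>. case_bool P1 P2 i (restrict (\<lambda>y. \<omega> y) (case_bool S1 S2 i))) -` {True} \<inter> space P))"
    by (rule P.indep_varsD_finite) auto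
  then show ?thesis
    by (simp add: loop_soup_def UNIV_bool vimage_def Int_def conj_ac P1(2) P2(2) mult.commute)
qed

section \<open>Recurrent graphs\<close>

lemma nn_integral_count_space_subset:
  assumes "A \<subseteq> B"
  shows "(\<integral>\<^sup>+x. f x \<partial>count_space A) \<le> (\<integral>\<^sup>+x. f x \<partial>count_space B)"
proof -
  have "(\<integral>\<^sup>+x. f x * indicator A x \<partial>count_space UNIV) \<le> (\<integral>\<^sup>+x. f x * indicator B x \<partial>count_space UNIV)"
    using assms by (intro nn_integral_mono) (auto simp: indicator_def)
  then show ?thesis by (simp add: nn_integral_count_space_indicator)
qed

section \<open>The law of the trajectory and its first return\<close>

lemma prob_space_random_walk: "prob_space (random_walk E x)"
proof
  interpret Ionescu_Tulcea "walk_kernel E x" "\<lambda>_. count_space (UNIV :: 'a set)"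
    by (rule walk_kernel_Ionescu_Tulcea)
  let ?M = "PiM {} (\<lambda>_. count_space (UNIV :: 'a set))"
  \<comment> \<open>The limit measure is known on cylinders; the cylinder over no coordinate at all
    is the whole space.\<close>
  have "emeasure PF.lim (PF.emb UNIV {} (space ?M)) = emeasure (CI {}) (space ?M)"
    by (rule lim) auto
  also have "\<dots> = 1"
    using prob_space.emeasure_space_1[OF PF.prob_space_P[of "{}"]] PF.space_P[of "{}"] by simp
  also have "PF.emb UNIV {} (space ?M) = space PF.lim"
    by (auto simp: prod_emb_def space_PiM)
  finally show "emeasure (random_walk E x) (space (random_walk E x)) = 1"
    by (simp add: random_walk_def)
qed

lemma random_walk_prefix:
  assumes "w \<in> set_pmf (path_pmf E n x)"
  shows "{\<omega>. \<forall>i\<le>n. \<omega> i = w ! i} \<in> sets (random_walk E x)"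
    and "emeasure (random_walk E x) {\<omega>. \<forall>i\<le>n. \<omega> i = w ! i} = ennreal (pmf (path_pmf E n x) w)"
proof -
  interpret prob_space "random_walk E x" by (rule prob_space_random_walk)
  note l = set_path_pmf_length[OF assms]
  have hd: "w ! 0 = x" using l by (cases w) auto
  have "measure (random_walk E x) {\<omega>. \<forall>i\<le>n. \<omega> i = w ! i} = (\<Prod>i<n. transition E (w ! i) (w ! Suc i))"
    using random_walk_cylinder[of E x n "\<lambda>i. w ! i"] hd by simp
  also have "\<dots> = pmf (path_pmf E n x) w"
    using l by (simp add: pmf_path_pmf path_weight_conv_prod)
  finally have m: "measure (random_walk E x) {\<omega>. \<forall>i\<le>n. \<omega> i = w ! i} = pmf (path_pmf E n x) w" .
  then show "emeasure (random_walk E x) {\<omega>. \<forall>i\<le>n. \<omega> i = w ! i} = ennreal (pmf (path_pmf E n x) w)"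
    by (simp add: emeasure_eq_measure)
  \<comment> \<open>A nonmeasurable set has \<open>measure\<close> 0 by convention, while the value
    found here is positive on the support of \<open>path_pmf\<close>.\<close>
  show "{\<omega>. \<forall>i\<le>n. \<omega> i = w ! i} \<in> sets (random_walk E x)"
    using m assms measure_notin_sets by (force simp: set_pmf_iff)
qed

text \<open>The cylinders over the countably many supported prefixes are disjoint, and their
  probabilities add up to the total mass of \<open>path_pmf\<close>.\<close>

lemma AE_random_walk_prefix:
  "AE \<omega> in random_walk E x. map \<omega> [0..<Suc n] \<in> set_pmf (path_pmf E n x)"
proof -
  interpret prob_space "random_walk E x" by (rule prob_space_random_walk)
  let ?C = "\<lambda>w. {\<omega>. \<forall>i\<le>n. \<omega> i = w ! i}"
  let ?S = "set_pmf (path_pmf E n x)"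
  have map: "map \<omega> [0..<Suc n] = w" if "w \<in> ?S" "\<omega> \<in> ?C w" for \<omega> w
    using that set_path_pmf_length[OF that(1)] by (intro nth_equalityI) (auto simp del: upt_Suc)
  have meas: "(\<Union>w\<in>?S. ?C w) \<in> sets (random_walk E x)"
    by (intro sets.countable_UN' countable_set_pmf) (auto intro: random_walk_prefix)
  have "emeasure (random_walk E x) (\<Union>w\<in>?S. ?C w) = (\<integral>\<^sup>+w. emeasure (random_walk E x) (?C w) \<partial>count_space ?S)"
    by (intro emeasure_UN_countable random_walk_prefix countable_set_pmf)
       (auto simp: disjoint_family_on_def dest: map)
  also have "\<dots> = (\<integral>\<^sup>+w. ennreal (pmf (path_pmf E n x) w) \<partial>count_space ?S)"
    by (intro nn_integral_cong) (simp add: random_walk_prefix)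
  also have "\<dots> = 1"
    by (simp add: nn_integral_pmf measure_pmf.emeasure_eq_1_AE AE_measure_pmf)
  finally have "prob (\<Union>w\<in>?S. ?C w) = 1" by (simp add: emeasure_eq_measure)
  then have "AE \<omega> in random_walk E x. \<omega> \<in> (\<Union>w\<in>?S. ?C w)" by (rule AE_prob_1)
  then show ?thesis by eventually_elim (use map in \<open>auto simp del: upt_Suc\<close>)
qed

text \<open>Without isolated vertices every step runs along an edge, hence between distinct
  vertices, which is the condition on consecutive vertices in \<open>based_loops\<close>.\<close>

lemma set_path_pmf_graph:
  assumes G: "locally_finite_graph V E" and nb: "\<And>v. v \<in> V \<Longrightarrow> neighbours E v \<noteq> {}"
  shows "w \<in> set_pmf (path_pmf E n x) \<Longrightarrow> x \<in> V \<Longrightarrow> set w \<subseteq> V \<and> (\<forall>i<n. w ! i \<noteq> w ! Suc i)"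
proof (induction n arbitrary: x w)
  case (Suc n)
  then obtain y v where v: "y \<in> set_pmf (walk_step E x)" "v \<in> set_pmf (path_pmf E n y)" "w = x # v"
    by auto
  have "finite (neighbours E x)" using G Suc.prems by (auto simp: locally_finite_graph_def)
  then have "y \<in> neighbours E x" using v(1) nb[OF Suc.prems(2)] by (simp add: walk_step_def)
  then have "{x, y} \<in> E" by (simp add: neighbours_def)
  then have "y \<in> V" "x \<noteq> y" using G unfolding locally_finite_graph_def by (metis doubleton_eq_iff)+
  moreover have "v ! 0 = y" using set_path_pmf_length[OF v(2)] by (cases v) auto
  ultimately show ?case using Suc.IH[OF v(2)] v Suc.prems
    by (auto simp: nth_Cons split: nat.splits)
qed auto

definition first_return_loops :: "'a set \<Rightarrow> 'a \<Rightarrow> 'a list set" where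
  "first_return_loops V x = {u\<in>based_loops V. hd u = x \<and> x \<notin> set (tl u)}"

lemma countable_based_loops: "countable V \<Longrightarrow> countable (based_loops V)"
  by (rule countable_subset[OF _ countable_lists[of V]]) (auto simp: based_loops_def lists_eq_set)

text \<open>Recurrence makes the first return time finite almost surely, so the cylinders of the
  first return loops cover almost every trajectory. They are disjoint, and their probabilities are
  the weights being summed.\<close>

lemma first_return_weight:
  assumes G: "locally_finite_graph V E" and nb: "\<And>v. v \<in> V \<Longrightarrow> neighbours E v \<noteq> {}"
    and x: "x \<in> V" and rec: "AE \<omega> in random_walk E x. \<exists>n\<ge>1. \<omega> n = x"
  shows "1 \<le> (\<integral>\<^sup>+u. ennreal (path_weight E (u @ [hd u])) \<partial>count_space (first_return_loops V x))"
proof -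
  interpret prob_space "random_walk E x" by (rule prob_space_random_walk)
  let ?R = "random_walk E x"
  \<comment> \<open>Only loops in the support are kept, since for these
    \<open>random_walk_prefix\<close> makes the cylinder measurable.\<close>
  define U where "U = {u\<in>first_return_loops V x. u @ [x] \<in> set_pmf (path_pmf E (length u) x)}"
  define C where "C u = {\<omega>. \<forall>i\<le>length u. \<omega> i = (u @ [x]) ! i}" for u
  have UC: "C u \<in> sets ?R" "emeasure ?R (C u) = ennreal (path_weight E (u @ [hd u]))" if "u \<in> U" for u
    using that random_walk_prefix[of "u @ [x]" E "length u" x]
    by (auto simp: U_def C_def pmf_path_pmf first_return_loops_def hd_append based_loops_def)
  have cU: "countable U"
    using countable_subset[OF _ countable_based_loops[of V], of U] G
    by (auto simp: U_def first_return_loops_def locally_finite_graph_def)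
  \<comment> \<open>The loop is recovered from any trajectory in its cylinder by cutting at the
    first return, so different loops have disjoint cylinders.\<close>
  have rep: "u = map \<omega> [0..<(LEAST n. 1 \<le> n \<and> \<omega> n = x)]" if u: "u \<in> U" "\<omega> \<in> C u" for u \<omega>
  proof -
    have w: "\<omega> i = u ! i" if "i < length u" for i using u(2) that by (auto simp: C_def nth_append)
    have len: "2 \<le> length u" "x \<notin> set (tl u)"
      using u(1) by (auto simp: U_def first_return_loops_def based_loops_def)
    have nx: "u ! i \<noteq> x" if "1 \<le> i" "i < length u" for i
    proof
      assume "u ! i = x"
      then have "tl u ! (i - 1) = x" "i - 1 < length (tl u)" using that len by (auto simp: nth_tl)
      then show False using len(2) nth_mem by metis
    qed
    have "(LEAST n. 1 \<le> n \<and> \<omega> n = x) = length u"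
    proof (rule Least_equality)
      show "1 \<le> length u \<and> \<omega> (length u) = x" using len u(2) by (auto simp: C_def nth_append)
      show "length u \<le> m" if "1 \<le> m \<and> \<omega> m = x" for m
        using that nx[of m] w[of m] by (cases "m < length u") auto
    qed
    then show ?thesis by (auto intro!: nth_equalityI simp: w)
  qed
  have "AE \<omega> in ?R. \<forall>n. map \<omega> [0..<Suc n] \<in> set_pmf (path_pmf E n x)"
    by (simp only: AE_all_countable AE_random_walk_prefix simp_thms)
  with rec have "AE \<omega> in ?R. \<omega> \<in> (\<Union>u\<in>U. C u)"
  proof eventually_elim
    case (elim \<omega>)
    define n where "n = (LEAST n. 1 \<le> n \<and> \<omega> n = x)"
    have n: "1 \<le> n" "\<omega> n = x" using elim(1) LeastI_ex[of "\<lambda>n. 1 \<le> n \<and> \<omega> n = x"] by (auto simp: n_def)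
    have nx: "\<omega> i \<noteq> x" if "1 \<le> i" "i < n" for i
      using that not_less_Least[of i "\<lambda>n. 1 \<le> n \<and> \<omega> n = x"] by (auto simp: n_def)
    have w: "map \<omega> [0..<Suc n] \<in> set_pmf (path_pmf E n x)" using elim(2) by blast
    have w0: "\<omega> 0 = x" using set_path_pmf_length[OF w] by (simp add: hd_map del: upt_Suc)
    note g = set_path_pmf_graph[OF G nb w x]
    have ne: "\<omega> i \<noteq> \<omega> (Suc i)" if "i < n" for i using g that by (simp del: upt_Suc)
    define u where "u = map \<omega> [0..<n]"
    \<comment> \<open>The first step leaves \<open>x\<close>, so a return takes at least two steps,
      the minimal length in \<open>based_loops\<close>.\<close>
    have "n \<noteq> 1" using ne[of 0] w0 n by auto
    then have n2: "2 \<le> n" using n by simp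
    have ux: "u @ [x] = map \<omega> [0..<Suc n]" using n by (simp add: u_def)
    have "u \<in> based_loops V"
      unfolding based_loops_def
    proof (safe)
      fix z assume "z \<in> set u" then show "z \<in> V" using g unfolding ux[symmetric] by auto
    next
      show "2 \<le> length u" using n2 by (simp add: u_def)
    next
      fix i assume i: "i < length u" "u ! i = u ! (Suc i mod length u)"
      then have "i < n" by (simp add: u_def)
      then show False using i ne[of i] n w0 n2
        by (cases "Suc i = n") (auto simp: u_def)
    qed
    moreover have "hd u = x" using w0 n by (simp add: u_def hd_map)
    moreover have "x \<notin> set (tl u)"
    proof
      assume "x \<in> set (tl u)"
      then obtain i where "i < length (tl u)" "tl u ! i = x" by (auto simp: in_set_conv_nth)
      then show False using nx[of "Suc i"] n by (auto simp: u_def nth_tl)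
    qed
    ultimately have "u \<in> U" using w ux by (auto simp: U_def first_return_loops_def u_def simp del: upt_Suc)
    moreover have "\<omega> \<in> C u" unfolding C_def ux by (auto simp: u_def simp del: upt_Suc)
    ultimately show ?case by auto
  qed
  moreover have mU: "(\<Union>u\<in>U. C u) \<in> sets ?R"
    by (intro sets.countable_UN' cU) (auto simp: UC)
  ultimately have "1 = emeasure ?R (\<Union>u\<in>U. C u)"
    using emeasure_eq_1_AE by (simp add: emeasure_eq_1_AE)
  also have "\<dots> = (\<integral>\<^sup>+u. emeasure ?R (C u) \<partial>count_space U)"
    by (intro emeasure_UN_countable UC cU) (auto simp: disjoint_family_on_def dest: rep)
  also have "\<dots> = (\<integral>\<^sup>+u. ennreal (path_weight E (u @ [hd u])) \<partial>count_space U)"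
    by (intro nn_integral_cong) (simp add: UC)
  also have "\<dots> \<le> (\<integral>\<^sup>+u. ennreal (path_weight E (u @ [hd u])) \<partial>count_space (first_return_loops V x))"
    by (rule nn_integral_count_space_subset) (auto simp: U_def)
  finally show ?thesis .
qed

section \<open>Rotation and concatenation of loops at a vertex\<close>

lemma path_weight_rotate1: 
  "path_weight E (rotate1 xs @ [hd (rotate1 xs)]) = path_weight E (xs @ [hd xs])"
proof (cases xs)
  case (Cons a v)
  show ?thesis
  proof (cases v)
    case (Cons b v')
    have "path_weight E ((b # v') @ a # [b]) = path_weight E ((b # v') @ [a]) * path_weight E (a # [b])"
      by (rule path_weight_append)
    then show ?thesis using \<open>xs = a # v\<close> Cons by simp
  qed (simp add: \<open>xs = a # v\<close>)
qed simp

lemma loop_weight_rotate: "loop_weight E \<kappa> (rotate k xs) = loop_weight E \<kappa> xs"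
proof (cases "xs = []")
  case False
  have "path_weight E (rotate k xs @ [hd (rotate k xs)]) = path_weight E (xs @ [hd xs])"
    by (induction k) (auto simp: path_weight_rotate1)
  then show ?thesis using False by (simp add: loop_weight_conv_path_weight)
qed simp

text \<open>Summing over the position of a visit to \<open>x\<close> instead of over the root: the factor
  \<open>1 / length\<close> of the loop measure turns into one over the number of visits to \<open>x\<close>.\<close>

lemma reroot_at_visit:
  fixes f :: "'a list \<Rightarrow> ennreal"
  assumes T: "\<And>xs k. xs \<in> T \<Longrightarrow> rotate k xs \<in> T" and f: "\<And>xs k. f (rotate k xs) = f xs"
  shows "(\<integral>\<^sup>+xs. of_nat (length xs) * f xs \<partial>count_space {xs\<in>T. xs \<noteq> [] \<and> hd xs = x}) \<le>
         (\<integral>\<^sup>+xs. of_nat (count_list xs x) * f xs \<partial>count_space T)"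
proof -
  let ?A = "{xs\<in>T. xs \<noteq> [] \<and> hd xs = x}"
  have fin: "of_nat (length xs) * f xs = (\<integral>\<^sup>+i. f xs * indicator {..<length xs} i \<partial>count_space UNIV)" for xs
    by (subst nn_integral_cmult_indicator) (auto simp: mult.commute)
  have fin2: "of_nat (count_list xs x) * f xs =
     (\<integral>\<^sup>+i. f xs * indicator {i. i < length xs \<and> xs ! i = x} i \<partial>count_space UNIV)" for xs
  proof -
    have "count_list xs x = card {i. i < length xs \<and> xs ! i = x}"
      by (simp add: count_list_eq_length_filter length_filter_conv_card eq_commute)
    then show ?thesis by (subst nn_integral_cmult_indicator) (auto simp: mult.commute)
  qed
  have swap: "(\<integral>\<^sup>+xs. (\<integral>\<^sup>+i. g xs i \<partial>count_space UNIV) * indicator S xs \<partial>count_space UNIV) =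
      (\<integral>\<^sup>+i. (\<integral>\<^sup>+xs. g xs i * indicator S xs \<partial>count_space UNIV) \<partial>count_space UNIV)"
    for g :: "'a list \<Rightarrow> nat \<Rightarrow> ennreal" and S
    using nn_integral_fst_count_space[of "\<lambda>(xs, i). g xs i * indicator S xs"]
      nn_integral_snd_count_space[of "\<lambda>(xs, i). g xs i * indicator S xs"]
    by (simp add: nn_integral_multc)
  have "(\<integral>\<^sup>+xs. f xs * indicator {..<length xs} i * indicator ?A xs \<partial>count_space UNIV) \<le>
        (\<integral>\<^sup>+xs. f xs * indicator {i. i < length xs \<and> xs ! i = x} i * indicator T xs \<partial>count_space UNIV)" for i
  proof -
    let ?Ai = "{xs\<in>?A. i < length xs}"
    \<comment> \<open>For a fixed position \<open>i\<close> this rotation moves the root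
      \<open>x\<close> to position \<open>i\<close>. It is undone by \<open>rotate i\<close>, which
      gives injectivity.\<close>
    let ?h = "\<lambda>ys. rotate (length ys - i) (ys :: 'a list)"
    have inv: "rotate i (?h ys) = ys" if "ys \<in> ?Ai" for ys
      using that by (simp add: rotate_rotate)
    have inj: "inj_on ?h ?Ai" by (rule inj_on_inverseI[of _ "rotate i"]) (rule inv)
    have "(\<integral>\<^sup>+xs. f xs * indicator {..<length xs} i * indicator ?A xs \<partial>count_space UNIV) =
       (\<integral>\<^sup>+xs. f xs \<partial>count_space ?Ai)"
      by (subst nn_integral_count_space_indicator) (auto intro!: nn_integral_cong simp: indicator_def)
    also have "\<dots> = (\<integral>\<^sup>+xs. f (?h xs) \<partial>count_space ?Ai)" by (simp add: f)
    also have "\<dots> = (\<integral>\<^sup>+xs. f xs \<partial>count_space (?h ` ?Ai))"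
      by (rule nn_integral_bij_count_space) (rule inj_on_imp_bij_betw[OF inj])
    also have "\<dots> \<le> (\<integral>\<^sup>+xs. f xs \<partial>count_space {xs\<in>T. i < length xs \<and> xs ! i = x})"
    proof (rule nn_integral_count_space_subset, safe)
      fix ys assume ys: "ys \<in> T" "ys \<noteq> []" "i < length ys" "x = hd ys"
      then show "?h ys \<in> T" "i < length (?h ys)" using T by auto
      have "hd (rotate i (?h ys)) = ?h ys ! (i mod length (?h ys))"
        using ys by (intro hd_rotate_conv_nth) auto
      then show "?h ys ! i = hd ys" using ys inv[of ys] by simp
    qed
    also have "\<dots> = (\<integral>\<^sup>+xs. f xs * indicator {i. i < length xs \<and> xs ! i = x} i * indicator T xs \<partial>count_space UNIV)"
      by (subst nn_integral_count_space_indicator) (auto intro!: nn_integral_cong simp: indicator_def)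
    finally show ?thesis .
  qed
  then have "(\<integral>\<^sup>+i. (\<integral>\<^sup>+xs. f xs * indicator {..<length xs} i * indicator ?A xs \<partial>count_space UNIV) \<partial>count_space UNIV) \<le>
        (\<integral>\<^sup>+i. (\<integral>\<^sup>+xs. f xs * indicator {i. i < length xs \<and> xs ! i = x} i * indicator T xs \<partial>count_space UNIV) \<partial>count_space UNIV)"
    by (rule nn_integral_mono)
  moreover have "(\<integral>\<^sup>+xs. of_nat (length xs) * f xs \<partial>count_space ?A) =
      (\<integral>\<^sup>+xs. (\<integral>\<^sup>+i. f xs * indicator {..<length xs} i \<partial>count_space UNIV) * indicator ?A xs \<partial>count_space UNIV)"
    by (subst nn_integral_count_space_indicator, simp) (simp only: fin)
  moreover have "(\<integral>\<^sup>+xs. of_nat (count_list xs x) * f xs \<partial>count_space T) =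
      (\<integral>\<^sup>+xs. (\<integral>\<^sup>+i. f xs * indicator {i. i < length xs \<and> xs ! i = x} i \<partial>count_space UNIV) * indicator T xs \<partial>count_space UNIV)"
    by (subst nn_integral_count_space_indicator, simp) (simp only: fin2)
  ultimately show ?thesis by (simp only: swap)
qed

text \<open>Prescribing the second vertex \<open>y\<close> forces the edge between \<open>x\<close>
  and \<open>y\<close> to be traversed, and this persists when further loops are appended.\<close>

definition loops_via :: "'a set \<Rightarrow> 'a \<Rightarrow> 'a \<Rightarrow> nat \<Rightarrow> 'a list set" where
  "loops_via V x y N = {xs\<in>based_loops V. hd xs = x \<and> xs ! 1 = y \<and> count_list xs x = N}"

text \<open>At the seam the last vertex of \<open>xs\<close> is followed by the head of
  \<open>u\<close>, which is the head of \<open>xs\<close>; so no new cyclically adjacent pair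
  arises.\<close>

lemma based_loops_append:
  assumes "xs \<in> based_loops V" "u \<in> based_loops V" "hd xs = hd u"
  shows "xs @ u \<in> based_loops V"
proof -
  have l: "2 \<le> length xs" "2 \<le> length u" using assms by (auto simp: based_loops_def)
  have h: "xs ! 0 = u ! 0" using assms(3) l by (metis hd_conv_nth length_0_conv not_numeral_le_zero)
  have "(xs @ u) ! i \<noteq> (xs @ u) ! (Suc i mod length (xs @ u))" if i: "i < length (xs @ u)" for i
  proof (cases "i < length xs")
    case True
    then have "xs ! i \<noteq> xs ! (Suc i mod length xs)" using assms(1) by (auto simp: based_loops_def)
    moreover have "Suc i mod length (xs @ u) = Suc i" using True l by simp
    ultimately show ?thesis using True l h
      by (cases "Suc i = length xs") (auto simp: nth_append)
  next
    case False
    then have j: "i - length xs < length u" using i by simp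
    then have *: "u ! (i - length xs) \<noteq> u ! (Suc (i - length xs) mod length u)"
      using assms(2) by (auto simp: based_loops_def)
    show ?thesis
    proof (cases "Suc i = length xs + length u")
      case True
      then have "Suc (i - length xs) = length u" using False by linarith
      then show ?thesis using True * False l h by (auto simp: nth_append)
    next
      case F: False
      have "Suc (i - length xs) < length u" using F False i by auto
      then show ?thesis using F * False l h i by (auto simp: nth_append Suc_diff_le)
    qed
  qed
  then show ?thesis using assms by (auto simp: based_loops_def)
qed

text \<open>Appending a first return loop adds exactly one visit to \<open>x\<close> and multiplies
  the weights. The appended piece can be read off the result, because \<open>x\<close> occurs in it
  only at its head; so no weight is counted twice.\<close>

lemma loops_via_Suc_weight:
  "(\<integral>\<^sup>+xs. ennreal (path_weight E (xs @ [hd xs])) \<partial>count_space (loops_via V x y N)) *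
   (\<integral>\<^sup>+u. ennreal (path_weight E (u @ [hd u])) \<partial>count_space (first_return_loops V x)) \<le>
   (\<integral>\<^sup>+xs. ennreal (path_weight E (xs @ [hd xs])) \<partial>count_space (loops_via V x y (Suc N)))"
proof -
  define F where "F xs = ennreal (path_weight E (xs @ [hd xs]))" for xs
  let ?S = "loops_via V x y" and ?U = "first_return_loops V x"
  have ne: "xs \<noteq> []" if "xs \<in> ?S M \<or> xs \<in> ?U" for xs M
    using that by (auto simp: loops_via_def first_return_loops_def based_loops_def)
  have U: "u = x # tl u" "x \<notin> set (tl u)" if "u \<in> ?U" for u
  proof -
    have "u \<noteq> []" "hd u = x" "x \<notin> set (tl u)" using that ne[of u] by (auto simp: first_return_loops_def)
    then show "u = x # tl u" "x \<notin> set (tl u)" by (metis list.collapse)+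
  qed
  have Smem: "hd xs = x" if "xs \<in> ?S M" for xs M using that by (auto simp: loops_via_def)
  have mult: "F xs * F u = F (xs @ u)" if "xs \<in> ?S N" "u \<in> ?U" for xs u
  proof -
    have "xs \<noteq> []" "hd xs = x" "hd u = x"
      using Smem[OF that(1)] ne[of xs] that by (auto simp: first_return_loops_def)
    then have h: "hd xs = x" "hd u = x" "hd (xs @ u) = x" by auto
    have "path_weight E (xs @ x # (tl u @ [x])) = path_weight E (xs @ [x]) * path_weight E (x # (tl u @ [x]))"
      by (rule path_weight_append)
    moreover have "x # (tl u @ [x]) = u @ [x]" using U(1)[OF that(2)] by (metis append_Cons)
    ultimately have "path_weight E ((xs @ u) @ [x]) = path_weight E (xs @ [x]) * path_weight E (u @ [x])"
      by simp
    then show ?thesis unfolding F_def h by (simp add: ennreal_mult path_weight_nonneg)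
  qed
  have inj: "inj_on (\<lambda>(xs, u). xs @ u) (?S N \<times> ?U)"
  proof (rule inj_onI, clarify)
    fix xs u xs' u' assume a: "xs \<in> ?S N" "u \<in> ?U" "xs' \<in> ?S N" "u' \<in> ?U" "xs @ u = xs' @ u'"
    \<comment> \<open>If two cuts differed, the head \<open>x\<close> of the shorter piece would lie
      in the tail of the longer one.\<close>
    have no: False if "z \<noteq> []" "z @ v = v'" "v \<in> ?U" "v' \<in> ?U" for z v v' :: "'a list"
    proof -
      have "tl v' = tl z @ v" using that by (cases z) auto
      then show False using U[OF that(3)] U[OF that(4)] by (metis Un_iff list.set_intros(1) set_append)
    qed
    from a(5) obtain z where "xs = xs' @ z \<and> z @ u = u' \<or> xs @ z = xs' \<and> u = z @ u'"
      by (auto simp: append_eq_append_conv2)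
    moreover have "z = []" using calculation no[of z u u'] no[of z u' u] a(2,4) by blast
    ultimately show "xs = xs' \<and> u = u'" by simp
  qed
  have img: "(\<lambda>(xs, u). xs @ u) ` (?S N \<times> ?U) \<subseteq> ?S (Suc N)"
  proof safe
    fix xs u assume a: "xs \<in> ?S N" "u \<in> ?U"
    have "count_list u x = 1"
    proof -
      have "count_list (x # tl u) x = 1" using U(2)[OF a(2)] by simp
      then show ?thesis using U(1)[OF a(2)] by simp
    qed
    moreover have "1 < length xs" "u \<in> based_loops V" "hd u = x" using a
      by (auto simp: loops_via_def first_return_loops_def based_loops_def)
    moreover have "xs \<noteq> []" using ne[of xs] a by blast
    ultimately show "xs @ u \<in> ?S (Suc N)" using a(1) based_loops_append[of xs V u]
      by (auto simp: loops_via_def nth_append)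
  qed
  have "(\<integral>\<^sup>+xs. F xs \<partial>count_space (?S N)) * (\<integral>\<^sup>+u. F u \<partial>count_space ?U) =
      (\<integral>\<^sup>+xs. \<integral>\<^sup>+u. F xs * indicator (?S N) xs * (F u * indicator ?U u) \<partial>count_space UNIV \<partial>count_space UNIV)"
    by (simp add: nn_integral_count_space_indicator nn_integral_cmult nn_integral_multc)
  also have "\<dots> = (\<integral>\<^sup>+p. F (fst p) * indicator (?S N) (fst p) * (F (snd p) * indicator ?U (snd p)) \<partial>count_space UNIV)"
    using nn_integral_fst_count_space[of "\<lambda>p. F (fst p) * indicator (?S N) (fst p) * (F (snd p) * indicator ?U (snd p))"]
    by simp
  also have "\<dots> = (\<integral>\<^sup>+p. F (case p of (xs, u) \<Rightarrow> xs @ u) \<partial>count_space (?S N \<times> ?U))"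
    by (subst nn_integral_count_space_indicator, simp)
       (auto intro!: nn_integral_cong simp: indicator_def mult)
  also have "\<dots> = (\<integral>\<^sup>+w. F w \<partial>count_space ((\<lambda>(xs, u). xs @ u) ` (?S N \<times> ?U)))"
    by (rule nn_integral_bij_count_space) (rule inj_on_imp_bij_betw[OF inj])
  also have "\<dots> \<le> (\<integral>\<^sup>+w. F w \<partial>count_space (?S (Suc N)))"
    by (rule nn_integral_count_space_subset[OF img])
  finally show ?thesis by (simp add: F_def)
qed

lemma ennreal_suminf_harmonic:
  assumes "0 < c"
  shows "(\<Sum>n. ennreal (c / real (Suc n))) = \<infinity>"
proof (rule ccontr)
  assume "(\<Sum>n. ennreal (c / real (Suc n))) \<noteq> \<infinity>"
  then have "summable (\<lambda>n. c / real (Suc n))" using assms by (intro summable_suminf_not_top) auto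
  then have "summable (\<lambda>n. inverse c * (c / real (Suc n)))" by (rule summable_mult)
  then have "summable (\<lambda>n. inverse (real (Suc n)))" using assms by (simp add: field_simps)
  then have "summable (\<lambda>n. inverse (real n))" by (subst (asm) summable_Suc_iff[of "\<lambda>n. inverse (real n)"])
  then show False using not_summable_harmonic[where 'a=real] by simp
qed

definition loops_through :: "'a set \<Rightarrow> 'a set \<Rightarrow> 'a list set" where
  "loops_through V e = {xs\<in>based_loops V. e \<in> traversed_edges (rotation_equiv V `` {xs})}"

lemma rotate_based_loops:
  assumes "xs \<in> based_loops V"
  shows "rotate k xs \<in> based_loops V" "rotation_equiv V `` {rotate k xs} = rotation_equiv V `` {xs}"
proof -
  have l: "2 \<le> length xs" using assms by (auto simp: based_loops_def)
  show *: "rotate k xs \<in> based_loops V"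
    unfolding based_loops_def
  proof (safe)
    fix z assume "z \<in> set (rotate k xs)"
    then show "z \<in> V" using assms by (auto simp: based_loops_def)
  next
    fix i assume i: "i < length (rotate k xs)"
      and eq: "rotate k xs ! i = rotate k xs ! (Suc i mod length (rotate k xs))"
    have 0: "0 < length xs" using l by linarith
    have "rotate k xs ! (Suc i mod length xs) = xs ! ((k + Suc i mod length xs) mod length xs)"
      using 0 by (intro nth_rotate) simp
    also have "\<dots> = xs ! (Suc ((k + i) mod length xs) mod length xs)"
      by (simp add: mod_simps)
    finally have "xs ! ((k + i) mod length xs) = xs ! (Suc ((k + i) mod length xs) mod length xs)"
      using eq i by (simp add: nth_rotate)
    moreover have "(k + i) mod length xs < length xs" using 0 by simp
    ultimately show False using assms by (auto simp: based_loops_def)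
  qed (use l in simp)
  show "rotation_equiv V `` {rotate k xs} = rotation_equiv V `` {xs}"
    using assms * by (intro equiv_class_eq[OF rotation_equiv, symmetric]) (auto simp: rotation_equiv_def)
qed

lemma loops_throughI:
  assumes "xs \<in> based_loops V" "i < length xs" "e = {xs ! i, xs ! (Suc i mod length xs)}"
  shows "xs \<in> loops_through V e"
proof -
  have "xs \<in> rotation_equiv V `` {xs}" using assms(1) equiv_class_self[OF rotation_equiv] by metis
  then show ?thesis using assms by (auto simp: loops_through_def traversed_edges_def)
qed

lemma recurrent_loops_through_edge:
  assumes G: "locally_finite_graph V E" and nb: "\<And>v. v \<in> V \<Longrightarrow> neighbours E v \<noteq> {}"
    and e: "x \<in> V" "{x, y} \<in> E" and rec: "AE \<omega> in random_walk E x. \<exists>n\<ge>1. \<omega> n = x"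
  shows "emeasure (based_loop_measure V E 0) (loops_through V {x, y}) = \<infinity>"
proof -
  have y: "y \<in> V" "x \<noteq> y" using G e unfolding locally_finite_graph_def by (metis doubleton_eq_iff)+
  have tr: "0 < transition E u v" if "{u, v} \<in> E" "u \<in> V" for u v
  proof -
    have "v \<in> neighbours E u" "finite (neighbours E u)"
      using that G by (auto simp: neighbours_def locally_finite_graph_def)
    then have "v \<in> set_pmf (walk_step E u)" by (auto simp: walk_step_def)
    then show ?thesis by (simp add: transition_def pmf_positive)
  qed
  define F where "F xs = ennreal (path_weight E (xs @ [hd xs]))" for xs
  define c where "c = transition E x y * transition E y x"
  have c: "0 < c" using tr[of x y] tr[of y x] e y by (simp add: c_def insert_commute)
  \<comment> \<open>The induction starts from the loop that steps to \<open>y\<close> and back, of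
    weight \<open>c\<close>. Each appended first return loop multiplies by a total weight of at
    least 1, so nothing is lost as the number of visits grows.\<close>
  have base: "ennreal c \<le> (\<integral>\<^sup>+xs. F xs \<partial>count_space (loops_via V x y (Suc N)))" for N
  proof (induction N)
    case 0
    have "[x, y] ! i \<noteq> [x, y] ! (Suc i mod length [x, y])" if "i < length [x, y]" for i
      using that y by (cases i) auto
    then have "[x, y] \<in> loops_via V x y 1"
      using e y by (auto simp: loops_via_def based_loops_def)
    then have "{[x, y]} \<subseteq> loops_via V x y (Suc 0)" by simp
    from nn_integral_count_space_subset[OF this, of F]
    show ?case by (simp add: nn_integral_count_space_finite F_def c_def)
  next
    case (Suc N)
    have "ennreal c * 1 \<le> (\<integral>\<^sup>+xs. F xs \<partial>count_space (loops_via V x y (Suc N))) *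
         (\<integral>\<^sup>+u. F u \<partial>count_space (first_return_loops V x))"
      using Suc first_return_weight[OF G nb e(1) rec] unfolding F_def by (intro mult_mono) auto
    also have "\<dots> \<le> (\<integral>\<^sup>+xs. F xs \<partial>count_space (loops_via V x y (Suc (Suc N))))"
      unfolding F_def by (rule loops_via_Suc_weight)
    finally show ?case by simp
  qed
  define T where "T N = {xs\<in>loops_through V {x, y}. count_list xs x = N}" for N
  have cnt: "count_list (rotate k xs) x = count_list xs x" for xs k
  proof (induction k)
    case (Suc k)
    have "count_list (rotate1 zs) x = count_list zs x" for zs by (cases zs) auto
    then show ?case using Suc by simp
  qed simp
  have "ennreal (c / real (Suc N)) \<le> emeasure (based_loop_measure V E 0) (T (Suc N))" for N
  proof -
    let ?f = "\<lambda>xs. ennreal (loop_weight E 0 xs)"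
    have "ennreal c \<le> (\<integral>\<^sup>+xs. F xs \<partial>count_space (loops_via V x y (Suc N)))" by (rule base)
    \<comment> \<open>The factor \<open>length xs\<close> cancels the division by the length in
      \<open>loop_weight\<close>; at \<kappa> = 0 the killing factor is 1.\<close>
    also have "\<dots> = (\<integral>\<^sup>+xs. of_nat (length xs) * ?f xs \<partial>count_space (loops_via V x y (Suc N)))"
    proof (rule nn_integral_cong)
      fix xs assume "xs \<in> space (count_space (loops_via V x y (Suc N)))"
      then have "xs \<noteq> []" by (auto simp: loops_via_def based_loops_def)
      then show "F xs = of_nat (length xs) * ?f xs"
        by (simp add: F_def loop_weight_conv_path_weight ennreal_of_nat_eq_real_of_nat ennreal_mult[symmetric] path_weight_nonneg)
    qed
    also have "\<dots> \<le> (\<integral>\<^sup>+xs. of_nat (length xs) * ?f xs \<partial>count_space {xs\<in>T (Suc N). xs \<noteq> [] \<and> hd xs = x})"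
    proof (rule nn_integral_count_space_subset, rule subsetI)
      fix xs assume xs: "xs \<in> loops_via V x y (Suc N)"
      then have l: "2 \<le> length xs" "xs \<in> based_loops V" by (auto simp: loops_via_def based_loops_def)
      then have "xs ! 0 = hd xs" by (metis hd_conv_nth length_0_conv not_numeral_le_zero)
      then have "xs \<in> loops_through V {x, y}"
        using xs l by (intro loops_throughI[of _ _ 0]) (auto simp: loops_via_def)
      then have "xs \<in> T (Suc N)" using xs by (simp add: T_def loops_via_def)
      moreover have "hd xs = x" "xs \<noteq> []" using xs l by (auto simp: loops_via_def)
      ultimately show "xs \<in> {xs\<in>T (Suc N). xs \<noteq> [] \<and> hd xs = x}" by simp
    qed
    also have "\<dots> \<le> (\<integral>\<^sup>+xs. of_nat (count_list xs x) * ?f xs \<partial>count_space (T (Suc N)))"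
    proof (rule reroot_at_visit)
      fix xs k assume "xs \<in> T (Suc N)"
      then show "rotate k xs \<in> T (Suc N)"
        using rotate_based_loops[of xs V k] by (auto simp: T_def loops_through_def cnt)
    qed (simp add: loop_weight_rotate)
    also have "\<dots> = (\<integral>\<^sup>+xs. of_nat (Suc N) * ?f xs \<partial>count_space (T (Suc N)))"
      by (rule nn_integral_cong) (simp add: T_def)
    also have "\<dots> = of_nat (Suc N) * emeasure (based_loop_measure V E 0) (T (Suc N))"
      by (subst nn_integral_cmult)
        (auto simp: T_def loops_through_def emeasure_based_loop_measure simp del: of_nat_Suc)
    finally have "ennreal (1 / real (Suc N)) * ennreal c \<le>
        ennreal (1 / real (Suc N)) * (of_nat (Suc N) * emeasure (based_loop_measure V E 0) (T (Suc N)))"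
      by (intro mult_left_mono) auto
    also have "\<dots> = emeasure (based_loop_measure V E 0) (T (Suc N))"
      unfolding mult.assoc[symmetric] ennreal_of_nat_eq_real_of_nat
      by (subst ennreal_mult[symmetric]) auto
    finally show ?thesis using c by (simp add: ennreal_mult[symmetric])
  qed
  then have "(\<Sum>N. ennreal (c / real (Suc N))) \<le> (\<Sum>N. emeasure (based_loop_measure V E 0) (T (Suc N)))"
    by (intro suminf_le) auto
  also have "\<dots> = emeasure (based_loop_measure V E 0) (\<Union>N. T (Suc N))"
    by (intro suminf_emeasure)
      (auto simp: based_loop_measure_def T_def loops_through_def disjoint_family_on_def sets_point_measure)
  also have "\<dots> \<le> emeasure (based_loop_measure V E 0) (loops_through V {x, y})"
    by (intro emeasure_mono) (auto simp: based_loop_measure_def T_def loops_through_def sets_point_measure)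
  finally show ?thesis using ennreal_suminf_harmonic[OF c] by (simp add: top_unique)
qed

lemma AE_edge_open:
  assumes V: "countable V" and e: "e \<in> E" and \<alpha>: "0 < \<alpha>"
    and inf: "emeasure (based_loop_measure V E \<kappa>) (loops_through V e) = \<infinity>"
  shows "AE \<omega> in loop_soup V E \<alpha> \<kappa>. e \<in> open_edges V E \<omega>"
proof -
  let ?S = "{l\<in>loops V. e \<in> traversed_edges l}"
  have "{xs\<in>based_loops V. rotation_equiv V `` {xs} \<in> ?S} = loops_through V e"
    by (auto simp: loops_through_def loops_def quotientI)
  then have "emeasure (loop_measure V E \<kappa>) ?S = \<infinity>"
    by (subst emeasure_loop_measure) (auto simp: inf)
  then have "AE \<omega> in loop_soup V E \<alpha> \<kappa>. \<exists>l\<in>?S. 0 < \<omega> l"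
    by (intro AE_loop_soup_present V \<alpha>) auto
  then show ?thesis by eventually_elim (use e in \<open>auto simp: open_edges_def\<close>)
qed

lemma recurrent_loop_percolation:
  assumes G: "locally_finite_graph V E" and con: "connected_graph V E"
    and rec: "recurrent_graph V E" and \<alpha>: "0 < \<alpha>"
  shows "AE \<omega> in loop_soup V E \<alpha> 0. \<forall>x\<in>V. \<forall>y\<in>V. y \<in> open_cluster V E \<omega> x"
proof -
  have cV: "countable V" using G by (simp add: locally_finite_graph_def)
  have edge: "\<exists>x\<in>V. \<exists>y\<in>V. x \<noteq> y \<and> e = {x, y}" if "e \<in> E" for e
    using G that by (auto simp: locally_finite_graph_def)
  have "E \<subseteq> (\<lambda>(x, y). {x, y}) ` (V \<times> V)" using edge by fast
  then have cE: "countable E" by (rule countable_subset) (use cV in auto)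
  have "AE \<omega> in loop_soup V E \<alpha> 0. e \<in> open_edges V E \<omega>" if e: "e \<in> E" for e
  proof -
    obtain x y where xy: "x \<in> V" "y \<in> V" "x \<noteq> y" "e = {x, y}" using edge[OF e] by blast
    \<comment> \<open>Isolated vertices are excluded only after an edge has been fixed: the graph
      with a single vertex is connected although its vertex has no neighbour, but there no edge has
      to be opened.\<close>
    have "neighbours E v \<noteq> {}" if "v \<in> V" for v
    proof (cases "v = x")
      case True
      then show ?thesis using e xy by (auto simp: neighbours_def)
    next
      case False
      have "linked E v x" using con xy that by (auto simp: connected_graph_def)
      then show ?thesis using False unfolding linked_def
        by (cases rule: converse_rtranclpE) (auto simp: neighbours_def)
    qed
    then show ?thesis using e xy \<alpha> cV rec unfolding xy(4)
      by (intro AE_edge_open recurrent_loops_through_edge G) (auto simp: recurrent_graph_def)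
  qed
  then have "AE \<omega> in loop_soup V E \<alpha> 0. \<forall>e\<in>E. e \<in> open_edges V E \<omega>"
    using cE by (simp add: AE_ball_countable)
  then show ?thesis
  proof eventually_elim
    case (elim \<omega>)
    then have "E \<subseteq> open_edges V E \<omega>" by auto
    then show ?case using con linked_mono[of E "open_edges V E \<omega>"]
      by (auto simp: open_cluster_def connected_graph_def)
  qed
qed

section \<open>The simple random walk on the integer lattice\<close>

lemma neighbours_zd: "neighbours zd_edges (x :: int ^ 'd::finite) =
   (\<lambda>(i, b). x + axis i (if b then 1 else -1)) ` UNIV"
proof -
  have *: "neighbours zd_edges x = {y. (\<Sum>i\<in>UNIV. \<bar>x $ i - y $ i\<bar>) = 1}"
  proof -
    have "(\<Sum>i\<in>UNIV. \<bar>u $ i - v $ i\<bar>) = (\<Sum>i\<in>UNIV. \<bar>v $ i - u $ i\<bar>)" for u v :: "int ^ 'd"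
      by (simp add: abs_minus_commute)
    then show ?thesis by (auto simp: neighbours_def zd_edges_def doubleton_eq_iff)
  qed
  have "(\<Sum>i\<in>UNIV. \<bar>x $ i - (x + axis j c) $ i\<bar>) = \<bar>c\<bar>" for j and c :: int
  proof -
    have "(\<Sum>i\<in>UNIV. \<bar>x $ i - (x + axis j c) $ i\<bar>) = (\<Sum>i\<in>UNIV. if i = j then \<bar>c\<bar> else 0)"
      by (intro sum.cong) (auto simp: axis_def)
    then show ?thesis by simp
  qed
  then have "(\<lambda>(i, b). x + axis i (if b then 1 else -1)) ` UNIV \<subseteq> neighbours zd_edges x"
    unfolding * by auto
  moreover have "y \<in> (\<lambda>(i, b). x + axis i (if b then 1 else -1)) ` UNIV"
    if y: "(\<Sum>i\<in>UNIV. \<bar>x $ i - y $ i\<bar>) = 1" for y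
  proof -
    obtain j where j: "x $ j \<noteq> y $ j" using y by fastforce
    have "1 = \<bar>x $ j - y $ j\<bar> + (\<Sum>i\<in>UNIV - {j}. \<bar>x $ i - y $ i\<bar>)"
      using y by (simp add: sum.remove[of UNIV j])
    moreover have "0 \<le> (\<Sum>i\<in>UNIV - {j}. \<bar>x $ i - y $ i\<bar>)" by (intro sum_nonneg) auto
    ultimately have 1: "\<bar>x $ j - y $ j\<bar> = 1" and 0: "(\<Sum>i\<in>UNIV - {j}. \<bar>x $ i - y $ i\<bar>) = 0"
      using j by linarith+
    from 0 have eq: "x $ i = y $ i" if "i \<noteq> j" for i
      using that by (subst (asm) sum_nonneg_eq_0_iff) auto
    have "y = x + axis j (if x $ j < y $ j then 1 else -1)"
      using 1 eq by (auto simp: vec_eq_iff axis_def)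
    then show ?thesis by (intro image_eqI[of _ _ "(j, x $ j < y $ j)"]) auto
  qed
  ultimately show ?thesis unfolding * by auto
qed

lemma inj_zd_steps: "inj (\<lambda>(i, b). (x :: int ^ 'd::finite) + axis i (if b then 1 else -1))"
  by (auto simp: inj_def axis_eq_axis split: if_splits)

lemma card_neighbours_zd: "card (neighbours zd_edges (x :: int ^ 'd::finite)) = 2 * CARD('d)"
  unfolding neighbours_zd by (subst card_image[OF inj_zd_steps]) (simp add: card_UNIV_bool mult.commute)

lemma finite_neighbours_zd: "finite (neighbours zd_edges (x :: int ^ 'd::finite))"
  and neighbours_zd_ne: "neighbours zd_edges x \<noteq> {}"
  unfolding neighbours_zd by auto

lemma walk_step_zd: "walk_step zd_edges (x :: int ^ 'd::finite) = pmf_of_set (neighbours zd_edges x)"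
  by (simp add: walk_step_def neighbours_zd_ne)

lemma transition_zd: "transition zd_edges (x :: int ^ 'd::finite) y =
    (if {x, y} \<in> zd_edges then 1 / (2 * real CARD('d)) else 0)"
proof -
  have "transition zd_edges x y = indicator (neighbours zd_edges x) y / real (card (neighbours zd_edges x))"
    unfolding transition_def walk_step_zd by (rule pmf_of_set[OF neighbours_zd_ne finite_neighbours_zd])
  then show ?thesis unfolding card_neighbours_zd by (simp add: neighbours_def)
qed

lemma transition_zd_sym: "transition zd_edges (x :: int ^ 'd::finite) y = transition zd_edges y x"
  by (simp add: transition_zd insert_commute)

lemma sum_neighbours_zd:
  fixes f :: "int ^ 'd::finite \<Rightarrow> 'b::comm_monoid_add"
  shows "sum f (neighbours zd_edges x) = (\<Sum>i\<in>UNIV. f (x + axis i 1) + f (x - axis i 1))"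
proof -
  have ax: "x + axis i (- 1) = x - axis i 1" for i by (simp add: vec_eq_iff axis_def)
  have "sum f (neighbours zd_edges x) = (\<Sum>(i, b)\<in>UNIV. f (x + axis i (if b then 1 else -1)))"
    unfolding neighbours_zd by (subst sum.reindex[OF inj_zd_steps]) (simp add: case_prod_unfold)
  also have "\<dots> = (\<Sum>i\<in>UNIV. \<Sum>b\<in>UNIV. f (x + axis i (if b then 1 else -1)))"
    by (subst sum.cartesian_product) (simp add: UNIV_Times_UNIV)
  also have "\<dots> = (\<Sum>i\<in>UNIV. f (x + axis i 1) + f (x - axis i 1))"
    by (simp add: UNIV_bool ax add.commute)
  finally show ?thesis .
qed

lemma integral_walk_step_zd:
  fixes f :: "int ^ 'd::finite \<Rightarrow> real"
  shows "(\<integral>y. f y \<partial>walk_step zd_edges x) = (\<Sum>i\<in>UNIV. f (x + axis i 1) + f (x - axis i 1)) / (2 * real CARD('d))"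
  by (simp add: walk_step_zd integral_pmf_of_set[OF neighbours_zd_ne finite_neighbours_zd]
      sum_neighbours_zd card_neighbours_zd)

lemma nn_integral_walk_step_zd:
  fixes f :: "int ^ 'd::finite \<Rightarrow> real"
  assumes "\<And>y. 0 \<le> f y"
  shows "(\<integral>\<^sup>+y. ennreal (f y) \<partial>walk_step zd_edges x) =
    ennreal ((\<Sum>i\<in>UNIV. f (x + axis i 1) + f (x - axis i 1)) / (2 * real CARD('d)))"
proof -
  have "integrable (walk_step zd_edges x) f"
    unfolding walk_step_zd
    by (intro integrable_measure_pmf_finite) (simp add: finite_neighbours_zd neighbours_zd_ne)
  then show ?thesis
    by (subst nn_integral_eq_integral) (auto simp: assms integral_walk_step_zd)
qed

section \<open>Position at a given time, hitting and time reversal\<close>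

definition walk_at :: "'a set set \<Rightarrow> nat \<Rightarrow> 'a \<Rightarrow> 'a pmf" where
  "walk_at E n x = map_pmf last (path_pmf E n x)"

lemma walk_at_0: "walk_at E 0 x = return_pmf x"
  by (simp add: walk_at_def)

lemma walk_at_Suc: "walk_at E (Suc n) x = bind_pmf (walk_step E x) (walk_at E n)"
proof -
  have "map_pmf last (map_pmf ((#) x) (path_pmf E n y)) = walk_at E n y" for y
    unfolding walk_at_def pmf.map_comp
    by (rule map_pmf_cong[OF refl]) (use set_path_pmf_length[of _ E n y] in force)
  then show ?thesis by (simp only: walk_at_def[of E "Suc n"] path_pmf.simps map_bind_pmf)
qed

lemma walk_at_Suc_expectation:
  "(\<integral>\<^sup>+y. f y \<partial>walk_at E (Suc n) x) = (\<integral>\<^sup>+y. (\<integral>\<^sup>+z. f z \<partial>walk_at E n y) \<partial>walk_step E x)"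
  by (simp add: walk_at_Suc)

abbreviation hit_prob :: "'a set set \<Rightarrow> nat \<Rightarrow> 'a \<Rightarrow> 'a set \<Rightarrow> ennreal" where
  "hit_prob E n x H \<equiv> emeasure (path_pmf E n x) {w. set w \<inter> H \<noteq> {}}"

text \<open>The hitting probability is the least supersolution of the step recursion that is at least 1 on
  the target.\<close>

lemma emeasure_hit_le:
  assumes base: "\<And>m x. m \<le> M \<Longrightarrow> x \<in> A \<Longrightarrow> 1 \<le> \<phi> m x"
    and super: "\<And>m x. (\<integral>\<^sup>+y. \<phi> m y \<partial>walk_step E x) \<le> \<phi> (Suc m) x"
  shows "m \<le> M \<Longrightarrow> hit_prob E m x A \<le> \<phi> m x"
proof (induction m arbitrary: x)
  case 0
  then show ?case using base[of 0 x] by (auto simp: indicator_def)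
next
  case (Suc m)
  show ?case
  proof (cases "x \<in> A")
    case True
    then show ?thesis using base[of "Suc m" x] Suc.prems measure_pmf.emeasure_le_1 order_trans by blast
  next
    case False
    have "emeasure (path_pmf E (Suc m) x) {w. set w \<inter> A \<noteq> {}} =
        (\<integral>\<^sup>+y. hit_prob E m y A \<partial>walk_step E x)"
      using False by (simp add: emeasure_bind_pmf vimage_def)
    also have "\<dots> \<le> (\<integral>\<^sup>+y. \<phi> m y \<partial>walk_step E x)"
      using Suc by (intro nn_integral_mono) auto
    also have "\<dots> \<le> \<phi> (Suc m) x" by (rule super)
    finally show ?thesis .
  qed
qed

text \<open>\<open>P\<close> sees only the first \<open>m + 1\<close> vertices. Wherever these end,
  the remaining \<open>m'\<close> steps reach \<open>y\<close> with probability at most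
  \<open>b\<close>, so the two constraints cost a product.\<close>

lemma emeasure_closed_path_le:
  assumes b: "\<And>z. pmf (walk_at E m' z) y \<le> b"
  shows "emeasure (path_pmf E (m + m') x) {w. last w = y \<and> P (take (Suc m) w)} \<le>
    ennreal b * emeasure (path_pmf E m x) {w. P w}"
proof -
  have "emeasure (path_pmf E (m + m') x) {w. last w = y \<and> P (take (Suc m) w)} =
     (\<integral>\<^sup>+w. emeasure (path_pmf E m' (last w)) {v. last (w @ tl v) = y \<and> P (take (Suc m) (w @ tl v))} \<partial>path_pmf E m x)"
    by (simp add: path_pmf_add emeasure_bind_pmf vimage_def)
  also have "\<dots> \<le> (\<integral>\<^sup>+w. ennreal b * indicator {w. P w} w \<partial>path_pmf E m x)"
  proof (rule nn_integral_mono_AE, rule AE_pmfI)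
    fix w assume w: "w \<in> set_pmf (path_pmf E m x)"
    note l = set_path_pmf_length[OF w]
    have "emeasure (path_pmf E m' (last w)) {v. last (w @ tl v) = y \<and> P (take (Suc m) (w @ tl v))} \<le>
      emeasure (path_pmf E m' (last w)) (if P w then {v. last v = y} else {})"
    proof (rule emeasure_mono_AE, rule AE_pmfI, rule impI)
      fix v assume v: "v \<in> set_pmf (path_pmf E m' (last w))"
        "v \<in> {v. last (w @ tl v) = y \<and> P (take (Suc m) (w @ tl v))}"
      have "last (w @ tl v) = last v"
        using set_path_pmf_length[OF v(1)] by (cases v; cases "tl v") auto
      then show "v \<in> (if P w then {v. last v = y} else {})" using v l by auto
    qed simp
    also have "\<dots> = ennreal (pmf (walk_at E m' (last w)) y) * indicator {w. P w} w"
      by (auto simp: walk_at_def emeasure_pmf_single[symmetric] vimage_def)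
    also have "\<dots> \<le> ennreal b * indicator {w. P w} w"
      using b by (intro mult_right_mono ennreal_leI) auto
    finally show "emeasure (path_pmf E m' (last w)) {v. last (w @ tl v) = y \<and> P (take (Suc m) (w @ tl v))} \<le>
      ennreal b * indicator {w. P w} w" .
  qed
  also have "\<dots> = ennreal b * emeasure (path_pmf E m x) {w. P w}"
    by (simp add: nn_integral_cmult_indicator)
  finally show ?thesis .
qed

lemma path_weight_rev:
  assumes "\<And>a b. transition E a b = transition E b a"
  shows "path_weight E (rev w) = path_weight E w"
proof (induction w)
  case (Cons a v)
  show ?case
  proof (cases v)
    case v: (Cons b w)
    have "path_weight E (rev w @ b # [a]) = path_weight E (rev w @ [b]) * path_weight E (b # [a])"
      by (rule path_weight_append)
    then have "path_weight E (rev (a # v)) = path_weight E v * transition E b a"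
      using Cons.IH v by simp
    also have "transition E b a = transition E a b" by (rule assms)
    finally show ?thesis using v by simp
  qed simp
qed simp

text \<open>Under a symmetric transition matrix reversal preserves weights and maps the paths from
  \<open>x\<close> to \<open>y\<close> bijectively to those from \<open>y\<close> to
  \<open>x\<close>.\<close>

lemma emeasure_path_rev:
  assumes sym: "\<And>a b. transition E a b = transition E b a"
  shows "emeasure (path_pmf E n x) {w. last w = y \<and> P w} =
    emeasure (path_pmf E n y) {w. last w = x \<and> P (rev w)}"
proof -
  have *: "emeasure (path_pmf E n x) {w. last w = y \<and> P w} =
     (\<integral>\<^sup>+w. ennreal (path_weight E w) \<partial>count_space {w. length w = Suc n \<and> hd w = x \<and> last w = y \<and> P w})"
    for x y P
  proof -
    let ?A = "{w. last w = y \<and> P w}" and ?B = "{w. length w = Suc n \<and> hd w = x \<and> last w = y \<and> P w}"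
    have "emeasure (path_pmf E n x) ?A = emeasure (path_pmf E n x) ?B"
      by (rule emeasure_eq_AE) (auto intro!: AE_pmfI dest: set_path_pmf_length)
    also have "\<dots> = (\<integral>\<^sup>+w. ennreal (pmf (path_pmf E n x) w) \<partial>count_space ?B)"
      by (rule nn_integral_pmf[symmetric])
    also have "\<dots> = (\<integral>\<^sup>+w. ennreal (path_weight E w) \<partial>count_space ?B)"
      by (intro nn_integral_cong) (simp add: pmf_path_pmf)
    finally show ?thesis .
  qed
  have "bij_betw rev {w. length w = Suc n \<and> hd w = x \<and> last w = y \<and> P w}
      {w. length w = Suc n \<and> hd w = y \<and> last w = x \<and> P (rev w)}"
    by (rule bij_betwI[of _ _ _ rev]) (auto simp: hd_rev last_rev)
  from nn_integral_bij_count_space[OF this, of "\<lambda>w. ennreal (path_weight E w)"]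
  show ?thesis unfolding *[of x] *[of y] by (simp add: path_weight_rev[OF sym])
qed

lemma pmf_walk_at_sym:
  assumes "\<And>a b. transition E a b = transition E b a"
  shows "pmf (walk_at E n x) y = pmf (walk_at E n y) x"
proof -
  have "ennreal (pmf (walk_at E n x) y) = emeasure (path_pmf E n x) {w. last w = y \<and> True}" for x y
    by (simp add: emeasure_pmf_single[symmetric] walk_at_def vimage_def)
  then have "ennreal (pmf (walk_at E n x) y) = ennreal (pmf (walk_at E n y) x)"
    using emeasure_path_rev[of E n x y "\<lambda>_. True"] assms by simp
  then show ?thesis by simp
qed

text \<open>Counting measure is invariant for a symmetric walk: exchanging start and end turns the
  sum over all starts into the total masses of the walks started in \<open>B\<close>.\<close>

lemma nn_integral_start_walk_at:
  assumes sym: "\<And>a b. transition E a b = transition E b a" and B: "finite B"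
  shows "(\<integral>\<^sup>+x. emeasure (walk_at E n x) B \<partial>count_space UNIV) = of_nat (card B)"
proof -
  have "(\<integral>\<^sup>+x. emeasure (walk_at E n x) B \<partial>count_space UNIV) =
     (\<integral>\<^sup>+x. (\<Sum>y\<in>B. ennreal (pmf (walk_at E n y) x)) \<partial>count_space UNIV)"
  proof (rule nn_integral_cong)
    fix x
    have "emeasure (walk_at E n x) B = (\<Sum>y\<in>B. emeasure (walk_at E n x) {y})"
      using B by (intro emeasure_eq_sum_singleton) auto
    then show "emeasure (walk_at E n x) B = (\<Sum>y\<in>B. ennreal (pmf (walk_at E n y) x))"
      by (simp add: emeasure_pmf_single pmf_walk_at_sym[OF sym, of n x])
  qed
  also have "\<dots> = (\<Sum>y\<in>B. \<integral>\<^sup>+x. ennreal (pmf (walk_at E n y) x) \<partial>count_space UNIV)"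
    by (rule nn_integral_sum) simp
  finally show ?thesis by (simp add: nn_integral_pmf)
qed

text \<open>A closed path meeting \<open>H\<close> does so in its first or in its second half; time reversal
  reduces the second case to the first.\<close>

lemma emeasure_closed_path_hit_le:
  assumes sym: "\<And>a b. transition E a b = transition E b a"
    and b: "\<And>z. pmf (walk_at E m z) x \<le> b" "\<And>z. pmf (walk_at E m' z) x \<le> b"
    and h: "hit_prob E m x H \<le> h"
      "hit_prob E m' x H \<le> h"
  shows "emeasure (path_pmf E (m + m') x) {w. last w = x \<and> set w \<inter> H \<noteq> {}} \<le> 2 * (ennreal b * h)"
proof -
  let ?p = "path_pmf E (m + m') x"
  let ?P = "\<lambda>w. set w \<inter> H \<noteq> {}"
  let ?B1 = "{w. last w = x \<and> ?P (take (Suc m) w)}"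
  let ?B2 = "{w. last w = x \<and> ?P (take (Suc m') (rev w))}"
  have "emeasure ?p {w. last w = x \<and> ?P w} \<le> emeasure ?p (?B1 \<union> ?B2)"
  proof (rule emeasure_mono_AE, rule AE_pmfI, rule impI)
    fix w assume w: "w \<in> set_pmf ?p" "w \<in> {w. last w = x \<and> ?P w}"
    \<comment> \<open>Both halves keep the vertex at index \<open>m\<close>, where they
      meet.\<close>
    have "take (Suc m') (rev w) = rev (drop m w)"
      using set_path_pmf_length[OF w(1)] by (simp add: take_rev)
    moreover have "set w \<subseteq> set (take (Suc m) w) \<union> set (drop m w)"
    proof -
      have "set w = set (take m w) \<union> set (drop m w)" by (metis append_take_drop_id set_append)
      moreover have "set (take m w) \<subseteq> set (take (Suc m) w)" by (rule set_take_subset_set_take) simp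
      ultimately show ?thesis by blast
    qed
    ultimately show "w \<in> ?B1 \<union> ?B2" using w(2) by auto
  qed simp
  also have "\<dots> \<le> emeasure ?p ?B1 + emeasure ?p ?B2" by (rule emeasure_subadditive) auto
  also have "emeasure ?p ?B2 = emeasure (path_pmf E (m' + m) x) {w. last w = x \<and> ?P (take (Suc m') w)}"
    using emeasure_path_rev[OF sym, where P="\<lambda>w. ?P (take (Suc m') (rev w))" and x=x and y=x and n="m + m'"]
    by (simp add: add.commute)
  also have "emeasure ?p ?B1 + \<dots> \<le> ennreal b * h + ennreal b * h"
    by (intro add_mono order_trans[OF emeasure_closed_path_le[OF b(2)]]
        order_trans[OF emeasure_closed_path_le[OF b(1)]] mult_left_mono h) auto
  finally show ?thesis by (simp add: mult_2)
qed

section \<open>The heat kernel bound\<close>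

text \<open>On [0, 2] the cubic term in x - x^3/6 takes away at most 2x/3. The interval contains the
  angles up to pi/2 to which the bound is applied.\<close>

lemma sin_ge_third: 
  assumes "0 \<le> x" "x \<le> 2" shows "x / 3 \<le> sin (x::real)"
proof -
  have "\<bar>sin x - (\<Sum>m<3. sin_coeff m * x ^ m)\<bar> \<le> inverse (fact 3) * \<bar>x\<bar> ^ 3"
    by (rule Maclaurin_sin_bound)
  then have "\<bar>sin x - x\<bar> \<le> x ^ 3 / 6"
    using assms by (simp add: eval_nat_numeral sin_coeff_def field_simps)
  moreover have "x ^ 3 \<le> 4 * x"
    using assms mult_mono[of "x*x" 4 x x] mult_mono[of x 2 x 2] by (simp add: power3_eq_cube)
  ultimately show ?thesis by linarith
qed

lemma sum_geometric_le:
  assumes "0 \<le> q" "q < (1::real)" shows "(\<Sum>k<n. q ^ k) \<le> 1 / (1 - q)"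
  using assms by (subst sum_gp_strict) (auto simp: divide_right_mono)

text \<open>When \<open>n\<close> is at least \<open>M * M\<close> the summand decays geometrically
  in the distance from \<open>k\<close> to the nearest multiple of \<open>M\<close>, where the sine
  vanishes, at a rate that depends on \<open>d\<close> alone. Hence \<open>K\<close> is uniform in
  \<open>M\<close> and \<open>n\<close>.\<close>

lemma sum_exp_sin_le:
  assumes d: "0 < d"
  obtains K where "0 < K" "\<And>M n. 0 < M \<Longrightarrow> M * M \<le> n \<Longrightarrow>
    (\<Sum>k<2*M. exp (- real n * (sin (pi * real k / real M))\<^sup>2 / (2 * d))) \<le> K"
proof -
  \<comment> \<open>The exponent is 4/9 divided by \<open>2 * d\<close>. The 4/9 comes from sin t >=
    t/3 for the angle t >= 2k/M, together with M^2 <= n and k <= k^2.\<close>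
  define q where "q = exp (- (2 / (9 * d)))"
  have q: "0 < q" "q < 1" using d by (auto simp: q_def)
  have "(\<Sum>k<2*M. exp (- real n * (sin (pi * real k / real M))\<^sup>2 / (2 * d))) \<le> 4 / (1 - q)"
    if M: "0 < M" and n: "M * M \<le> n" for M n
  proof -
    define g where "g k = exp (- real n * (sin (pi * real k / real M))\<^sup>2 / (2 * d))" for k
    have low: "exp (- real n * t\<^sup>2 / (2 * d)) \<le> q ^ k"
      if k: "2 * k \<le> M" and t: "t = sin (pi * real k / real M)" for k t
    proof -
      have "2 \<le> pi" by (rule pi_ge_two)
      then have a: "2 * real k / real M / 3 \<le> pi * real k / real M / 3"
        by (intro divide_right_mono mult_right_mono) auto
      have "pi * real k / real M \<le> 2"
      proof -
        have "2 * real k \<le> real M" using k by linarith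
        then have "pi * (2 * real k) \<le> 4 * real M" using pi_less_4 by (intro mult_mono) auto
        then show ?thesis using M by (simp add: field_simps)
      qed
      then have "(pi * real k / real M) / 3 \<le> t" unfolding t by (intro sin_ge_third) auto
      with a have "2 * real k / real M / 3 \<le> t" by (rule order_trans)
      then have "(2 * real k / real M / 3)\<^sup>2 \<le> t\<^sup>2" by (intro power_mono) auto
      then have "real n * (2 * real k / real M / 3)\<^sup>2 \<le> real n * t\<^sup>2" by (intro mult_left_mono) auto
      moreover have "4 / 9 * real k \<le> real n * (2 * real k / real M / 3)\<^sup>2"
      proof -
        have "real (M * M) \<le> real n" using n by (simp only: of_nat_le_iff)
        then have "real (M * M) * (2 * real k / real M / 3)\<^sup>2 \<le> real n * (2 * real k / real M / 3)\<^sup>2"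
          by (intro mult_right_mono) auto
        moreover have "real (M * M) * (2 * real k / real M / 3)\<^sup>2 = 4 / 9 * (real k * real k)"
          using M by (simp add: power2_eq_square field_simps)
        moreover have "real k \<le> real k * real k" by (cases k) (auto simp: field_simps)
        ultimately show ?thesis by linarith
      qed
      ultimately have "4 / 9 * real k / (2 * d) \<le> real n * t\<^sup>2 / (2 * d)"
        using d by (intro divide_right_mono) auto
      moreover have "4 / 9 * real k / (2 * d) = real k * (2 / (9 * d))" using d by (simp add: field_simps)
      ultimately have "- real n * t\<^sup>2 / (2 * d) \<le> real k * (- (2 / (9 * d)))" by simp
      then have "exp (- real n * t\<^sup>2 / (2 * d)) \<le> exp (real k * (- (2 / (9 * d))))" by (simp only: exp_le_cancel_iff)
      then show ?thesis by (simp only: q_def exp_of_nat_mult)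
    qed
    have g: "g k \<le> q ^ k + q ^ (M - k)" if k: "k < M" for k
    proof (cases "2 * k \<le> M")
      case True
      then have "g k \<le> q ^ k" unfolding g_def by (rule low) simp
      then show ?thesis using q by (smt (verit) zero_le_power)
    next
      case False
      have "sin (pi * real k / real M) = sin (pi - pi * real k / real M)" by simp
      also have "pi - pi * real k / real M = pi * real (M - k) / real M"
        using k M by (simp add: of_nat_diff field_simps)
      finally have "g k \<le> q ^ (M - k)" unfolding g_def using False by (intro low) auto
      then show ?thesis using q by (smt (verit) zero_le_power)
    qed
    have per: "g (k + M) = g k" for k
    proof -
      have "pi * real (k + M) / real M = pi * real k / real M + pi" using M by (simp add: field_simps)
      then show ?thesis unfolding g_def by (simp only: sin_periodic_pi) simp
    qed
    have "(\<Sum>k<2*M. g k) = (\<Sum>k<M. g k) + (\<Sum>k<M. g (k + M))"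
      using sum.atLeastLessThan_concat[of 0 M "2 * M" g] sum.shift_bounds_nat_ivl[of g 0 M M]
      by (simp add: mult_2 lessThan_atLeast0)
    also have "\<dots> = 2 * (\<Sum>k<M. g k)" by (simp add: per)
    also have "\<dots> \<le> 2 * (\<Sum>k<M. q ^ k + q ^ (M - k))"
      by (intro mult_left_mono sum_mono g) auto
    also have "\<dots> = 2 * ((\<Sum>k<M. q ^ k) + (\<Sum>k<M. q ^ (M - k)))" by (simp add: sum.distrib)
    also have "(\<Sum>k<M. q ^ (M - k)) = (\<Sum>k<M. q ^ Suc k)"
      by (rule sum.reindex_bij_witness[of _ "\<lambda>k. M - Suc k" "\<lambda>k. M - Suc k"]) (auto simp: Suc_diff_Suc)
    also have "\<dots> \<le> (\<Sum>k<M. q ^ k)" using q by (intro sum_mono) (simp add: mult_left_le_one_le)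
    also have "2 * ((\<Sum>k<M. q ^ k) + (\<Sum>k<M. q ^ k)) \<le> 2 * (1 / (1 - q) + 1 / (1 - q))"
      using q by (intro mult_left_mono add_mono sum_geometric_le) auto
    finally show ?thesis by (simp add: g_def)
  qed
  moreover have "0 < 4 / (1 - q)" using q by simp
  ultimately show ?thesis using that by blast
qed

section \<open>Character sums and the walk on the torus\<close>

lemma sum_cos_nonneg:
  fixes z :: int
  assumes M: "0 < M"
  shows "0 \<le> (\<Sum>k<2*M. cos (pi * real k / real M * real_of_int z))"
proof -
  define \<beta> where "\<beta> = pi * real_of_int z / real M"
  define S where "S n = (\<Sum>k<n. cos (real k * \<beta>))" for n
  \<comment> \<open>Summation as for the Dirichlet kernel: multiplied by 2 sin(\<beta>/2) the
    cosines telescope, and over \<open>2 * M\<close> terms the two ends cancel. So the sum is 0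
    unless sin(\<beta>/2) = 0, and then every cosine is 1.\<close>
  have tele: "2 * sin (\<beta> / 2) * S n = sin ((real n - 1/2) * \<beta>) + sin (\<beta> / 2)" for n
  proof (induction n)
    case 0
    have "(real 0 - 1/2) * \<beta> = - (\<beta> / 2)" by simp
    then show ?case by (simp only: S_def sin_minus) simp
  next
    case (Suc n)
    have "2 * sin (\<beta> / 2) * cos (real n * \<beta>) = sin (real n * \<beta> + \<beta> / 2) - sin (real n * \<beta> - \<beta> / 2)"
      by (simp add: sin_add sin_diff)
    moreover have "real n * \<beta> + \<beta> / 2 = (real (Suc n) - 1/2) * \<beta>" "real n * \<beta> - \<beta> / 2 = (real n - 1/2) * \<beta>"
      by (simp_all add: field_simps)
    ultimately show ?case using Suc by (simp add: S_def algebra_simps)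
  qed
  have "(real (2 * M) - 1/2) * \<beta> = (2 * pi) * of_int z - \<beta> / 2"
    using M by (simp add: \<beta>_def field_simps)
  then have "sin ((real (2 * M) - 1/2) * \<beta>) = - sin (\<beta> / 2)"
    by (simp only: sin_diff sin_int_2pin cos_int_2pin)
  then have "sin (\<beta> / 2) = 0 \<or> S (2 * M) = 0" using tele[of "2 * M"] by simp
  then have "0 \<le> S (2 * M)"
  proof
    assume "sin (\<beta> / 2) = 0"
    then obtain i where i: "\<beta> / 2 = of_int i * pi" by (auto simp: sin_zero_iff_int2)
    have "cos (real k * \<beta>) = 1" for k
    proof -
      have "real k * \<beta> = (2 * pi) * of_int (int k * i)" using i by simp
      then show ?thesis by (simp only: cos_int_2pin)
    qed
    then show ?thesis by (simp add: S_def)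
  qed simp
  then show ?thesis by (simp add: S_def \<beta>_def field_simps)
qed

definition torus_angles :: "nat \<Rightarrow> ('d::finite \<Rightarrow> nat) set" where
  "torus_angles M = (\<Pi>\<^sub>E i\<in>UNIV. {..<2 * M})"

text \<open>For \<open>n\<close> steps of the walk projected to the torus of side \<open>2 M\<close>, the probability of a displacement
  \<open>z\<close>, expanded in characters. Only the inequality in \<open>pmf_walk_at_le_torus_kernel\<close> is needed.\<close>

definition torus_kernel :: "nat \<Rightarrow> nat \<Rightarrow> int ^ 'd::finite \<Rightarrow> real" where
  "torus_kernel M n z = (\<Sum>k\<in>torus_angles M.
     ((\<Sum>i\<in>UNIV. cos (pi * real (k i) / real M)) / real CARD('d)) ^ n *
     (\<Prod>i\<in>UNIV. cos (pi * real (k i) / real M * real_of_int (z $ i)))) / real (2 * M) ^ CARD('d)"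

text \<open>At time 0 the sum factors into one sum of cosines per coordinate. With the value 1 at
  displacement 0, the kernel then dominates the indicator of 0.\<close>

lemma torus_kernel_0_nonneg: "0 < M \<Longrightarrow> 0 \<le> torus_kernel M 0 (z :: int ^ 'd::finite)"
  unfolding torus_kernel_def torus_angles_def
  by (subst power_0, subst mult_1, subst prod_sum_PiE[symmetric])
    (simp, simp, intro divide_nonneg_nonneg prod_nonneg sum_cos_nonneg, auto)

lemma torus_kernel_0_0: "0 < M \<Longrightarrow> torus_kernel M 0 (0 :: int ^ 'd::finite) = 1"
  unfolding torus_kernel_def torus_angles_def by (simp add: card_PiE)

text \<open>A product of cosines is an eigenfunction of the average over neighbours, with the mean
  of the cosines of the angles as eigenvalue; each step adds one power of it.\<close>

lemma torus_kernel_Suc: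
  "torus_kernel M (Suc n) (z :: int ^ 'd::finite) =
    (\<Sum>i\<in>UNIV. torus_kernel M n (z + axis i 1) + torus_kernel M n (z - axis i 1)) / (2 * real CARD('d))"
proof -
  let ?D = "real CARD('d)"
  let ?t = "\<lambda>k i. pi * real (k i) / real M" and ?N = "real (2 * M) ^ CARD('d)"
  let ?p = "\<lambda>k z. \<Prod>i\<in>UNIV. cos (?t k i * real_of_int ((z :: int ^ 'd) $ i))"
  let ?f = "\<lambda>k. (\<Sum>i\<in>UNIV. cos (?t k i)) / ?D"
  have step: "?p k (z + axis j 1) + ?p k (z - axis j 1) = 2 * cos (?t k j) * ?p k z" for k :: "'d \<Rightarrow> nat" and j
  proof -
    define R where "R = (\<Prod>i\<in>UNIV - {j}. cos (?t k i * real_of_int (z $ i)))"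
    have P: "?p k (z + axis j c) = cos (?t k j * real_of_int (z $ j + c)) * R" for c
    proof -
      have "?p k (z + axis j c) = cos (?t k j * real_of_int ((z + axis j c) $ j)) *
          (\<Prod>i\<in>UNIV - {j}. cos (?t k i * real_of_int ((z + axis j c) $ i)))"
        by (rule prod.remove) auto
      also have "(\<Prod>i\<in>UNIV - {j}. cos (?t k i * real_of_int ((z + axis j c) $ i))) = R"
        unfolding R_def by (intro prod.cong) (auto simp: axis_def)
      finally show ?thesis by (simp only: vector_add_component axis_nth)
    qed
    have "axis j 0 = (0 :: int ^ 'd)" "z - axis j 1 = z + axis j (-1)" by (simp_all add: vec_eq_iff axis_def)
    then have "?p k (z + axis j 1) = cos (?t k j * real_of_int (z $ j + 1)) * R"
      "?p k (z - axis j 1) = cos (?t k j * real_of_int (z $ j - 1)) * R"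
      "?p k z = cos (?t k j * real_of_int (z $ j)) * R"
      using P[of 1] P[of "-1"] P[of 0] by (simp_all only: add_0_right uminus_add_conv_diff diff_conv_add_uminus)
    moreover have "cos (?t k j * real_of_int (z $ j + 1)) + cos (?t k j * real_of_int (z $ j - 1)) =
        2 * cos (?t k j) * cos (?t k j * real_of_int (z $ j))"
      unfolding of_int_add of_int_diff of_int_1 distrib_left right_diff_distrib mult_1_right cos_add cos_diff
      by simp
    ultimately show ?thesis by (simp only: distrib_right[symmetric] mult.assoc)
  qed
  have "(\<Sum>i\<in>UNIV. torus_kernel M n (z + axis i 1) + torus_kernel M n (z - axis i 1)) =
     (\<Sum>i\<in>UNIV. (\<Sum>k\<in>torus_angles M. ?f k ^ n * (?p k (z + axis i 1) + ?p k (z - axis i 1))) / ?N)"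
    unfolding torus_kernel_def by (simp only: distrib_left sum.distrib add_divide_distrib)
  also have "\<dots> = (\<Sum>i\<in>UNIV. \<Sum>k\<in>torus_angles M. ?f k ^ n * (2 * cos (?t k i) * ?p k z)) / ?N"
    by (simp only: step sum_divide_distrib)
  also have "\<dots> = (\<Sum>k\<in>torus_angles M. \<Sum>i\<in>UNIV. ?f k ^ n * (2 * cos (?t k i) * ?p k z)) / ?N"
    by (subst sum.swap) simp
  also have "\<dots> = (\<Sum>k\<in>torus_angles M. 2 * ?D * (?f k ^ Suc n * ?p k z)) / ?N"
  proof -
    have "(\<Sum>i\<in>UNIV. ?f k ^ n * (2 * cos (?t k i) * ?p k z)) = 2 * ?D * (?f k ^ Suc n * ?p k z)" for k :: "'d \<Rightarrow> nat"
    proof -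
      have "(\<Sum>i\<in>UNIV. ?f k ^ n * (2 * cos (?t k i) * ?p k z)) = (\<Sum>i\<in>UNIV. cos (?t k i) * (2 * ?f k ^ n * ?p k z))"
        by (intro sum.cong refl) simp
      also have "\<dots> = (?D * ?f k) * (2 * ?f k ^ n * ?p k z)"
        by (simp only: sum_distrib_right[symmetric]) simp
      finally show ?thesis by simp
    qed
    then show ?thesis by simp
  qed
  also have "\<dots> = 2 * ?D * torus_kernel M (Suc n) z"
    unfolding torus_kernel_def by (simp only: sum_distrib_left[symmetric] times_divide_eq_right)
  finally show ?thesis by simp
qed

text \<open>Both sides obey the same first step recursion, so the comparison at time 0 propagates.
  The right side also counts displacements that differ by multiples of \<open>2 * M\<close>, hence
  an inequality.\<close>

lemma pmf_walk_at_le_torus_kernel: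
  assumes "0 < M"
  shows "pmf (walk_at zd_edges n (x :: int ^ 'd::finite)) y \<le> torus_kernel M n (x - y)"
proof (induction n arbitrary: x)
  case 0
  show ?case using torus_kernel_0_nonneg[OF assms, of "x - y"] torus_kernel_0_0[OF assms, where 'd='d]
    by (auto simp: walk_at_0 indicator_def)
next
  case (Suc n)
  let ?p = "\<lambda>z. pmf (walk_at zd_edges n z) y"
  have "pmf (walk_at zd_edges (Suc n) x) y = (\<Sum>i\<in>UNIV. ?p (x + axis i 1) + ?p (x - axis i 1)) / (2 * real CARD('d))"
    by (simp add: walk_at_Suc pmf_bind integral_walk_step_zd)
  also have "\<dots> \<le> (\<Sum>i\<in>UNIV. torus_kernel M n (x + axis i 1 - y) + torus_kernel M n (x - axis i 1 - y)) / (2 * real CARD('d))"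
    by (intro divide_right_mono sum_mono add_mono Suc) auto
  also have "\<dots> = torus_kernel M (Suc n) (x - y)"
    by (simp add: torus_kernel_Suc algebra_simps)
  finally show ?case .
qed

lemma torus_kernel_le:
  assumes n: "0 < n"
  shows "torus_kernel M n (z :: int ^ 'd::finite) \<le>
    ((\<Sum>k<2*M. exp (- real n * (sin (pi * real k / real M))\<^sup>2 / (2 * real CARD('d)))) / real (2 * M)) ^ CARD('d)"
proof -
  let ?D = "real CARD('d)"
  let ?t = "\<lambda>k i. pi * real (k i) / real M"
  let ?g = "\<lambda>k. exp (- real n * (sin (pi * real k / real M))\<^sup>2 / (2 * ?D))"
  have abs: "\<bar>((\<Sum>i\<in>UNIV. cos (?t k i)) / ?D) ^ n * (\<Prod>i\<in>UNIV. cos (?t k i * real_of_int (z $ i)))\<bar> \<le> (\<Prod>i\<in>(UNIV :: 'd set). ?g (k i))"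
    for k :: "'d \<Rightarrow> nat"
  proof -
    \<comment> \<open>From (1 - |cos t|)^2 >= 0. The sine treats angles near 0 and near pi alike,
      and both matter: the lattice is bipartite, so eigenvalues near -1 occur as well as near
      1.\<close>
    have c: "\<bar>cos t\<bar> \<le> 1 - (sin t)\<^sup>2 / 2" for t :: real
    proof -
      have "0 \<le> (1 - \<bar>cos t\<bar>)\<^sup>2" by simp
      then show ?thesis by (simp add: sin_squared_eq power2_diff field_simps)
    qed
    have "\<bar>(\<Sum>i\<in>UNIV. cos (?t k i)) / ?D\<bar> \<le> (\<Sum>i\<in>UNIV. \<bar>cos (?t k i)\<bar>) / ?D"
      by (simp add: abs_divide divide_right_mono sum_abs)
    also have "\<dots> \<le> (\<Sum>i\<in>UNIV. 1 - (sin (?t k i))\<^sup>2 / 2) / ?D"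
      by (intro divide_right_mono sum_mono c) auto
    also have "\<dots> = 1 + (\<Sum>i\<in>UNIV. - (sin (?t k i))\<^sup>2 / (2 * ?D))"
      by (simp add: sum_subtractf diff_divide_distrib sum_negf sum_divide_distrib[symmetric])
    \<comment> \<open>The exponential turns the sum over coordinates into a product, so that the sum
      over the torus factors into a power of a one-dimensional sum.\<close>
    also have "\<dots> \<le> exp (\<Sum>i\<in>UNIV. - (sin (?t k i))\<^sup>2 / (2 * ?D))" by (rule exp_ge_add_one_self)
    finally have "\<bar>(\<Sum>i\<in>UNIV. cos (?t k i)) / ?D\<bar> ^ n \<le> exp (\<Sum>i\<in>UNIV. - (sin (?t k i))\<^sup>2 / (2 * ?D)) ^ n"
      by (intro power_mono) auto
    also have "\<dots> = (\<Prod>i\<in>(UNIV :: 'd set). ?g (k i))"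
      by (simp add: exp_of_nat_mult[symmetric] exp_sum[symmetric] sum_distrib_left)
    finally have *: "\<bar>(\<Sum>i\<in>UNIV. cos (?t k i)) / ?D\<bar> ^ n \<le> (\<Prod>i\<in>(UNIV :: 'd set). ?g (k i))" .
    have "\<bar>\<Prod>i\<in>UNIV. cos (?t k i * real_of_int (z $ i))\<bar> \<le> 1"
      unfolding abs_prod by (intro prod_le_1) auto
    then have "\<bar>(\<Sum>i\<in>UNIV. cos (?t k i)) / ?D\<bar> ^ n * \<bar>\<Prod>i\<in>UNIV. cos (?t k i * real_of_int (z $ i))\<bar> \<le>
        (\<Prod>i\<in>(UNIV :: 'd set). ?g (k i)) * 1"
      using * by (intro mult_mono) (auto intro!: prod_nonneg)
    then show ?thesis by (simp only: abs_mult power_abs mult_1_right)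
  qed
  have "torus_kernel M n z \<le> (\<Sum>k\<in>torus_angles M. \<Prod>i\<in>(UNIV :: 'd set). ?g (k i)) / real (2 * M) ^ CARD('d)"
    unfolding torus_kernel_def
  proof (rule divide_right_mono)
    show "(\<Sum>k\<in>torus_angles M. ((\<Sum>i\<in>UNIV. cos (?t k i)) / ?D) ^ n * (\<Prod>i\<in>UNIV. cos (?t k i * real_of_int (z $ i)))) \<le>
       (\<Sum>k\<in>torus_angles M. \<Prod>i\<in>(UNIV :: 'd set). ?g (k i))"
    proof (rule sum_mono)
      fix k :: "'d \<Rightarrow> nat"
      show "((\<Sum>i\<in>UNIV. cos (?t k i)) / ?D) ^ n * (\<Prod>i\<in>UNIV. cos (?t k i * real_of_int (z $ i))) \<le> (\<Prod>i\<in>(UNIV :: 'd set). ?g (k i))"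
        using abs[of k] by (rule order_trans[OF abs_ge_self])
    qed
  qed simp
  also have "(\<Sum>k\<in>torus_angles M. \<Prod>i\<in>(UNIV :: 'd set). ?g (k i)) = (\<Prod>i\<in>(UNIV :: 'd set). \<Sum>k<2*M. ?g k)"
    unfolding torus_angles_def by (subst prod_sum_PiE) auto
  finally show ?thesis by (simp add: power_divide)
qed

lemma heat_kernel_bound:
  obtains C where "0 < C" "\<And>n (x :: int ^ 'd::finite) y. 0 < n \<Longrightarrow>
    pmf (walk_at zd_edges n x) y \<le> C / sqrt (real n) ^ CARD('d)"
proof -
  obtain K where K: "0 < K" "\<And>M n. 0 < M \<Longrightarrow> M * M \<le> n \<Longrightarrow>
    (\<Sum>k<2*M. exp (- real n * (sin (pi * real k / real M))\<^sup>2 / (2 * real CARD('d)))) \<le> K"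
    using sum_exp_sin_le[of "real CARD('d)"] by auto
  have "pmf (walk_at zd_edges n x) y \<le> K ^ CARD('d) / sqrt (real n) ^ CARD('d)" if n: "0 < n" for n and x y :: "int ^ 'd"
  proof -
    \<comment> \<open>Small enough for \<open>M * M \<le> n\<close>, and large enough that sqrt n <=
      2M, so that K / (2M) is at most K / sqrt n.\<close>
    define M where "M = nat \<lfloor>sqrt (real n)\<rfloor>"
    have s1: "1 \<le> sqrt (real n)" using n by simp
    then have f: "1 \<le> \<lfloor>sqrt (real n)\<rfloor>" by simp
    then have "real M = of_int \<lfloor>sqrt (real n)\<rfloor>" by (simp add: M_def)
    then have M: "0 < M" "real M \<le> sqrt (real n)" "sqrt (real n) \<le> 2 * real M"
    proof -
      show "0 < M" using f by (simp add: M_def)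
      show "real M \<le> sqrt (real n)" using \<open>real M = _\<close> by simp
      have "sqrt (real n) < of_int \<lfloor>sqrt (real n)\<rfloor> + 1" by linarith
      moreover have "(1 :: real) \<le> of_int \<lfloor>sqrt (real n)\<rfloor>" using f by linarith
      ultimately show "sqrt (real n) \<le> 2 * real M" using \<open>real M = _\<close> by linarith
    qed
    have "real (M * M) \<le> real n"
    proof -
      have "real M * real M \<le> sqrt (real n) * sqrt (real n)" using M by (intro mult_mono) auto
      then show ?thesis by simp
    qed
    then have MM: "M * M \<le> n" by (simp only: of_nat_le_iff)
    have "pmf (walk_at zd_edges n x) y \<le> torus_kernel M n (x - y)"
      by (rule pmf_walk_at_le_torus_kernel[OF M(1)])
    also have "\<dots> \<le> ((\<Sum>k<2*M. exp (- real n * (sin (pi * real k / real M))\<^sup>2 / (2 * real CARD('d)))) / real (2 * M)) ^ CARD('d)"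
      by (rule torus_kernel_le[OF n])
    also have "\<dots> \<le> (K / sqrt (real n)) ^ CARD('d)"
    proof (rule power_mono)
      have "(\<Sum>k<2*M. exp (- real n * (sin (pi * real k / real M))\<^sup>2 / (2 * real CARD('d)))) / real (2 * M) \<le> K / real (2 * M)"
        by (intro divide_right_mono K M MM) auto
      also have "\<dots> \<le> K / sqrt (real n)" using K M n by (intro divide_left_mono mult_pos_pos) auto
      finally show "(\<Sum>k<2*M. exp (- real n * (sin (pi * real k / real M))\<^sup>2 / (2 * real CARD('d)))) / real (2 * M) \<le> K / sqrt (real n)" .
    qed (auto intro!: divide_nonneg_nonneg sum_nonneg)
    finally show ?thesis by (simp add: power_divide)
  qed
  then show ?thesis using that[of "K ^ CARD('d)"] K by simp
qed

section \<open>Tails and hitting probabilities\<close>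

lemma two_power_fact_le: "2 ^ n * fact n \<le> (fact (2 * n) :: real)"
proof (induction n)
  case (Suc n)
  have "2 ^ Suc n * fact (Suc n) = (2 * real (Suc n)) * 1 * (2 ^ n * fact n :: real)" by simp
  also have "\<dots> \<le> (2 * real (Suc n)) * real (Suc (2 * n)) * fact (2 * n)"
    by (intro mult_mono mult_nonneg_nonneg Suc) auto
  also have "\<dots> = real (Suc (Suc (2 * n))) * (real (Suc (2 * n)) * fact (2 * n))" by simp
  also have "\<dots> = fact (Suc (Suc (2 * n)))" by (simp only: fact_Suc)
  also have "Suc (Suc (2 * n)) = 2 * Suc n" by simp
  finally show ?case .
qed simp

text \<open>Comparison of the even terms of the two power series, by (2m)! >= 2^m m!.\<close>

lemma cosh_le_exp_sq: "cosh x \<le> exp (x\<^sup>2 / 2)" for x :: real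
proof (rule sums_le[OF _ cosh_converges])
  have "(\<lambda>n. if even n then (x\<^sup>2 / 2) ^ (n div 2) /\<^sub>R fact (n div 2) else 0) sums (0 + exp (x\<^sup>2 / 2))"
    using sums_if[of "\<lambda>_. 0" 0 "\<lambda>n. (x\<^sup>2 / 2) ^ n /\<^sub>R fact n" "exp (x\<^sup>2 / 2)",
        OF sums_zero exp_converges] .
  then show "(\<lambda>n. if even n then (x\<^sup>2 / 2) ^ (n div 2) /\<^sub>R fact (n div 2) else 0) sums exp (x\<^sup>2 / 2)"
    by (simp only: add_0_left)
  fix n :: nat
  show "(if even n then x ^ n /\<^sub>R fact n else 0) \<le> (if even n then (x\<^sup>2 / 2) ^ (n div 2) /\<^sub>R fact (n div 2) else 0)"
  proof (cases "even n")
    case True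
    then obtain m where m: "n = 2 * m" by (elim evenE)
    have "(x\<^sup>2) ^ m / fact (2 * m) \<le> (x\<^sup>2) ^ m / (2 ^ m * fact m)"
      by (rule divide_left_mono[OF two_power_fact_le]) simp_all
    moreover have "x ^ n /\<^sub>R fact n = (x\<^sup>2) ^ m / fact (2 * m)"
    proof -
      have "x ^ n = (x\<^sup>2) ^ m" unfolding m by (rule power_mult)
      then show ?thesis unfolding m real_scaleR_def divide_inverse_commute by (rule arg_cong)
    qed
    moreover have "n div 2 = m" using m by simp
    moreover have "(x\<^sup>2 / 2) ^ m /\<^sub>R fact m = (x\<^sup>2) ^ m / (2 ^ m * fact m)"
    proof -
      have "(x\<^sup>2 / 2) ^ m = (x\<^sup>2) ^ m / 2 ^ m" by (rule power_divide)
      then show ?thesis unfolding real_scaleR_def divide_inverse_commute[of _ "2 ^ m * fact m"]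
        by (simp only: inverse_mult_distrib divide_inverse mult_ac)
    qed
    ultimately have "x ^ n /\<^sub>R fact n \<le> (x\<^sup>2 / 2) ^ (n div 2) /\<^sub>R fact (n div 2)"
      by (simp only:)
    then show ?thesis using True by (simp only: if_True)
  qed simp
qed

text \<open>In one step a coordinate moves by 1 up or down or stays, so its exponential moment
  averages terms of size at most cosh l. The resulting bound is sub-Gaussian and the same in every
  dimension.\<close>

lemma walk_at_exp_moment:
  "(\<integral>\<^sup>+y. ennreal (exp (l * real_of_int (y $ i - x $ i))) \<partial>walk_at zd_edges n (x :: int ^ 'd::finite)) \<le>
     ennreal (exp (l\<^sup>2 / 2) ^ n)"
proof (induction n arbitrary: x)
  case 0
  show ?case by (simp add: walk_at_0)
next
  case (Suc n)
  let ?D = "real CARD('d)"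
  let ?f = "\<lambda>z. exp (l * real_of_int (z $ i - x $ i))"
  have "(\<integral>\<^sup>+y. ennreal (exp (l * real_of_int (y $ i - x $ i))) \<partial>walk_at zd_edges (Suc n) x) =
     (\<integral>\<^sup>+z. (\<integral>\<^sup>+y. ennreal (?f z) * ennreal (exp (l * real_of_int (y $ i - z $ i))) \<partial>walk_at zd_edges n z) \<partial>walk_step zd_edges x)"
    unfolding walk_at_Suc_expectation
    by (intro nn_integral_cong) (simp add: ennreal_mult[symmetric] exp_add[symmetric] algebra_simps)
  also have "\<dots> = (\<integral>\<^sup>+z. ennreal (?f z) * (\<integral>\<^sup>+y. ennreal (exp (l * real_of_int (y $ i - z $ i))) \<partial>walk_at zd_edges n z) \<partial>walk_step zd_edges x)"
    by (simp add: nn_integral_cmult)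
  also have "\<dots> \<le> (\<integral>\<^sup>+z. ennreal (?f z) * ennreal (exp (l\<^sup>2 / 2) ^ n) \<partial>walk_step zd_edges x)"
    by (intro nn_integral_mono mult_left_mono Suc) auto
  also have "\<dots> = (\<integral>\<^sup>+z. ennreal (?f z) \<partial>walk_step zd_edges x) * ennreal (exp (l\<^sup>2 / 2) ^ n)"
    by (rule nn_integral_multc) simp
  also have "(\<integral>\<^sup>+z. ennreal (?f z) \<partial>walk_step zd_edges x) \<le> ennreal (exp (l\<^sup>2 / 2))"
  proof -
    have "?f (x + axis j 1) + ?f (x - axis j 1) \<le> 2 * cosh l" for j
    proof (cases "j = i")
      case True
      then show ?thesis by (simp add: cosh_def)
    next
      case False
      then show ?thesis using cosh_real_ge_1[of l] by (simp add: axis_def)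
    qed
    then have "(\<Sum>j\<in>UNIV. ?f (x + axis j 1) + ?f (x - axis j 1)) \<le> (\<Sum>j\<in>(UNIV :: 'd set). 2 * cosh l)"
      by (intro sum_mono)
    then have "(\<Sum>j\<in>UNIV. ?f (x + axis j 1) + ?f (x - axis j 1)) / (2 * ?D) \<le> (\<Sum>j\<in>(UNIV :: 'd set). 2 * cosh l) / (2 * ?D)"
      by (rule divide_right_mono) simp
    also have "\<dots> = cosh l" by simp
    also have "\<dots> \<le> exp (l\<^sup>2 / 2)" by (rule cosh_le_exp_sq)
    finally show ?thesis by (subst nn_integral_walk_step_zd) (auto intro: ennreal_leI)
  qed
  finally show ?case by (simp add: ennreal_mult[symmetric] mult_right_mono)
qed

section \<open>Distances, boxes and Gaussian tails\<close>

definition sup_dist :: "int ^ 'd::finite \<Rightarrow> int ^ 'd \<Rightarrow> int" where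
  "sup_dist x y = Max (range (\<lambda>i. \<bar>x $ i - y $ i\<bar>))"

lemma sup_dist_le_iff: "sup_dist x y \<le> r \<longleftrightarrow> (\<forall>i. \<bar>x $ i - y $ i\<bar> \<le> r)"
  by (simp add: sup_dist_def)

lemma sup_dist_ge_iff: "r \<le> sup_dist x y \<longleftrightarrow> (\<exists>i. r \<le> \<bar>x $ i - y $ i\<bar>)"
  by (simp add: sup_dist_def Max_ge_iff)

lemma sup_dist_nonneg [simp]: "0 \<le> sup_dist x y"
  by (simp add: sup_dist_ge_iff)

lemma sup_dist_self [simp]: "sup_dist x x = 0"
  by (simp add: sup_dist_def)

lemma sup_dist_sym: "sup_dist x y = sup_dist y x"
  by (simp add: sup_dist_def abs_minus_commute)

lemma sup_dist_triangle: "sup_dist x z \<le> sup_dist x y + sup_dist y z"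
proof -
  have "\<bar>x $ i - z $ i\<bar> \<le> sup_dist x y + sup_dist y z" for i
  proof -
    have "\<bar>x $ i - y $ i\<bar> \<le> sup_dist x y" "\<bar>y $ i - z $ i\<bar> \<le> sup_dist y z"
      using sup_dist_le_iff[of x y "sup_dist x y"] sup_dist_le_iff[of y z "sup_dist y z"] by auto
    then show ?thesis by linarith
  qed
  then show ?thesis by (simp add: sup_dist_le_iff)
qed

lemma sup_dist_edge: "{x, y} \<in> zd_edges \<Longrightarrow> sup_dist x (y :: int ^ 'd::finite) \<le> 1"
proof -
  assume "{x, y} \<in> zd_edges"
  then have "y \<in> neighbours zd_edges x" by (simp add: neighbours_def)
  then show ?thesis unfolding neighbours_zd by (auto simp: sup_dist_le_iff axis_def)
qed

definition zbox :: "int ^ 'd::finite \<Rightarrow> nat \<Rightarrow> (int ^ 'd) set" where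
  "zbox c s = {x. sup_dist x c \<le> int s}"

lemma finite_zbox: "finite (zbox c s)" and card_zbox: "card (zbox (c :: int ^ 'd::finite) s) = (2 * s + 1) ^ CARD('d)"
proof -
  let ?F = "\<Pi>\<^sub>E i\<in>UNIV. {c $ i - int s .. c $ i + int s}"
  have "bij_betw (\<lambda>f. \<chi> i. f i) ?F (zbox c s)"
    by (rule bij_betwI[of _ _ _ "\<lambda>x i. x $ i"]) (auto simp: zbox_def sup_dist_le_iff PiE_def Pi_def abs_le_iff
        algebra_simps; smt (verit))+
  moreover have "nat (2 * int s + 1) = 2 * s + 1" by simp
  ultimately show "finite (zbox c s)" "card (zbox c s) = (2 * s + 1) ^ CARD('d)"
    by (auto simp: bij_betw_finite[symmetric] bij_betw_same_card[symmetric] finite_PiE card_PiE)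
qed

text \<open>The radius is real because halves and sixths of integer distances occur.\<close>

definition far :: "int ^ 'd::finite \<Rightarrow> real \<Rightarrow> (int ^ 'd) set" where
  "far x a = {y. a \<le> real_of_int (sup_dist y x)}"

text \<open>Exponential Markov inequality, once for each sign of each coordinate. The bound is in
  terms of \<open>n\<close> for all times \<open>m \<le> n\<close>, so that one estimate serves
  every time within the horizon of a hitting argument.\<close>

lemma walk_at_tail:
  assumes n: "0 < n" "m \<le> n" and a: "0 \<le> a"
  shows "emeasure (walk_at zd_edges m (x :: int ^ 'd::finite)) (far x a) \<le>
    ennreal (2 * real CARD('d) * exp (- a\<^sup>2 / (2 * real n)))"
proof -
  let ?p = "walk_at zd_edges m x"
  define S where "S i c = {y. a \<le> c * real_of_int (y $ i - x $ i)}" for i and c :: real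
  have one: "emeasure ?p (S i c) \<le> ennreal (exp (- a\<^sup>2 / (2 * real n)))" if c: "c * c = 1" for i c
  proof -
    \<comment> \<open>The value a / n minimises -l a + n l^2 / 2, and \<open>c\<close>, which is 1
      or -1, selects the direction.\<close>
    define l where "l = c * (a / real n)"
    have la: "a / real n * (c * t) = l * t" for t by (simp add: l_def)
    have l2: "l\<^sup>2 = (a / real n)\<^sup>2" using c by (simp add: l_def power_mult_distrib power2_eq_square)
    have "emeasure ?p (S i c) = (\<integral>\<^sup>+y. indicator (S i c) y \<partial>?p)" by simp
    also have "\<dots> \<le> (\<integral>\<^sup>+y. ennreal (exp (- (a / real n * a))) * ennreal (exp (l * real_of_int (y $ i - x $ i))) \<partial>?p)"
    proof (intro nn_integral_mono)
      fix y
      have "1 \<le> exp (- (a / real n * a)) * exp (l * real_of_int (y $ i - x $ i))" if "y \<in> S i c"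
      proof -
        have "a / real n * a \<le> a / real n * (c * real_of_int (y $ i - x $ i))"
          using that a by (intro mult_left_mono) (auto simp: S_def)
        then show ?thesis unfolding la by (simp add: exp_add[symmetric])
      qed
      then show "indicator (S i c) y \<le> ennreal (exp (- (a / real n * a))) * ennreal (exp (l * real_of_int (y $ i - x $ i)))"
        by (auto simp: indicator_def ennreal_mult[symmetric])
    qed
    also have "\<dots> \<le> ennreal (exp (- (a / real n * a))) * ennreal (exp (l\<^sup>2 / 2) ^ m)"
      by (subst nn_integral_cmult) (auto intro!: mult_left_mono walk_at_exp_moment simp del: of_int_diff)
    also have "\<dots> = ennreal (exp (- (a / real n * a) + real m * (l\<^sup>2 / 2)))"
      by (simp only: ennreal_mult[symmetric] exp_ge_zero zero_le_power exp_add exp_of_nat_mult)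
    also have "- (a / real n * a) + real m * (l\<^sup>2 / 2) \<le> - a\<^sup>2 / (2 * real n)"
    proof -
      have "real m * (l\<^sup>2 / 2) \<le> real n * (l\<^sup>2 / 2)" using n by (intro mult_right_mono) auto
      also have "\<dots> = a\<^sup>2 / (2 * real n)" unfolding l2 using n by (simp add: power2_eq_square field_simps)
      finally show ?thesis using n by (simp add: power2_eq_square field_simps)
    qed
    finally show ?thesis by (simp add: ennreal_leI)
  qed
  have sub: "far x a \<subseteq> (\<Union>i\<in>UNIV. S i 1 \<union> S i (-1))"
  proof
    fix y assume "y \<in> far x a"
    then have a: "a \<le> real_of_int (sup_dist y x)" by (simp add: far_def)
    obtain i where "sup_dist y x \<le> \<bar>y $ i - x $ i\<bar>"
      using sup_dist_ge_iff[of "sup_dist y x" y x] by auto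
    with a have "a \<le> real_of_int \<bar>y $ i - x $ i\<bar>" by linarith
    then show "y \<in> (\<Union>i\<in>UNIV. S i 1 \<union> S i (-1))" by (auto simp: S_def abs_if split: if_splits)
  qed
  have "emeasure ?p (far x a) \<le> emeasure ?p (\<Union>i\<in>UNIV. S i 1 \<union> S i (-1))"
    by (rule emeasure_mono[OF sub]) simp
  also have "\<dots> \<le> (\<Sum>i\<in>UNIV. emeasure ?p (S i 1 \<union> S i (-1)))"
    by (rule emeasure_subadditive_finite) auto
  also have "\<dots> \<le> (\<Sum>i\<in>(UNIV :: 'd set). ennreal (2 * exp (- a\<^sup>2 / (2 * real n))))"
  proof (rule sum_mono)
    fix i :: 'd
    have "emeasure ?p (S i 1 \<union> S i (-1)) \<le> emeasure ?p (S i 1) + emeasure ?p (S i (-1))"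
      by (rule emeasure_subadditive) auto
    also have "\<dots> \<le> ennreal (exp (- a\<^sup>2 / (2 * real n))) + ennreal (exp (- a\<^sup>2 / (2 * real n)))"
      by (intro add_mono one) auto
    finally show "emeasure ?p (S i 1 \<union> S i (-1)) \<le> ennreal (2 * exp (- a\<^sup>2 / (2 * real n)))"
      by (simp add: ennreal_plus[symmetric] del: ennreal_plus)
  qed
  also have "\<dots> = ennreal (2 * real CARD('d) * exp (- a\<^sup>2 / (2 * real n)))"
    by (simp add: ennreal_of_nat_eq_real_of_nat ennreal_mult[symmetric] mult_ac)
  finally show ?thesis .
qed

text \<open>From 1 + u/d <= exp(u/d). With u of the order of a squared distance, this trades the
  Gaussian factor for a power that is still summable over the lattice.\<close>

lemma exp_minus_le_power:
  assumes "0 < u" "0 < d"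
  shows "exp (- u) \<le> (real d / u) ^ d"
proof -
  have "(u / real d) ^ d \<le> exp (u / real d) ^ d"
    using assms exp_ge_add_one_self[of "u / real d"] by (intro power_mono) (auto simp del: exp_ge_add_one_self)
  also have "\<dots> = exp u" using assms by (simp add: exp_of_nat_mult[symmetric])
  finally have "inverse (exp u) \<le> inverse ((u / real d) ^ d)" using assms by (intro le_imp_inverse_le) auto
  then show ?thesis by (simp add: exp_minus power_divide)
qed

text \<open>Reflection argument: after reaching distance \<open>\<rho>\<close> the walk is still at distance \<open>\<rho> / 2\<close> at the final time with
  probability at least \<open>1 / 2\<close>. If \<open>n\<close> is too large for that, the bound exceeds 1.\<close>

lemma hit_far_bound:
  obtains C where "0 < C" "\<And>n m \<rho> (x :: int ^ 'd::finite). 0 < n \<Longrightarrow> m \<le> n \<Longrightarrow> 0 < \<rho> \<Longrightarrow>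
    hit_prob zd_edges m x (far x \<rho>) \<le> ennreal (C * (real n / \<rho>\<^sup>2) ^ CARD('d))"
proof -
  let ?D = "real CARD('d)"
  \<comment> \<open>Beyond \<rho>^2 = A n the tail at distance \<rho>/2, that is 2d exp(-\<rho>^2 /
    (8n)) in dimension d, is at most 1/2.\<close>
  define A where "A = 8 * ln (4 * ?D)"
  have D1: "1 \<le> ?D" by (simp add: Suc_le_eq)
  then have "1 < 4 * ?D" by linarith
  then have A: "0 < A" by (simp add: A_def)
  define C where "C = A ^ CARD('d) + 4 * ?D * (8 * ?D) ^ CARD('d)"
  have C: "0 < C" using A D1 by (auto simp: C_def intro!: add_pos_nonneg)
  have "hit_prob zd_edges m x (far x \<rho>) \<le> ennreal (C * (real n / \<rho>\<^sup>2) ^ CARD('d))"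
    if n: "0 < n" "m \<le> n" "0 < \<rho>" for n m \<rho> and x :: "int ^ 'd"
  proof (cases "\<rho>\<^sup>2 \<le> A * real n")
    case True
    have "1 \<le> (A * (real n / \<rho>\<^sup>2)) ^ CARD('d)" using True n by (intro one_le_power) (simp add: field_simps)
    also have "\<dots> = A ^ CARD('d) * (real n / \<rho>\<^sup>2) ^ CARD('d)" by (simp only: power_mult_distrib)
    also have "\<dots> \<le> C * (real n / \<rho>\<^sup>2) ^ CARD('d)"
      by (intro mult_right_mono) (auto simp: C_def)
    finally have "1 \<le> ennreal (C * (real n / \<rho>\<^sup>2) ^ CARD('d))" by simp
    then show ?thesis using measure_pmf.emeasure_le_1 order_trans by blast
  next
    case False
    \<comment> \<open>The factor 2 makes up for the probability 1/2 of still being far at the end.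
      The rest satisfies the step recursion with equality, as \<open>emeasure_hit_le\<close>
      asks.\<close>
    define \<phi> where "\<phi> m y = 2 * emeasure (walk_at zd_edges m y) (far x (\<rho> / 2))" for m y
    have half: "1 \<le> \<phi> k y" if k: "k \<le> n" and y: "y \<in> far x \<rho>" for k y
    proof -
      let ?q = "measure (walk_at zd_edges k y)"
      have "emeasure (walk_at zd_edges k y) (far y (\<rho> / 2)) \<le> ennreal (2 * ?D * exp (- (\<rho> / 2)\<^sup>2 / (2 * real n)))"
        using n k by (intro walk_at_tail) auto
      then have "?q (far y (\<rho> / 2)) \<le> 2 * ?D * exp (- (\<rho> / 2)\<^sup>2 / (2 * real n))"
        by (simp add: measure_pmf.emeasure_eq_measure)
      also have "\<dots> \<le> 2 * ?D * exp (- ln (4 * ?D))"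
      proof -
        have "ln (4 * ?D) \<le> (\<rho> / 2)\<^sup>2 / (2 * real n)"
          using False n by (simp add: A_def power_divide field_simps)
        then show ?thesis by (intro mult_left_mono) auto
      qed
      also have "\<dots> = 1 / 2" using D1 by (simp add: exp_minus)
      finally have q: "?q (far y (\<rho> / 2)) \<le> 1 / 2" .
      have "UNIV \<subseteq> far y (\<rho> / 2) \<union> far x (\<rho> / 2)"
      proof
        fix z
        have "sup_dist y x \<le> sup_dist y z + sup_dist z x" by (rule sup_dist_triangle)
        then have "real_of_int (sup_dist y x) \<le> real_of_int (sup_dist z y) + real_of_int (sup_dist z x)"
          by (simp add: sup_dist_sym[of y z] flip: of_int_add)
        then show "z \<in> far y (\<rho> / 2) \<union> far x (\<rho> / 2)" using y by (auto simp: far_def)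
      qed
      then have "1 \<le> ?q (far y (\<rho> / 2) \<union> far x (\<rho> / 2))"
        by (metis measure_pmf.prob_space measure_pmf.finite_measure_mono sets_measure_pmf UNIV_I space_measure_pmf)
      also have "\<dots> \<le> ?q (far y (\<rho> / 2)) + ?q (far x (\<rho> / 2))"
        by (rule measure_Un_le) auto
      finally have "1 \<le> 2 * ?q (far x (\<rho> / 2))" using q by linarith
      then show ?thesis
        by (simp add: \<phi>_def measure_pmf.emeasure_eq_measure ennreal_mult'[symmetric] flip: ennreal_numeral ennreal_1)
    qed
    have "hit_prob zd_edges m x (far x \<rho>) \<le> \<phi> m x"
    proof (rule emeasure_hit_le[of n _ \<phi>])
      show "(\<integral>\<^sup>+y. \<phi> m y \<partial>walk_step zd_edges x) \<le> \<phi> (Suc m) x" for m x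
        by (simp add: \<phi>_def nn_integral_cmult walk_at_Suc emeasure_bind_pmf)
    qed (use half n in auto)
    also have "\<dots> \<le> 2 * ennreal (2 * ?D * exp (- (\<rho> / 2)\<^sup>2 / (2 * real n)))"
      unfolding \<phi>_def using n by (intro mult_left_mono walk_at_tail) auto
    also have "\<dots> = ennreal (4 * ?D * exp (- (\<rho>\<^sup>2 / (8 * real n))))"
      by (simp add: power_divide ennreal_mult'[symmetric] flip: ennreal_numeral)
    also have "\<dots> \<le> ennreal (4 * ?D * (8 * ?D) ^ CARD('d) * (real n / \<rho>\<^sup>2) ^ CARD('d))"
    proof (rule ennreal_leI)
      have "exp (- (\<rho>\<^sup>2 / (8 * real n))) \<le> (?D / (\<rho>\<^sup>2 / (8 * real n))) ^ CARD('d)"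
        using n by (intro exp_minus_le_power) auto
      also have "?D / (\<rho>\<^sup>2 / (8 * real n)) = (8 * ?D) * (real n / \<rho>\<^sup>2)" by simp
      finally have "exp (- (\<rho>\<^sup>2 / (8 * real n))) \<le> (8 * ?D) ^ CARD('d) * (real n / \<rho>\<^sup>2) ^ CARD('d)"
        by (simp only: power_mult_distrib)
      then show "4 * ?D * exp (- (\<rho>\<^sup>2 / (8 * real n))) \<le> 4 * ?D * (8 * ?D) ^ CARD('d) * (real n / \<rho>\<^sup>2) ^ CARD('d)"
        by (simp only: mult.assoc) (intro mult_left_mono, auto)
    qed
    also have "\<dots> \<le> ennreal (C * (real n / \<rho>\<^sup>2) ^ CARD('d))"
      using A by (intro ennreal_leI mult_right_mono) (auto simp: C_def)
    finally show ?thesis .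
  qed
  then show ?thesis using that C by blast
qed

section \<open>The mass of large loops\<close>

text \<open>Once in the box, the walk is in an enlarged box with probability at least \<open>1 / 2\<close> at each of the next
  \<open>s * s\<close> steps, so \<open>h\<close> can be taken as a multiple of the expected time in the enlarged box.\<close>

lemma hit_zbox_bound:
  "\<exists>C>0. \<forall>(c :: int ^ 'd::finite) s n. 1 \<le> s \<longrightarrow> s * s \<le> n \<longrightarrow>
    (\<exists>h. (\<forall>m\<le>n. \<forall>x. hit_prob zd_edges m x (zbox c s) \<le> h x) \<and>
        (\<integral>\<^sup>+x. h x \<partial>count_space UNIV) \<le> ennreal (C * real n * real s ^ CARD('d) / (real s)\<^sup>2))"
proof -
  let ?D = "real CARD('d)"
  have D1: "1 \<le> ?D" by (simp add: Suc_le_eq)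
  obtain B0 :: nat where B0: "ln (4 * ?D) \<le> real B0" using real_arch_simple by blast
  \<comment> \<open>B >= 2 and B >= ln(4d) give B^2/2 >= ln(4d). Hence at each time up to s^2 the
    walk is at distance at least \<open>B * s\<close> from its start with probability at most 2d
    exp(-B^2/2) <= 1/2.\<close>
  define B where "B = B0 + 2"
  have B: "ln (4 * ?D) \<le> (real B)\<^sup>2 / 2"
  proof -
    have "2 * real B \<le> real B * real B" by (intro mult_right_mono) (auto simp: B_def)
    then show ?thesis using B0 by (simp add: power2_eq_square) (simp add: B_def)
  qed
  \<comment> \<open>Here 6 = 2 * 3: the 2 from the normalisation of \<phi>, the 3 from at most 3n
    times. The other factor bounds the points of the enlarged box, up to s^d.\<close>
  define C where "C = 6 * real (2 * B + 3) ^ CARD('d)"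
  have main: "\<exists>h. (\<forall>m\<le>n. \<forall>x. hit_prob zd_edges m x (zbox c s) \<le> h x) \<and>
        (\<integral>\<^sup>+x. h x \<partial>count_space UNIV) \<le> ennreal (C * real n * real s ^ CARD('d) / (real s)\<^sup>2)"
    if s: "1 \<le> s" and n: "s * s \<le> n" for c :: "int ^ 'd" and s n
  proof -
    let ?Z = "zbox c ((B + 1) * s)"
    \<comment> \<open>The sum runs \<open>s * s\<close> steps beyond \<open>m\<close>, so that a
      walk which is in the box only at the end still collects \<open>s * s\<close> terms of size
      1/2, and the factor 2 / s^2 turns these into 1.\<close>
    define \<phi> where "\<phi> m x = ennreal (2 / (real s)\<^sup>2) * (\<Sum>k\<le>m + s * s. emeasure (walk_at zd_edges k x) ?Z)" for m x
    have stay: "ennreal (1 / 2) \<le> emeasure (walk_at zd_edges k x) ?Z" if x: "x \<in> zbox c s" and k: "k \<le> s * s" for k x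
    proof -
      let ?q = "measure (walk_at zd_edges k x)"
      let ?F = "far x (real (B * s))"
      have "emeasure (walk_at zd_edges k x) ?F \<le> ennreal (2 * ?D * exp (- (real (B * s))\<^sup>2 / (2 * real (s * s))))"
        using s k by (intro walk_at_tail) auto
      then have "?q ?F \<le> 2 * ?D * exp (- (real (B * s))\<^sup>2 / (2 * real (s * s)))"
        by (simp add: measure_pmf.emeasure_eq_measure)
      also have "(real (B * s))\<^sup>2 / (2 * real (s * s)) = (real B)\<^sup>2 / 2"
        using s by (simp add: power2_eq_square field_simps)
      then have "- (real (B * s))\<^sup>2 / (2 * real (s * s)) = - ((real B)\<^sup>2 / 2)" by simp
      also have "2 * ?D * exp (- ((real B)\<^sup>2 / 2)) \<le> 2 * ?D * exp (- ln (4 * ?D))"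
        using B by (intro mult_left_mono) auto
      also have "\<dots> = 1 / 2" using D1 by (simp add: exp_minus)
      finally have q: "?q ?F \<le> 1 / 2" .
      have "UNIV \<subseteq> ?Z \<union> ?F"
      proof
        fix y
        have "sup_dist y c \<le> sup_dist y x + sup_dist x c" by (rule sup_dist_triangle)
        moreover have "sup_dist x c \<le> int s" using x by (simp add: zbox_def)
        ultimately have "sup_dist y c \<le> sup_dist y x + int s" by linarith
        then have "y \<in> ?Z" if "sup_dist y x < int (B * s)"
          using that by (simp add: zbox_def algebra_simps)
        moreover have "real (B * s) \<le> real_of_int (sup_dist y x)" if "int (B * s) \<le> sup_dist y x"
          using that by linarith
        ultimately show "y \<in> ?Z \<union> ?F" unfolding far_def by (cases "sup_dist y x < int (B * s)") simp_all
      qed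
      then have "?q UNIV \<le> ?q (?Z \<union> ?F)" by (intro measure_pmf.finite_measure_mono) auto
      also have "\<dots> \<le> ?q ?Z + ?q ?F" by (rule measure_Un_le) auto
      finally have "1 / 2 \<le> ?q ?Z" using q measure_pmf.prob_space[of "walk_at zd_edges k x"] by simp
      then show ?thesis unfolding measure_pmf.emeasure_eq_measure by (rule ennreal_leI)
    qed
    have base: "1 \<le> \<phi> m x" if x: "x \<in> zbox c s" for m x
    proof -
      have "(1 :: ennreal) = ennreal (2 / (real s)\<^sup>2) * (\<Sum>k<s * s. ennreal (1 / 2))"
      proof -
        have "(\<Sum>k<s * s. ennreal (1 / 2)) = ennreal (\<Sum>k<s * s. 1 / 2)" by (rule sum_ennreal) simp
        then have "ennreal (2 / (real s)\<^sup>2) * (\<Sum>k<s * s. ennreal (1 / 2)) =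
            ennreal (2 / (real s)\<^sup>2 * (\<Sum>k<s * s. 1 / 2))"
          by (simp only: ennreal_mult' divide_nonneg_nonneg zero_le_power2 zero_le_numeral)
        also have "2 / (real s)\<^sup>2 * (\<Sum>k<s * s. 1 / 2) = 1" using s by (simp add: power2_eq_square)
        finally show ?thesis by simp
      qed
      also have "\<dots> \<le> ennreal (2 / (real s)\<^sup>2) * (\<Sum>k<s * s. emeasure (walk_at zd_edges k x) ?Z)"
        by (intro mult_left_mono sum_mono stay x) auto
      also have "\<dots> \<le> \<phi> m x"
        unfolding \<phi>_def by (intro mult_left_mono sum_mono2) auto
      finally show ?thesis .
    qed
    have super: "(\<integral>\<^sup>+y. \<phi> m y \<partial>walk_step zd_edges x) \<le> \<phi> (Suc m) x" for m x
    proof -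
      have "(\<integral>\<^sup>+y. \<phi> m y \<partial>walk_step zd_edges x) =
         ennreal (2 / (real s)\<^sup>2) * (\<Sum>k\<le>m + s * s. emeasure (walk_at zd_edges (Suc k) x) ?Z)"
        unfolding \<phi>_def by (simp add: nn_integral_cmult nn_integral_sum walk_at_Suc emeasure_bind_pmf)
      also have "(\<Sum>k\<le>m + s * s. emeasure (walk_at zd_edges (Suc k) x) ?Z) \<le> (\<Sum>k\<le>Suc m + s * s. emeasure (walk_at zd_edges k x) ?Z)"
        unfolding add_Suc by (subst sum.atMost_Suc_shift) simp
      finally show ?thesis unfolding \<phi>_def by (simp add: mult_left_mono)
    qed
    have mono: "\<phi> m x \<le> \<phi> n x" if "m \<le> n" for m x
      unfolding \<phi>_def using that by (intro mult_left_mono sum_mono2) auto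
    have "hit_prob zd_edges m x (zbox c s) \<le> \<phi> n x" if "m \<le> n" for m x
      using emeasure_hit_le[of m "zbox c s" \<phi>, OF base super, of m x] mono[OF that, of x] by force
    moreover have "(\<integral>\<^sup>+x. \<phi> n x \<partial>count_space UNIV) \<le> ennreal (C * real n * real s ^ CARD('d) / (real s)\<^sup>2)"
    proof -
      have "(\<integral>\<^sup>+x. \<phi> n x \<partial>count_space UNIV) = ennreal (2 / (real s)\<^sup>2) *
          (\<Sum>k\<le>n + s * s. \<integral>\<^sup>+x. emeasure (walk_at zd_edges k x) ?Z \<partial>count_space UNIV)"
        unfolding \<phi>_def by (simp add: nn_integral_cmult nn_integral_sum)
      also have "\<dots> = ennreal (2 / (real s)\<^sup>2) * (\<Sum>k\<le>n + s * s. of_nat (card ?Z))"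
        by (simp only: nn_integral_start_walk_at[OF transition_zd_sym finite_zbox])
      also have "\<dots> = ennreal (2 / (real s)\<^sup>2 * (real (n + s * s + 1) * real (card ?Z)))"
        by (simp add: ennreal_of_nat_eq_real_of_nat ennreal_mult[symmetric] del: of_nat_add of_nat_mult of_nat_Suc)
      also have "\<dots> \<le> ennreal (C * real n * real s ^ CARD('d) / (real s)\<^sup>2)"
      proof (rule ennreal_leI)
        have "card ?Z \<le> ((2 * B + 3) * s) ^ CARD('d)"
          unfolding card_zbox using s by (intro power_mono) (auto simp: algebra_simps)
        then have "real (card ?Z) \<le> real (((2 * B + 3) * s) ^ CARD('d))" by (simp only: of_nat_le_iff)
        also have "\<dots> = real (2 * B + 3) ^ CARD('d) * real s ^ CARD('d)" by (simp add: power_mult_distrib)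
        finally have cz: "real (card ?Z) \<le> real (2 * B + 3) ^ CARD('d) * real s ^ CARD('d)" .
        have "1 \<le> s * s" using s by (simp add: Suc_le_eq)
        then have "n + s * s + 1 \<le> 3 * n" using n by linarith
        then have "real (n + s * s + 1) \<le> 3 * real n" by linarith
        with cz have "real (n + s * s + 1) * real (card ?Z) \<le> 3 * real n * (real (2 * B + 3) ^ CARD('d) * real s ^ CARD('d))"
          by (intro mult_mono) auto
        then have "2 / (real s)\<^sup>2 * (real (n + s * s + 1) * real (card ?Z)) \<le>
          2 / (real s)\<^sup>2 * (3 * real n * (real (2 * B + 3) ^ CARD('d) * real s ^ CARD('d)))"
          by (intro mult_left_mono) auto
        then show "2 / (real s)\<^sup>2 * (real (n + s * s + 1) * real (card ?Z)) \<le> C * real n * real s ^ CARD('d) / (real s)\<^sup>2"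
          by (simp add: C_def field_simps)
      qed
      finally show ?thesis .
    qed
    ultimately show ?thesis by (intro exI[of _ "\<phi> n"]) simp
  qed
  have pos: "0 < C" by (simp add: C_def)
  show ?thesis
    by (rule exI[of _ C], rule conjI[OF pos], intro allI impI, rule main)
qed

text \<open>Both halves of a path of \<open>n \<ge> 2\<close> steps have at least n/3 steps, so the
  heat kernel bound at half time costs a factor sqrt 3 per dimension.\<close>

lemma closed_path_hit_bound:
  "\<exists>C>0. \<forall>n (x :: int ^ 'd::finite) H h. 2 \<le> n \<longrightarrow>
    (\<forall>m\<le>n. hit_prob zd_edges m x H \<le> h) \<longrightarrow>
    emeasure (path_pmf zd_edges n x) {w. last w = x \<and> set w \<inter> H \<noteq> {}} \<le> ennreal (C / sqrt (real n) ^ CARD('d)) * h"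
proof -
  obtain K where K: "0 < K" "\<And>n (x :: int ^ 'd) y. 0 < n \<Longrightarrow>
    pmf (walk_at zd_edges n x) y \<le> K / sqrt (real n) ^ CARD('d)" using heat_kernel_bound by blast
  define C where "C = 2 * (K * sqrt 3 ^ CARD('d))"
  have main: "emeasure (path_pmf zd_edges n x) {w. last w = x \<and> set w \<inter> H \<noteq> {}} \<le> ennreal (C / sqrt (real n) ^ CARD('d)) * h"
    if n: "2 \<le> n" and h: "\<And>m. m \<le> n \<Longrightarrow> hit_prob zd_edges m x H \<le> h"
    for n H h and x :: "int ^ 'd"
  proof -
    define b where "b = K * sqrt 3 ^ CARD('d) / sqrt (real n) ^ CARD('d)"
    have b: "pmf (walk_at zd_edges k z) x \<le> b" if k: "n \<le> 3 * k" for k z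
    proof -
      have k0: "0 < k" using n k by linarith
      have "real n \<le> 3 * real k" using k by linarith
      then have "sqrt (real n) \<le> sqrt 3 * sqrt (real k)" by (simp add: real_sqrt_mult[symmetric])
      then have "sqrt (real n) ^ CARD('d) \<le> (sqrt 3 * sqrt (real k)) ^ CARD('d)" by (intro power_mono) auto
      then have "sqrt (real n) ^ CARD('d) \<le> sqrt 3 ^ CARD('d) * sqrt (real k) ^ CARD('d)"
        by (simp only: power_mult_distrib)
      then have "K * sqrt (real n) ^ CARD('d) \<le> K * (sqrt 3 ^ CARD('d) * sqrt (real k) ^ CARD('d))"
        using K by (intro mult_left_mono) auto
      then have "K / sqrt (real k) ^ CARD('d) \<le> b"
        using n k0 by (simp add: b_def field_simps)
      then show ?thesis using K(2)[OF k0, of z x] by linarith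
    qed
    have "emeasure (path_pmf zd_edges (n div 2 + (n - n div 2)) x) {w. last w = x \<and> set w \<inter> H \<noteq> {}} \<le> 2 * (ennreal b * h)"
      using n by (intro emeasure_closed_path_hit_le[OF transition_zd_sym] b h) linarith+
    moreover have "2 * (ennreal b * h) = ennreal (C / sqrt (real n) ^ CARD('d)) * h"
      using K by (simp add: C_def b_def ennreal_mult'[symmetric] mult.assoc[symmetric] flip: ennreal_numeral)
    ultimately show ?thesis by simp
  qed
  have pos: "0 < C" using K by (simp add: C_def)
  show ?thesis
    by (rule exI[of _ C], rule conjI[OF pos], intro allI impI, rule main) simp_all
qed

section \<open>From closed paths to loops: long loops near a box\<close>

lemma based_loop_measure_length_le:
  fixes E :: "'a::countable set set"
  assumes n: "0 < n"
  shows "emeasure (based_loop_measure UNIV E 0) {xs\<in>based_loops UNIV. length xs = n \<and> P xs} \<le>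
    ennreal (1 / real n) * (\<integral>\<^sup>+x. emeasure (path_pmf E n x) {w. last w = x \<and> P (butlast w)} \<partial>count_space UNIV)"
proof -
  let ?\<mu> = "based_loop_measure UNIV E 0"
  let ?A = "\<lambda>x. {xs\<in>based_loops UNIV. length xs = n \<and> hd xs = x \<and> P xs}"
  have "{xs\<in>based_loops UNIV. length xs = n \<and> P xs} = (\<Union>x\<in>UNIV. ?A x)" by auto
  then have "emeasure ?\<mu> {xs\<in>based_loops UNIV. length xs = n \<and> P xs} = (\<integral>\<^sup>+x. emeasure ?\<mu> (?A x) \<partial>count_space UNIV)"
    by (simp only:) (intro emeasure_UN_countable; auto simp: based_loop_measure_def sets_point_measure disjoint_family_on_def)
  also have "\<dots> \<le> (\<integral>\<^sup>+x. ennreal (1 / real n) * emeasure (path_pmf E n x) {w. last w = x \<and> P (butlast w)} \<partial>count_space UNIV)"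
  proof (rule nn_integral_mono)
    fix x
    have "emeasure ?\<mu> (?A x) = ennreal (1 / real n * (1 / (1 + 0)) ^ n) * emeasure (path_pmf E n x) {xs @ [x] | xs. xs \<in> ?A x}"
      by (rule emeasure_based_loop_measure_rooted) (use n in auto)
    also have "\<dots> \<le> ennreal (1 / real n) * emeasure (path_pmf E n x) {w. last w = x \<and> P (butlast w)}"
    proof -
      have "emeasure (path_pmf E n x) {xs @ [x] | xs. xs \<in> ?A x} \<le> emeasure (path_pmf E n x) {w. last w = x \<and> P (butlast w)}"
        by (intro emeasure_mono) auto
      then show ?thesis by (simp add: mult_left_mono)
    qed
    finally show "emeasure ?\<mu> (?A x) \<le> ennreal (1 / real n) * emeasure (path_pmf E n x) {w. last w = x \<and> P (butlast w)}" .
  qed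
  also have "\<dots> = ennreal (1 / real n) * (\<integral>\<^sup>+x. emeasure (path_pmf E n x) {w. last w = x \<and> P (butlast w)} \<partial>count_space UNIV)"
    by (rule nn_integral_cmult) simp
  finally show ?thesis .
qed

text \<open>Telescoping of 1/u^3 <= 4/u - 4/v with u = sqrt N and v = sqrt (N + 1): from v <= 3u/2
  the product u v (u + v) is at most 15/4 u^3.\<close>

lemma sum_inverse_sqrt_cube_le:
  assumes "1 \<le> a" "a \<le> N"
  shows "(\<Sum>n=a..<N. 1 / sqrt (real n) ^ 3) \<le> 4 / sqrt (real a) - 4 / sqrt (real N)"
  using assms(2)
proof (induction N rule: dec_induct)
  case (step N)
  define u v where "u = sqrt (real N)" and "v = sqrt (real (Suc N))"
  have N: "1 \<le> N" using step assms by simp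
  have uv: "1 \<le> u" "0 < v" "v\<^sup>2 = u\<^sup>2 + 1" using N by (auto simp: u_def v_def)
  have "v\<^sup>2 \<le> (3/2 * u)\<^sup>2"
  proof -
    have "1 \<le> u\<^sup>2" using uv by simp
    then show ?thesis using uv by (simp add: power_mult_distrib power2_eq_square)
  qed
  then have v: "v \<le> 3/2 * u" by (rule power2_le_imp_le) (use uv in auto)
  have "(u * v) * (u + v) \<le> (u * (3/2 * u)) * (u + 3/2 * u)"
    using v uv by (intro mult_mono) auto
  also have "\<dots> \<le> 4 * u ^ 3" using uv by (simp add: power3_eq_cube)
  finally have le: "(u * v) * (u + v) \<le> 4 * u ^ 3" .
  have one: "(v - u) * (u + v) = 1" using uv by (simp add: power2_eq_square algebra_simps)
  have "1 / u - 1 / v = (v - u) / (u * v)" using uv by (simp add: field_simps)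
  also have "\<dots> = ((v - u) * (u + v)) / ((u * v) * (u + v))" using uv by simp
  also have "\<dots> = 1 / ((u * v) * (u + v))" by (simp only: one)
  also have "\<dots> \<ge> 1 / (4 * u ^ 3)" using le uv by (intro divide_left_mono mult_pos_pos) auto
  finally have "1 / u ^ 3 \<le> 4 / u - 4 / v" by (simp add: field_simps)
  then show ?case using step by (simp add: u_def v_def)
qed simp

lemma sets_based_loop_measure: "sets (based_loop_measure V E \<kappa>) = Pow (based_loops V)"
  by (simp add: based_loop_measure_def sets_point_measure)

lemma long_loops_bound:
  assumes d: "3 \<le> CARD('d::finite)"
  obtains C where "0 < C" "\<And>(c :: int ^ 'd) s. 1 \<le> s \<Longrightarrow>
    emeasure (based_loop_measure UNIV zd_edges 0)
      {xs\<in>based_loops UNIV. s * s \<le> length xs \<and> set xs \<inter> zbox c s \<noteq> {}} \<le> ennreal C"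
proof -
  obtain C1 where C1: "0 < C1" "\<forall>n (x :: int ^ 'd) H h. 2 \<le> n \<longrightarrow>
    (\<forall>m\<le>n. hit_prob zd_edges m x H \<le> h) \<longrightarrow>
    emeasure (path_pmf zd_edges n x) {w. last w = x \<and> set w \<inter> H \<noteq> {}} \<le> ennreal (C1 / sqrt (real n) ^ CARD('d)) * h"
    using closed_path_hit_bound[where 'd='d] by (elim exE conjE) (rule that)
  obtain C2 where C2: "0 < C2" "\<forall>(c :: int ^ 'd) s n. 1 \<le> s \<longrightarrow> s * s \<le> n \<longrightarrow>
    (\<exists>h. (\<forall>m\<le>n. \<forall>x. hit_prob zd_edges m x (zbox c s) \<le> h x) \<and>
        (\<integral>\<^sup>+x. h x \<partial>count_space UNIV) \<le> ennreal (C2 * real n * real s ^ CARD('d) / (real s)\<^sup>2))"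
    using hit_zbox_bound[where 'd='d] by (elim exE conjE) (rule that)
  let ?\<mu> = "based_loop_measure UNIV zd_edges 0 :: (int ^ 'd) list measure"
  have "emeasure ?\<mu> {xs\<in>based_loops UNIV. s * s \<le> length xs \<and> set xs \<inter> zbox c s \<noteq> {}} \<le> ennreal (4 * (C1 * C2))"
    if s: "1 \<le> s" for c :: "int ^ 'd" and s
  proof -
    let ?A = "\<lambda>n. {xs\<in>based_loops UNIV. length xs = n \<and> (s * s \<le> n \<and> set xs \<inter> zbox c s \<noteq> {})}"
    have 1: "1 \<le> s * s" using s by (simp add: Suc_le_eq)
    have len: "emeasure ?\<mu> (?A n) \<le> ennreal (if s * s \<le> n then C1 * C2 * real s * (1 / sqrt (real n) ^ 3) else 0)" for n
    proof (cases "2 \<le> n \<and> s * s \<le> n")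
      case False
      have "?A n = {}" if "\<not> s * s \<le> n" using that by auto
      moreover have "?A n = {}" if "\<not> 2 \<le> n" using that by (auto simp: based_loops_def)
      ultimately have "?A n = {}" using False by blast
      then show ?thesis by (simp only: emeasure_empty zero_le)
    next
      case True
      then have n: "2 \<le> n" "s * s \<le> n" by auto
      obtain h where h: "\<forall>m\<le>n. \<forall>x. hit_prob zd_edges m x (zbox c s) \<le> h x"
        "(\<integral>\<^sup>+x. h x \<partial>count_space UNIV) \<le> ennreal (C2 * real n * real s ^ CARD('d) / (real s)\<^sup>2)"
        using C2(2)[rule_format, OF s n(2), of c] by (elim exE conjE) (rule that)
      have "emeasure ?\<mu> (?A n) \<le> ennreal (1 / real n) *
         (\<integral>\<^sup>+x. emeasure (path_pmf zd_edges n x) {w. last w = x \<and> (s * s \<le> n \<and> set (butlast w) \<inter> zbox c s \<noteq> {})} \<partial>count_space UNIV)"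
        by (rule based_loop_measure_length_le) (use n in simp)
      also have "\<dots> \<le> ennreal (1 / real n) * (\<integral>\<^sup>+x. ennreal (C1 / sqrt (real n) ^ CARD('d)) * h x \<partial>count_space UNIV)"
      proof (intro mult_left_mono nn_integral_mono)
        fix x :: "int ^ 'd"
        have "emeasure (path_pmf zd_edges n x) {w. last w = x \<and> (s * s \<le> n \<and> set (butlast w) \<inter> zbox c s \<noteq> {})} \<le>
          emeasure (path_pmf zd_edges n x) {w. last w = x \<and> set w \<inter> zbox c s \<noteq> {}}"
          by (intro emeasure_mono) (auto dest: in_set_butlastD)
        also have "\<dots> \<le> ennreal (C1 / sqrt (real n) ^ CARD('d)) * h x"
          using C1(2)[rule_format, OF n(1) h(1)[rule_format]] .
        finally show "emeasure (path_pmf zd_edges n x) {w. last w = x \<and> (s * s \<le> n \<and> set (butlast w) \<inter> zbox c s \<noteq> {})} \<le>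
          ennreal (C1 / sqrt (real n) ^ CARD('d)) * h x" .
      qed simp
      also have "\<dots> = ennreal (1 / real n) * (ennreal (C1 / sqrt (real n) ^ CARD('d)) * (\<integral>\<^sup>+x. h x \<partial>count_space UNIV))"
        by (subst nn_integral_cmult) auto
      also have "\<dots> \<le> ennreal (1 / real n) * (ennreal (C1 / sqrt (real n) ^ CARD('d)) * ennreal (C2 * real n * real s ^ CARD('d) / (real s)\<^sup>2))"
        by (intro mult_left_mono h) auto
      also have "\<dots> = ennreal (1 / real n * (C1 / sqrt (real n) ^ CARD('d) * (C2 * real n * real s ^ CARD('d) / (real s)\<^sup>2)))"
      proof -
        have "0 \<le> 1 / real n" "0 \<le> C1 / sqrt (real n) ^ CARD('d)" using C1(1) by auto
        then show ?thesis by (simp only: ennreal_mult')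
      qed
      also have "\<dots> \<le> ennreal (C1 * C2 * real s * (1 / sqrt (real n) ^ 3))"
      proof (rule ennreal_leI)
        \<comment> \<open>Length \<open>n\<close> contributes a multiple of s^(d-2) n^(-d/2). With d
          = e + 3 and s <= sqrt n, the surplus (s / sqrt n)^e is at most 1, and s n^(-3/2) remains,
          whose sum over n >= s^2 is bounded.\<close>
        obtain e where e: "CARD('d) = e + 3" using d by (metis add.commute le_Suc_ex)
        have sn: "real s \<le> sqrt (real n)"
        proof (rule real_le_rsqrt)
          have "real (s * s) \<le> real n" using n by (simp only: of_nat_le_iff)
          then show "(real s)\<^sup>2 \<le> real n" by (simp add: power2_eq_square)
        qed
        have "real s ^ e / sqrt (real n) ^ e \<le> 1"
          using sn s n by (simp add: power_mono divide_le_eq_1)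
        then have "(C1 * C2 * real s * (1 / sqrt (real n) ^ 3)) * (real s ^ e / sqrt (real n) ^ e) \<le> C1 * C2 * real s * (1 / sqrt (real n) ^ 3)"
          using C1(1) C2(1) by (intro mult_left_le) auto
        moreover have "1 / real n * (C1 / sqrt (real n) ^ CARD('d) * (C2 * real n * real s ^ CARD('d) / (real s)\<^sup>2)) =
           (C1 * C2 * real s * (1 / sqrt (real n) ^ 3)) * (real s ^ e / sqrt (real n) ^ e)"
        proof -
          have "real n \<noteq> 0" "real s \<noteq> 0" using n s by auto
          then show ?thesis unfolding e power_add
            by (simp add: power2_eq_square power3_eq_cube mult_ac)
        qed
        ultimately show "1 / real n * (C1 / sqrt (real n) ^ CARD('d) * (C2 * real n * real s ^ CARD('d) / (real s)\<^sup>2)) \<le>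
           C1 * C2 * real s * (1 / sqrt (real n) ^ 3)" by simp
      qed
      finally show ?thesis using n by simp
    qed
    have "{xs\<in>based_loops UNIV. s * s \<le> length xs \<and> set xs \<inter> zbox c s \<noteq> {}} = (\<Union>n. ?A n)" by auto
    then have "emeasure ?\<mu> {xs\<in>based_loops UNIV. s * s \<le> length xs \<and> set xs \<inter> zbox c s \<noteq> {}} \<le> (\<Sum>n. emeasure ?\<mu> (?A n))"
      by (simp only:) (rule emeasure_subadditive_countably; auto simp: sets_based_loop_measure)
    also have "\<dots> \<le> (\<Sum>n. ennreal (if s * s \<le> n then C1 * C2 * real s * (1 / sqrt (real n) ^ 3) else 0))"
      by (intro suminf_le len) auto
    also have "\<dots> \<le> ennreal (4 * (C1 * C2))"
      unfolding suminf_eq_SUP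
    proof (rule SUP_least)
      fix N
      have "(\<Sum>n<N. (if s * s \<le> n then C1 * C2 * real s * (1 / sqrt (real n) ^ 3) else 0)) \<le> 4 * (C1 * C2)"
      proof (cases "s * s \<le> N")
        case False
        then have "(\<Sum>n<N. (if s * s \<le> n then C1 * C2 * real s * (1 / sqrt (real n) ^ 3) else 0)) = 0"
          by (intro sum.neutral) auto
        then show ?thesis using C1(1) C2(1) by simp
      next
        case True
        have "(\<Sum>n<N. (if s * s \<le> n then C1 * C2 * real s * (1 / sqrt (real n) ^ 3) else 0)) =
           (\<Sum>n\<in>{s * s..<N}. C1 * C2 * real s * (1 / sqrt (real n) ^ 3))"
          by (intro sum.mono_neutral_cong_right) auto
        also have "\<dots> = C1 * C2 * real s * (\<Sum>n\<in>{s * s..<N}. 1 / sqrt (real n) ^ 3)"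
          by (simp only: sum_distrib_left)
        also have "\<dots> \<le> C1 * C2 * real s * (4 / sqrt (real (s * s)))"
          using sum_inverse_sqrt_cube_le[OF 1 True] C1(1) C2(1)
          by (intro mult_left_mono) (auto intro: order_trans)
        also have "\<dots> = 4 * (C1 * C2)" using s by (simp add: real_sqrt_mult)
        finally show ?thesis .
      qed
      then show "(\<Sum>n<N. ennreal (if s * s \<le> n then C1 * C2 * real s * (1 / sqrt (real n) ^ 3) else 0)) \<le> ennreal (4 * (C1 * C2))"
        using C1(1) C2(1) by (subst sum_ennreal) (auto intro: ennreal_leI)
    qed
    finally show ?thesis .
  qed
  then show ?thesis using that[of "4 * (C1 * C2)"] C1(1) C2(1) by simp
qed

text \<open>The constant 36 is the square of the 6 in \<open>far_from_root\<close>.\<close>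

lemma nn_integral_inverse_dist_le:
  assumes d: "2 \<le> CARD('d::finite)"
  shows "\<exists>C>0. \<forall>(c :: int ^ 'd) s. 1 \<le> s \<longrightarrow>
    (\<integral>\<^sup>+x. ennreal ((36 / (real s + real_of_int (sup_dist x c))\<^sup>2) ^ CARD('d)) \<partial>count_space UNIV) \<le> ennreal (C / real s ^ CARD('d))"
proof -
  let ?d = "CARD('d)"
  \<comment> \<open>108 = 36 * 3, where the 3 comes from the at most (3t)^d points in a box of
    radius t >= 1, and pi^2/6 is the sum of the 1/(j+1)^2.\<close>
  define C where "C = 108 ^ ?d * (pi\<^sup>2 / 6)"
  have pos: "0 < C" by (simp add: C_def)
  have main: "(\<integral>\<^sup>+x. ennreal ((36 / (real s + real_of_int (sup_dist x c))\<^sup>2) ^ ?d) \<partial>count_space UNIV) \<le> ennreal (C / real s ^ ?d)"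
    if s: "1 \<le> s" for c :: "int ^ 'd" and s
  proof -
    let ?t = "\<lambda>j. real (Suc j * s)"
    let ?Z = "\<lambda>j. zbox c (Suc j * s)"
    have tpos: "0 < ?t j" for j
      unfolding of_nat_0_less_iff using s by simp
    have "(\<integral>\<^sup>+x. ennreal ((36 / (real s + real_of_int (sup_dist x c))\<^sup>2) ^ ?d) \<partial>count_space UNIV) \<le>
       (\<integral>\<^sup>+x. (\<Sum>j. ennreal ((36 / (?t j)\<^sup>2) ^ ?d) * indicator (?Z j) x) \<partial>count_space UNIV)"
    proof (rule nn_integral_mono)
      fix x
      define D where "D = nat (sup_dist x c)"
      have D: "sup_dist x c = int D" by (simp add: D_def)
      \<comment> \<open>Shells of width \<open>s\<close> around \<open>c\<close>: a point at
        distance \<open>D\<close> has j s <= D < (j+1) s. It lies in the box of radius (j+1) s, and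
        (j+1) s <= s + D allows the replacement in the denominator.\<close>
      define j where "j = D div s"
      have 1: "D < Suc j * s" using dividend_less_times_div[of s D] s by (simp add: j_def mult.commute)
      have 2: "Suc j * s \<le> s + D" by (simp add: j_def)
      have "(36 / (real s + real_of_int (sup_dist x c))\<^sup>2) ^ ?d \<le> (36 / (?t j)\<^sup>2) ^ ?d"
      proof (rule power_mono, rule divide_left_mono)
        show "(?t j)\<^sup>2 \<le> (real s + real_of_int (sup_dist x c))\<^sup>2"
          using 2 unfolding D by (intro power_mono) (simp_all only: of_nat_le_iff of_int_of_nat_eq of_nat_add[symmetric] of_nat_0_le_iff)
        show "0 < (real s + real_of_int (sup_dist x c))\<^sup>2 * (?t j)\<^sup>2"
          using s tpos[of j] unfolding D by (intro mult_pos_pos zero_less_power) auto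
      qed auto
      then have "ennreal ((36 / (real s + real_of_int (sup_dist x c))\<^sup>2) ^ ?d) \<le>
         ennreal ((36 / (?t j)\<^sup>2) ^ ?d) * indicator (?Z j) x"
        using 1 D by (simp add: zbox_def ennreal_leI del: of_nat_mult of_nat_Suc mult_Suc)
      also have "\<dots> = (\<Sum>j\<in>{j}. ennreal ((36 / (?t j)\<^sup>2) ^ ?d) * indicator (?Z j) x)"
        by (simp only: sum.insert finite.emptyI empty_iff not_False_eq_True sum.empty add_0_right)
      also have "\<dots> \<le> (\<Sum>j. ennreal ((36 / (?t j)\<^sup>2) ^ ?d) * indicator (?Z j) x)"
        by (rule sum_le_suminf) auto
      finally show "ennreal ((36 / (real s + real_of_int (sup_dist x c))\<^sup>2) ^ ?d) \<le>
        (\<Sum>j. ennreal ((36 / (?t j)\<^sup>2) ^ ?d) * indicator (?Z j) x)" .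
    qed
    also have "\<dots> = (\<Sum>j. \<integral>\<^sup>+x. ennreal ((36 / (?t j)\<^sup>2) ^ ?d) * indicator (?Z j) x \<partial>count_space UNIV)"
      by (rule nn_integral_suminf) simp
    also have "\<dots> \<le> (\<Sum>j. ennreal (108 ^ ?d / real s ^ ?d * (1 / (real j + 1)\<^sup>2)))"
    proof (rule suminf_le)
      fix j
      have "(\<integral>\<^sup>+x. ennreal ((36 / (?t j)\<^sup>2) ^ ?d) * indicator (?Z j) x \<partial>count_space UNIV) =
         ennreal ((36 / (?t j)\<^sup>2) ^ ?d) * of_nat (card (?Z j))"
        by (subst nn_integral_cmult_indicator) (simp_all add: finite_zbox emeasure_count_space_finite)
      also have "\<dots> = ennreal ((36 / (?t j)\<^sup>2) ^ ?d * real (card (?Z j)))"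
        by (simp only: ennreal_of_nat_eq_real_of_nat ennreal_mult' zero_le_power divide_nonneg_nonneg zero_le_power2 zero_le_numeral)
      also have "\<dots> \<le> ennreal (108 ^ ?d / real s ^ ?d * (1 / (real j + 1)\<^sup>2))"
      proof (rule ennreal_leI)
        have "1 \<le> Suc j * s" using s by simp
        then have "card (?Z j) \<le> (3 * (Suc j * s)) ^ ?d"
          unfolding card_zbox by (intro power_mono) linarith+
        then have "real (card (?Z j)) \<le> real ((3 * (Suc j * s)) ^ ?d)" by (simp only: of_nat_le_iff)
        also have "\<dots> = (3 * ?t j) ^ ?d" by simp
        finally have "(36 / (?t j)\<^sup>2) ^ ?d * real (card (?Z j)) \<le> (36 / (?t j)\<^sup>2) ^ ?d * (3 * ?t j) ^ ?d"
          by (intro mult_left_mono) auto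
        also have "\<dots> = (108 / ?t j) ^ ?d"
        proof -
          have "36 / t\<^sup>2 * (3 * t) = 108 / t" if "0 < t" for t :: real
            using that by (simp add: power2_eq_square)
          from this[OF tpos[of j]] show ?thesis by (simp only: power_mult_distrib[symmetric])
        qed
        also have "\<dots> = 108 ^ ?d / real s ^ ?d * (1 / (real j + 1) ^ ?d)"
        proof -
          have "?t j = real s * (real j + 1)" by (simp add: algebra_simps)
          then show ?thesis by (simp only: power_divide power_mult_distrib) simp
        qed
        also have "\<dots> \<le> 108 ^ ?d / real s ^ ?d * (1 / (real j + 1)\<^sup>2)"
          using d by (intro mult_left_mono divide_left_mono power_increasing) auto
        finally show "(36 / (?t j)\<^sup>2) ^ ?d * real (card (?Z j)) \<le> 108 ^ ?d / real s ^ ?d * (1 / (real j + 1)\<^sup>2)" .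
      qed
      finally show "(\<integral>\<^sup>+x. ennreal ((36 / (?t j)\<^sup>2) ^ ?d) * indicator (?Z j) x \<partial>count_space UNIV) \<le>
        ennreal (108 ^ ?d / real s ^ ?d * (1 / (real j + 1)\<^sup>2))" .
    qed auto
    also have "\<dots> = ennreal (108 ^ ?d / real s ^ ?d * (pi\<^sup>2 / 6))"
    proof (rule suminf_ennreal_eq)
      show "(\<lambda>j. 108 ^ ?d / real s ^ ?d * (1 / (real j + 1)\<^sup>2)) sums (108 ^ ?d / real s ^ ?d * (pi\<^sup>2 / 6))"
        by (rule sums_mult) (use inverse_squares_sums in \<open>simp add: add.commute\<close>)
    qed simp
    also have "108 ^ ?d / real s ^ ?d * (pi\<^sup>2 / 6) = C / real s ^ ?d" by (simp add: C_def)
    finally show ?thesis .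
  qed
  show ?thesis
    by (rule exI[of _ C], rule conjI[OF pos], intro allI impI, rule main)
qed

text \<open>If \<open>x\<close> is within 3s/2 of \<open>c\<close>, one of two loop points more than
  s apart is more than s/2 away from \<open>x\<close>, and 6 (s/2) exceeds s + 3s/2. Otherwise the
  loop point in the box is at distance at least |x - c| - s from \<open>x\<close>, and 6 (|x - c| -
  s) exceeds s + |x - c| because 5 |x - c| > 7s.\<close>

lemma far_from_root:
  assumes hit: "z \<in> set xs" "z \<in> zbox c s" and diam: "u \<in> set xs" "v \<in> set xs" "int s < sup_dist u v"
  shows "set xs \<inter> far x ((real s + real_of_int (sup_dist x c)) / 6) \<noteq> {}"
proof -
  have zc: "sup_dist z c \<le> int s" using hit by (simp add: zbox_def)
  have t: "sup_dist u v \<le> sup_dist u x + sup_dist v x"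
    using sup_dist_triangle[of u v x] sup_dist_sym[of x v] by simp
  have t2: "sup_dist x c \<le> sup_dist z x + sup_dist z c"
    using sup_dist_triangle[of x c z] sup_dist_sym[of x z] by simp
  have "\<exists>y\<in>set xs. int s + sup_dist x c \<le> 6 * sup_dist y x"
  proof (cases "2 * sup_dist x c \<le> 3 * int s")
    case True
    then have "int s + sup_dist x c \<le> 6 * sup_dist u x \<or> int s + sup_dist x c \<le> 6 * sup_dist v x"
      using t diam(3) by linarith
    then show ?thesis using diam by blast
  next
    case False
    then have "int s + sup_dist x c \<le> 6 * sup_dist z x" using t2 zc by linarith
    then show ?thesis using hit by blast
  qed
  then obtain y where y: "y \<in> set xs" "int s + sup_dist x c \<le> 6 * sup_dist y x" by blast
  have "real_of_int (int s + sup_dist x c) \<le> real_of_int (6 * sup_dist y x)" using y(2) by (simp only: of_int_le_iff)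
  then have "y \<in> far x ((real s + real_of_int (sup_dist x c)) / 6)" by (simp add: far_def)
  then show ?thesis using y by blast
qed

text \<open>Seen from its root \<open>x\<close>, such a loop reaches a distance of order s + |x -
  c|. Summed over \<open>x\<close>, length \<open>n\<close> has mass of order n^(d/2 - 1) s^(-d),
  which is at most s^(-2) for n < s^2, and there are fewer than s^2 lengths.\<close>

lemma short_loops_bound:
  assumes d: "3 \<le> CARD('d::finite)"
  shows "\<exists>C>0. \<forall>(c :: int ^ 'd) s. 1 \<le> s \<longrightarrow>
    emeasure (based_loop_measure UNIV zd_edges 0)
      {xs\<in>based_loops UNIV. length xs < s * s \<and> set xs \<inter> zbox c s \<noteq> {} \<and> (\<exists>u\<in>set xs. \<exists>v\<in>set xs. int s < sup_dist u v)} \<le> ennreal C"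
proof -
  let ?d = "CARD('d)"
  obtain C1 where C1: "0 < C1" "\<forall>n (x :: int ^ 'd) H h. 2 \<le> n \<longrightarrow>
    (\<forall>m\<le>n. hit_prob zd_edges m x H \<le> h) \<longrightarrow>
    emeasure (path_pmf zd_edges n x) {w. last w = x \<and> set w \<inter> H \<noteq> {}} \<le> ennreal (C1 / sqrt (real n) ^ ?d) * h"
    using closed_path_hit_bound[where 'd='d] by (elim exE conjE) (rule that)
  obtain C3 where C3: "0 < C3" "\<And>n m \<rho> (x :: int ^ 'd). 0 < n \<Longrightarrow> m \<le> n \<Longrightarrow> 0 < \<rho> \<Longrightarrow>
    hit_prob zd_edges m x (far x \<rho>) \<le> ennreal (C3 * (real n / \<rho>\<^sup>2) ^ ?d)"
    using hit_far_bound[where 'd='d] by blast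
  obtain C4 where C4: "0 < C4" "\<forall>(c :: int ^ 'd) s. 1 \<le> s \<longrightarrow>
    (\<integral>\<^sup>+x. ennreal ((36 / (real s + real_of_int (sup_dist x c))\<^sup>2) ^ ?d) \<partial>count_space UNIV) \<le> ennreal (C4 / real s ^ ?d)"
    using nn_integral_inverse_dist_le[where 'd='d] d by auto
  let ?\<mu> = "based_loop_measure UNIV zd_edges 0 :: (int ^ 'd) list measure"
  define C where "C = C1 * C3 * C4"
  have pos: "0 < C" using C1 C3 C4 by (simp add: C_def)
  have main: "emeasure ?\<mu> {xs\<in>based_loops UNIV. length xs < s * s \<and> set xs \<inter> zbox c s \<noteq> {} \<and>
      (\<exists>u\<in>set xs. \<exists>v\<in>set xs. int s < sup_dist u v)} \<le> ennreal C"
    if s: "1 \<le> s" for c :: "int ^ 'd" and s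
  proof -
    let ?P = "\<lambda>xs. set xs \<inter> zbox c s \<noteq> {} \<and> (\<exists>u\<in>set xs. \<exists>v\<in>set xs. int s < sup_dist u v)"
    let ?A = "\<lambda>n. {xs\<in>based_loops UNIV. length xs = n \<and> ?P xs}"
    have len: "emeasure ?\<mu> (?A n) \<le> ennreal (C / (real s)\<^sup>2)" if ns: "n < s * s" for n
    proof (cases "2 \<le> n")
      case False
      then have "?A n = {}" by (auto simp: based_loops_def)
      then show ?thesis by (simp only: emeasure_empty zero_le)
    next
      case n: True
      define \<rho> where "\<rho> x = (real s + real_of_int (sup_dist x c)) / 6" for x
      have \<rho>: "0 < \<rho> x" for x
      proof -
        have "0 \<le> real_of_int (sup_dist x c)" by simp
        moreover have "1 \<le> real s" using s by simp
        ultimately have "0 < real s + real_of_int (sup_dist x c)" by linarith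
        then show ?thesis by (simp add: \<rho>_def)
      qed
      have "emeasure ?\<mu> (?A n) \<le> ennreal (1 / real n) *
         (\<integral>\<^sup>+x. emeasure (path_pmf zd_edges n x) {w. last w = x \<and> ?P (butlast w)} \<partial>count_space UNIV)"
        by (rule based_loop_measure_length_le) (use n in simp)
      also have "\<dots> \<le> ennreal (1 / real n) *
         (\<integral>\<^sup>+x. ennreal (C1 / sqrt (real n) ^ ?d * C3 * real n ^ ?d) * ennreal ((36 / (real s + real_of_int (sup_dist x c))\<^sup>2) ^ ?d) \<partial>count_space UNIV)"
      proof (intro mult_left_mono nn_integral_mono)
        fix x :: "int ^ 'd"
        have "emeasure (path_pmf zd_edges n x) {w. last w = x \<and> ?P (butlast w)} \<le>
          emeasure (path_pmf zd_edges n x) {w. last w = x \<and> set w \<inter> far x (\<rho> x) \<noteq> {}}"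
        proof (rule emeasure_mono)
          show "{w. last w = x \<and> ?P (butlast w)} \<subseteq> {w. last w = x \<and> set w \<inter> far x (\<rho> x) \<noteq> {}}"
          proof (rule subsetI, rule CollectI)
            fix w assume w: "w \<in> {w. last w = x \<and> ?P (butlast w)}"
            then obtain z u v where "z \<in> set (butlast w)" "z \<in> zbox c s" "u \<in> set (butlast w)" "v \<in> set (butlast w)"
              "int s < sup_dist u v" by blast
            then have "set (butlast w) \<inter> far x (\<rho> x) \<noteq> {}" unfolding \<rho>_def by (rule far_from_root)
            then show "last w = x \<and> set w \<inter> far x (\<rho> x) \<noteq> {}" using w by (auto dest: in_set_butlastD)
          qed
        qed simp
        also have "\<dots> \<le> ennreal (C1 / sqrt (real n) ^ ?d) * ennreal (C3 * (real n / (\<rho> x)\<^sup>2) ^ ?d)"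
        proof (rule C1(2)[rule_format, OF n])
          fix m assume "m \<le> n"
          then show "hit_prob zd_edges m x (far x (\<rho> x)) \<le> ennreal (C3 * (real n / (\<rho> x)\<^sup>2) ^ ?d)"
            using n \<rho> by (intro C3(2)) auto
        qed
        also have "\<dots> = ennreal (C1 / sqrt (real n) ^ ?d * (C3 * (real n / (\<rho> x)\<^sup>2) ^ ?d))"
          using C1(1) by (intro ennreal_mult'[symmetric]) simp
        also have "C1 / sqrt (real n) ^ ?d * (C3 * (real n / (\<rho> x)\<^sup>2) ^ ?d) =
            (C1 / sqrt (real n) ^ ?d * C3 * real n ^ ?d) * (36 / (real s + real_of_int (sup_dist x c))\<^sup>2) ^ ?d"
        proof -
          have "real n / (\<rho> x)\<^sup>2 = real n * (36 / (real s + real_of_int (sup_dist x c))\<^sup>2)"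
            by (simp add: \<rho>_def power_divide)
          then show ?thesis by (simp only: power_mult_distrib mult_ac)
        qed
        also have "ennreal \<dots> = ennreal (C1 / sqrt (real n) ^ ?d * C3 * real n ^ ?d) * ennreal ((36 / (real s + real_of_int (sup_dist x c))\<^sup>2) ^ ?d)"
          using C1(1) C3(1) by (intro ennreal_mult') simp
        finally show "emeasure (path_pmf zd_edges n x) {w. last w = x \<and> ?P (butlast w)} \<le>
          ennreal (C1 / sqrt (real n) ^ ?d * C3 * real n ^ ?d) * ennreal ((36 / (real s + real_of_int (sup_dist x c))\<^sup>2) ^ ?d)" .
      qed simp
      also have "\<dots> = ennreal (1 / real n) * (ennreal (C1 / sqrt (real n) ^ ?d * C3 * real n ^ ?d) *
          (\<integral>\<^sup>+x. ennreal ((36 / (real s + real_of_int (sup_dist x c))\<^sup>2) ^ ?d) \<partial>count_space UNIV))"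
        by (subst nn_integral_cmult) auto
      also have "\<dots> \<le> ennreal (1 / real n) * (ennreal (C1 / sqrt (real n) ^ ?d * C3 * real n ^ ?d) * ennreal (C4 / real s ^ ?d))"
        by (intro mult_left_mono C4(2)[rule_format] s) auto
      also have "\<dots> = ennreal (1 / real n * ((C1 / sqrt (real n) ^ ?d * C3 * real n ^ ?d) * (C4 / real s ^ ?d)))"
      proof -
        have "0 \<le> 1 / real n" "0 \<le> C1 / sqrt (real n) ^ ?d * C3 * real n ^ ?d" using C1(1) C3(1) by auto
        then show ?thesis by (simp only: ennreal_mult')
      qed
      also have "\<dots> \<le> ennreal (C / (real s)\<^sup>2)"
      proof (rule ennreal_leI)
        obtain e where e: "?d = e + 2" using d by (metis add.commute le_Suc_ex numeral_3_eq_3 numeral_2_eq_2 Suc_leD)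
        define q where "q = sqrt (real n)"
        have q: "0 < q" "real n = q * q" using n by (auto simp: q_def)
        have qs: "q \<le> real s"
        proof -
          have "real n \<le> real (s * s)" using ns by (simp only: of_nat_le_iff less_imp_le)
          then have "real n \<le> (real s)\<^sup>2" by (simp add: power2_eq_square)
          then show ?thesis unfolding q_def by (intro real_le_lsqrt) auto
        qed
        have s0: "real s \<noteq> 0" using s by simp
        have "1 / real n * ((C1 / sqrt (real n) ^ ?d * C3 * real n ^ ?d) * (C4 / real s ^ ?d)) = C / (real s)\<^sup>2 * (q ^ e / real s ^ e)"
          unfolding q_def[symmetric] q(2) e power_add C_def using q(1) s0
          by (simp add: power2_eq_square power_mult_distrib mult_ac)
        also have "\<dots> \<le> C / (real s)\<^sup>2"
          using qs q(1) s pos by (intro mult_left_le) (simp_all add: power_mono divide_le_eq_1)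
        finally show "1 / real n * ((C1 / sqrt (real n) ^ ?d * C3 * real n ^ ?d) * (C4 / real s ^ ?d)) \<le> C / (real s)\<^sup>2" .
      qed
      finally show ?thesis .
    qed
    have "{xs\<in>based_loops UNIV. length xs < s * s \<and> ?P xs} = (\<Union>n\<in>{..<s * s}. ?A n)" by auto
    then have "emeasure ?\<mu> {xs\<in>based_loops UNIV. length xs < s * s \<and> ?P xs} \<le> (\<Sum>n<s * s. emeasure ?\<mu> (?A n))"
      by (simp only:) (rule emeasure_subadditive_finite; auto simp: sets_based_loop_measure)
    also have "\<dots> \<le> (\<Sum>n<s * s. ennreal (C / (real s)\<^sup>2))" by (intro sum_mono len) simp
    also have "\<dots> = ennreal (\<Sum>n<s * s. C / (real s)\<^sup>2)" using pos by (intro sum_ennreal) simp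
    also have "(\<Sum>n<s * s. C / (real s)\<^sup>2) = C" using s by (simp add: power2_eq_square)
    finally show ?thesis .
  qed
  show ?thesis
    by (rule exI[of _ C], rule conjI[OF pos], intro allI impI, rule main)
qed

section \<open>Renormalization\<close>

definition loop_verts :: "'a list set \<Rightarrow> 'a set" where
  "loop_verts l = (\<Union>xs\<in>l. set xs)"

lemma loop_verts_class:
  assumes "xs \<in> based_loops V"
  shows "loop_verts (rotation_equiv V `` {xs}) = set xs"
proof -
  have "xs \<in> rotation_equiv V `` {xs}" by (rule equiv_class_self[OF rotation_equiv assms])
  moreover have "set ys \<subseteq> set xs" if "ys \<in> rotation_equiv V `` {xs}" for ys
    using that by (auto simp: rotation_equiv_def)
  ultimately show ?thesis unfolding loop_verts_def by blast
qed

lemma loopsE: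
  assumes "l \<in> loops V"
  obtains xs where "xs \<in> based_loops V" "l = rotation_equiv V `` {xs}" "loop_verts l = set xs"
proof -
  obtain xs where xs: "xs \<in> based_loops V" "l = rotation_equiv V `` {xs}"
    using assms unfolding loops_def by (rule quotientE)
  then show thesis by (intro that[of xs]) (simp_all add: loop_verts_class)
qed

lemma loop_verts_finite: "l \<in> loops V \<Longrightarrow> finite (loop_verts l)"
  by (metis loopsE List.finite_set)

lemma loop_verts_nonempty: "l \<in> loops V \<Longrightarrow> loop_verts l \<noteq> {}"
proof -
  assume "l \<in> loops V"
  then obtain xs where "xs \<in> based_loops V" "loop_verts l = set xs" by (rule loopsE)
  then show ?thesis by (auto simp: based_loops_def)
qed

lemma traversed_edge_verts:
  assumes "e \<in> traversed_edges l"
  shows "e \<subseteq> loop_verts l"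
proof -
  obtain xs i where xs: "xs \<in> l" "i < length xs" "e = {xs ! i, xs ! (Suc i mod length xs)}"
    using assms by (auto simp: traversed_edges_def)
  have "Suc i mod length xs < length xs" using xs by (intro mod_less_divisor) auto
  then have "e \<subseteq> set xs" using xs by (simp add: nth_mem)
  then show ?thesis using xs(1) unfolding loop_verts_def by blast
qed

lemma emeasure_loop_measure_verts:
  "emeasure (loop_measure V E \<kappa>) {l\<in>loops V. Q (loop_verts l)} =
    emeasure (based_loop_measure V E \<kappa>) {xs\<in>based_loops V. Q (set xs)}"
proof -
  have "{xs \<in> based_loops V. rotation_equiv V `` {xs} \<in> {l\<in>loops V. Q (loop_verts l)}} = {xs\<in>based_loops V. Q (set xs)}"
    by (auto simp: loop_verts_class loops_def quotientI)
  then show ?thesis by (subst emeasure_loop_measure) auto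
qed

definition wide :: "nat \<Rightarrow> (int ^ 'd::finite) set \<Rightarrow> bool" where
  "wide s A \<longleftrightarrow> (\<exists>u\<in>A. \<exists>v\<in>A. int s < sup_dist u v)"

text \<open>The second bound starts the induction over scales. Every loop has length at least 1, so
  at scale 1 all loops that meet the box fall under \<open>long_loops_bound\<close>.\<close>

lemma loop_measure_bounds:
  assumes d: "3 \<le> CARD('d::finite)"
  shows "\<exists>C>0. (\<forall>(c :: int ^ 'd) s. 1 \<le> s \<longrightarrow> emeasure (loop_measure UNIV zd_edges 0)
        {l\<in>loops UNIV. loop_verts l \<inter> zbox c s \<noteq> {} \<and> wide s (loop_verts l)} \<le> ennreal C) \<and>
    (\<forall>c :: int ^ 'd. emeasure (loop_measure UNIV zd_edges 0)
        {l\<in>loops UNIV. loop_verts l \<inter> zbox c 1 \<noteq> {}} \<le> ennreal C)"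
proof -
  obtain C1 where C1: "0 < C1" "\<And>(c :: int ^ 'd) s. 1 \<le> s \<Longrightarrow>
    emeasure (based_loop_measure UNIV zd_edges 0)
      {xs\<in>based_loops UNIV. s * s \<le> length xs \<and> set xs \<inter> zbox c s \<noteq> {}} \<le> ennreal C1"
    using long_loops_bound[OF d] by blast
  obtain C2 where C2: "0 < C2" "\<forall>(c :: int ^ 'd) s. 1 \<le> s \<longrightarrow>
    emeasure (based_loop_measure UNIV zd_edges 0)
      {xs\<in>based_loops UNIV. length xs < s * s \<and> set xs \<inter> zbox c s \<noteq> {} \<and> (\<exists>u\<in>set xs. \<exists>v\<in>set xs. int s < sup_dist u v)} \<le> ennreal C2"
    using short_loops_bound[OF d] by (elim exE conjE) (rule that)
  let ?\<mu> = "based_loop_measure UNIV zd_edges 0 :: (int ^ 'd) list measure"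
  have A: "emeasure (loop_measure UNIV zd_edges 0)
        {l\<in>loops UNIV. loop_verts l \<inter> zbox c s \<noteq> {} \<and> wide s (loop_verts l)} \<le> ennreal (C1 + C2)"
    if s: "1 \<le> s" for c :: "int ^ 'd" and s
  proof -
    let ?A1 = "{xs\<in>based_loops UNIV. s * s \<le> length xs \<and> set xs \<inter> zbox c s \<noteq> {}}"
    let ?A2 = "{xs\<in>based_loops UNIV. length xs < s * s \<and> set xs \<inter> zbox c s \<noteq> {} \<and> (\<exists>u\<in>set xs. \<exists>v\<in>set xs. int s < sup_dist u v)}"
    have "emeasure (loop_measure UNIV zd_edges 0)
        {l\<in>loops UNIV. loop_verts l \<inter> zbox c s \<noteq> {} \<and> wide s (loop_verts l)} =
      emeasure ?\<mu> {xs\<in>based_loops UNIV. set xs \<inter> zbox c s \<noteq> {} \<and> wide s (set xs)}"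
      by (rule emeasure_loop_measure_verts)
    also have "\<dots> \<le> emeasure ?\<mu> (?A1 \<union> ?A2)"
      by (rule emeasure_mono) (auto simp: wide_def sets_based_loop_measure)
    also have "\<dots> \<le> emeasure ?\<mu> ?A1 + emeasure ?\<mu> ?A2"
      by (rule emeasure_subadditive) (auto simp: sets_based_loop_measure)
    also have "\<dots> \<le> ennreal C1 + ennreal C2" by (intro add_mono C1(2)[OF s] C2(2)[rule_format, OF s])
    also have "\<dots> = ennreal (C1 + C2)" using C1 C2 by (simp add: ennreal_plus)
    finally show ?thesis .
  qed
  have B: "emeasure (loop_measure UNIV zd_edges 0) {l\<in>loops UNIV. loop_verts l \<inter> zbox c 1 \<noteq> {}} \<le> ennreal (C1 + C2)"
    for c :: "int ^ 'd"
  proof -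
    have "emeasure (loop_measure UNIV zd_edges 0) {l\<in>loops UNIV. loop_verts l \<inter> zbox c 1 \<noteq> {}} =
      emeasure ?\<mu> {xs\<in>based_loops UNIV. set xs \<inter> zbox c 1 \<noteq> {}}"
      by (rule emeasure_loop_measure_verts)
    also have "\<dots> \<le> emeasure ?\<mu> {xs\<in>based_loops UNIV. 1 * 1 \<le> length xs \<and> set xs \<inter> zbox c 1 \<noteq> {}}"
      by (rule emeasure_mono) (auto simp: based_loops_def sets_based_loop_measure)
    also have "\<dots> \<le> ennreal C1" by (rule C1(2)) simp
    also have "\<dots> \<le> ennreal (C1 + C2)" using C2 by (intro ennreal_leI) simp
    finally show ?thesis .
  qed
  show ?thesis using A B C1(1) C2(1) by (intro exI[of _ "C1 + C2"]) simp
qed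

section \<open>The grid of mesh r and crossings of annuli\<close>

definition scaled :: "nat \<Rightarrow> int ^ 'd::finite \<Rightarrow> int ^ 'd" where
  "scaled r k = (\<chi> i. int r * k $ i)"

definition grid_point :: "nat \<Rightarrow> int ^ 'd::finite \<Rightarrow> int ^ 'd" where
  "grid_point r a = (\<chi> i. a $ i div int r)"

lemma grid_point:
  assumes r: "1 \<le> r"
  shows "sup_dist a (scaled r (grid_point r a)) \<le> int r"
    and "sup_dist a (scaled r k) \<le> int (M * r) \<Longrightarrow> grid_point r a \<in> zbox k M"
proof -
  have "\<bar>a $ i - int r * (a $ i div int r)\<bar> \<le> int r" for i
  proof -
    have "a $ i - int r * (a $ i div int r) = a $ i mod int r" by (simp add: minus_mult_div_eq_mod)
    moreover have "0 \<le> a $ i mod int r" "a $ i mod int r < int r" using r by auto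
    ultimately show ?thesis by linarith
  qed
  then show "sup_dist a (scaled r (grid_point r a)) \<le> int r"
    by (simp add: sup_dist_le_iff scaled_def grid_point_def)
  assume a: "sup_dist a (scaled r k) \<le> int (M * r)"
  have "\<bar>a $ i div int r - k $ i\<bar> \<le> int M" for i
  proof -
    have "\<bar>a $ i - int r * k $ i\<bar> \<le> int M * int r" using a by (simp add: sup_dist_le_iff scaled_def)
    then have "(k $ i - int M) * int r \<le> a $ i" "a $ i \<le> (k $ i + int M) * int r"
      by (simp_all add: algebra_simps abs_le_iff)
    then have "(k $ i - int M) * int r div int r \<le> a $ i div int r" "a $ i div int r \<le> (k $ i + int M) * int r div int r"
      using r by (intro zdiv_mono1; simp)+
    then show ?thesis using r by simp
  qed
  then show "grid_point r a \<in> zbox k M" by (simp add: zbox_def sup_dist_le_iff grid_point_def)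
qed

definition wide_near :: "nat \<Rightarrow> int ^ 'd::finite \<Rightarrow> nat \<Rightarrow> (int ^ 'd) list set set" where
  "wide_near r k M = {l\<in>loops UNIV. loop_verts l \<inter> zbox (scaled r k) (M * r) \<noteq> {} \<and> wide r (loop_verts l)}"

abbreviation zsoup :: "real \<Rightarrow> ((int ^ 'd::finite) list set \<Rightarrow> nat) measure" where
  "zsoup \<alpha> \<equiv> loop_soup UNIV zd_edges \<alpha> 0"

text \<open>The box of radius \<open>M * r\<close> is covered by the boxes of radius
  \<open>r\<close> around the grid points indexed by \<open>zbox k M\<close>, and the mass bound
  applies to each. The result does not depend on \<open>r\<close>.\<close>

lemma prob_wide_near_le:
  fixes k :: "int ^ 'd::finite"
  assumes C: "\<And>(c :: int ^ 'd) s. 1 \<le> s \<Longrightarrow> emeasure (loop_measure UNIV zd_edges 0)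
        {l\<in>loops UNIV. loop_verts l \<inter> zbox c s \<noteq> {} \<and> wide s (loop_verts l)} \<le> ennreal C" "0 \<le> C"
    and r: "1 \<le> r" and \<alpha>: "0 \<le> \<alpha>"
  shows "measure (zsoup \<alpha>) {\<omega>\<in>space (zsoup \<alpha>). \<exists>l\<in>wide_near r k M. 0 < \<omega> l} \<le>
    real (card (zbox k M)) * (\<alpha> * C)"
proof -
  interpret prob_space "zsoup \<alpha> :: ((int ^ 'd) list set \<Rightarrow> nat) measure" by (rule prob_space_loop_soup) simp
  let ?W = "\<lambda>k'. {l\<in>loops UNIV. loop_verts l \<inter> zbox (scaled r k') r \<noteq> {} \<and> wide r (loop_verts l)}"
  let ?ev = "\<lambda>S. {\<omega>\<in>space (zsoup \<alpha>). \<exists>l\<in>S. 0 < \<omega> l}"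
  have meas: "?ev S \<in> events" if "S \<subseteq> loops UNIV" for S
    using that by (intro present_in_sets) auto
  have "wide_near r k M \<subseteq> (\<Union>k'\<in>zbox k M. ?W k')"
  proof
    fix l assume "l \<in> wide_near r k M"
    then obtain a where a: "l \<in> loops UNIV" "a \<in> loop_verts l" "a \<in> zbox (scaled r k) (M * r)" "wide r (loop_verts l)"
      by (auto simp: wide_near_def)
    have "grid_point r a \<in> zbox k M" using a(3) by (intro grid_point(2)[OF r]) (simp add: zbox_def)
    moreover have "a \<in> zbox (scaled r (grid_point r a)) r" using grid_point(1)[OF r] by (simp add: zbox_def)
    ultimately show "l \<in> (\<Union>k'\<in>zbox k M. ?W k')" using a by blast
  qed
  then have "?ev (wide_near r k M) \<subseteq> (\<Union>k'\<in>zbox k M. ?ev (?W k'))" by blast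
  then have "prob (?ev (wide_near r k M)) \<le> prob (\<Union>k'\<in>zbox k M. ?ev (?W k'))"
    by (intro finite_measure_mono sets.finite_UN finite_zbox meas) auto
  also have "\<dots> \<le> (\<Sum>k'\<in>zbox k M. prob (?ev (?W k')))"
    by (intro finite_measure_subadditive_finite finite_zbox image_subsetI meas) auto
  also have "\<dots> \<le> (\<Sum>k'\<in>zbox k M. \<alpha> * C)"
    by (intro sum_mono prob_loop_soup_present_le C r \<alpha>) auto
  finally show ?thesis by simp
qed

definition local_loops :: "int ^ 'd::finite \<Rightarrow> nat \<Rightarrow> (int ^ 'd) list set set" where
  "local_loops c s = {l\<in>loops UNIV. loop_verts l \<subseteq> zbox c s}"

text \<open>Only loops inside the box of radius \<open>3 * r\<close> count, so that crossings at
  centres more than 6r apart depend on disjoint sets of loops.\<close>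

definition crossing :: "nat \<Rightarrow> int ^ 'd::finite \<Rightarrow> ((int ^ 'd) list set \<Rightarrow> nat) \<Rightarrow> bool" where
  "crossing r k \<omega> \<longleftrightarrow> (\<exists>y\<in>zbox (scaled r k) r. \<exists>z. z \<notin> zbox (scaled r k) (2 * r) \<and>
     linked (edges_from zd_edges (local_loops (scaled r k) (3 * r)) \<omega>) y z)"

text \<open>The path is cut at its first exit from \<open>B\<close>; every edge up to there starts
  in \<open>B\<close>.\<close>

lemma linked_exit:
  assumes "linked F a z" "a \<in> B" "z \<notin> B"
  shows "\<exists>z'. z' \<notin> B \<and> linked {e\<in>F. e \<inter> B \<noteq> {}} a z'"
  using assms unfolding linked_def
proof (induction rule: converse_rtranclp_induct)
  case (step u v)
  have uv: "{u, v} \<in> {e\<in>F. e \<inter> B \<noteq> {}}" using step by auto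
  show ?case
  proof (cases "v \<in> B")
    case True
    then obtain z' where "z' \<notin> B" "(\<lambda>x y. {x, y} \<in> {e\<in>F. e \<inter> B \<noteq> {}})\<^sup>*\<^sup>* v z'"
      using step by blast
    then show ?thesis using uv converse_rtranclp_into_rtranclp[of "\<lambda>x y. {x, y} \<in> {e\<in>F. e \<inter> B \<noteq> {}}" u v z'] by blast
  next
    case False
    then show ?thesis using r_into_rtranclp[of "\<lambda>x y. {x, y} \<in> {e\<in>F. e \<inter> B \<noteq> {}}" u v] uv by blast
  qed
qed simp

text \<open>Discrete intermediate value property: an edge changes the distance to \<open>X\<close>
  by at most 1.\<close>

lemma linked_level:
  fixes X :: "int ^ 'd::finite"
  assumes "linked F y z" "F \<subseteq> zd_edges" "sup_dist y X \<le> t" "t \<le> sup_dist z X"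
  shows "\<exists>a. sup_dist a X = t \<and> linked F a z"
  using assms(1,3) unfolding linked_def
proof (induction rule: converse_rtranclp_induct)
  case base
  then have "sup_dist z X = t" using assms(4) by simp
  then show ?case by (intro exI[of _ z]) simp
next
  case (step u v)
  show ?case
  proof (cases "sup_dist u X = t")
    case True
    have "(\<lambda>x y. {x, y} \<in> F)\<^sup>*\<^sup>* u z" using step.hyps by (rule converse_rtranclp_into_rtranclp)
    then show ?thesis using True by (intro exI[of _ u]) simp
  next
    case False
    have "{u, v} \<in> zd_edges" using step.hyps(1) assms(2) by auto
    then have "sup_dist v u \<le> 1" using sup_dist_edge[of u v] sup_dist_sym[of u v] by simp
    then have "sup_dist v X \<le> t" using sup_dist_triangle[of v X u] False step.prems by linarith
    then show ?thesis by (rule step.IH)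
  qed
qed

text \<open>Until it leaves the box of radius 2r the path uses edges that meet this box. Their loops
  meet it too and, not being wide, stay within 3r of the centre, which makes them local.\<close>

lemma crossing_from_linked:
  fixes a :: "int ^ 'd::finite"
  assumes r: "1 \<le> r" and F: "F = edges_from zd_edges S \<omega>" "S \<subseteq> loops UNIV"
    and nw: "\<And>l. l \<in> S \<Longrightarrow> 0 < \<omega> l \<Longrightarrow> loop_verts l \<inter> zbox (scaled r k) (2 * r) \<noteq> {} \<Longrightarrow> \<not> wide r (loop_verts l)"
    and a: "linked F a z" "a \<in> zbox (scaled r k) r" "z \<notin> zbox (scaled r k) (2 * r)"
  shows "crossing r k \<omega>"
proof -
  let ?B = "zbox (scaled r k) (2 * r)"
  have "a \<in> ?B" using a(2) by (simp add: zbox_def)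
  from linked_exit[OF a(1) this a(3)] obtain z' where z': "z' \<notin> ?B" "linked {e\<in>F. e \<inter> ?B \<noteq> {}} a z'" by blast
  have "{e\<in>F. e \<inter> ?B \<noteq> {}} \<subseteq> edges_from zd_edges (local_loops (scaled r k) (3 * r)) \<omega>"
  proof
    fix e assume "e \<in> {e\<in>F. e \<inter> ?B \<noteq> {}}"
    then obtain l u where l: "e \<in> zd_edges" "l \<in> S" "0 < \<omega> l" "e \<in> traversed_edges l" and u: "u \<in> e" "u \<in> ?B"
      unfolding F(1) edges_from_def by blast
    have ul: "u \<in> loop_verts l" using traversed_edge_verts[OF l(4)] u by blast
    have "loop_verts l \<subseteq> zbox (scaled r k) (3 * r)"
    proof
      fix v assume v: "v \<in> loop_verts l"
      have "\<not> wide r (loop_verts l)" using nw[OF l(2,3)] ul u by blast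
      then have "sup_dist v u \<le> int r" using v ul unfolding wide_def by (meson not_less)
      moreover have "sup_dist u (scaled r k) \<le> int (2 * r)" using u by (simp add: zbox_def)
      moreover have "sup_dist v (scaled r k) \<le> sup_dist v u + sup_dist u (scaled r k)" by (rule sup_dist_triangle)
      ultimately have "sup_dist v (scaled r k) \<le> int (3 * r)" by simp
      then show "v \<in> zbox (scaled r k) (3 * r)" by (simp add: zbox_def)
    qed
    then have "l \<in> local_loops (scaled r k) (3 * r)" using l F(2) unfolding local_loops_def by blast
    then show "e \<in> edges_from zd_edges (local_loops (scaled r k) (3 * r)) \<omega>" using l unfolding edges_from_def by blast
  qed
  then have "linked (edges_from zd_edges (local_loops (scaled r k) (3 * r)) \<omega>) a z'"
    using z'(2) by (rule linked_mono)
  then show ?thesis using a(2) z'(1) unfolding crossing_def by blast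
qed

text \<open>The two crossings start from points of the path at distance 12r and 21r from
  \<open>X\<close>. Rounding to the grid moves a point by at most r. So the grid centres are at
  least 9r - 2r = 7r apart, more than the 6r that separates their local loops, and they lie within
  22r of \<open>X\<close>, so that \<open>z\<close>, beyond 24r, is outside both boxes of radius 2r.
  The 36 is 3 * 12, the range of the local loops at scale 12r.\<close>

lemma crossing_split:
  fixes k :: "int ^ 'd::finite"
  assumes r: "1 \<le> r" and cr: "crossing (12 * r) k \<omega>"
    and nw: "\<not> (\<exists>l\<in>wide_near r (scaled 12 k) 36. 0 < \<omega> l)"
  shows "\<exists>k1\<in>zbox (scaled 12 k) 36. \<exists>k2\<in>zbox (scaled 12 k) 36.
     6 * int r < sup_dist (scaled r k1) (scaled r k2) \<and> crossing r k1 \<omega> \<and> crossing r k2 \<omega>"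
proof -
  define X where "X = scaled (12 * r) k"
  have X: "X = scaled r (scaled 12 k)" by (simp add: X_def scaled_def vec_eq_iff)
  let ?S = "local_loops X (36 * r)"
  define F where "F = edges_from zd_edges ?S \<omega>"
  have S: "?S \<subseteq> loops UNIV" by (auto simp: local_loops_def)
  obtain y z where yz: "y \<in> zbox X (12 * r)" "z \<notin> zbox X (24 * r)" "linked F y z"
    using cr unfolding crossing_def F_def X_def by (auto simp: mult.assoc)
  have nw': "\<not> wide r (loop_verts l)" if "l \<in> ?S" "0 < \<omega> l" for l
  proof -
    have l: "l \<in> loops UNIV" "loop_verts l \<subseteq> zbox X (36 * r)" using that by (auto simp: local_loops_def)
    then have "loop_verts l \<inter> zbox X (36 * r) \<noteq> {}" using loop_verts_nonempty by blast
    then show ?thesis using nw that l by (auto simp: wide_near_def X)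
  qed
  have Fsub: "F \<subseteq> zd_edges" by (auto simp: F_def edges_from_def)
  have yX: "sup_dist y X \<le> 12 * int r" using yz by (simp add: zbox_def)
  have zX: "24 * int r < sup_dist z X" using yz by (simp add: zbox_def)
  have make: "\<exists>k'. k' \<in> zbox (scaled 12 k) 36 \<and> crossing r k' \<omega> \<and> sup_dist a (scaled r k') \<le> int r"
    if a: "sup_dist a X \<le> 21 * int r" "linked F a z" for a
  proof (intro exI conjI)
    let ?k = "grid_point r a"
    show ak: "sup_dist a (scaled r ?k) \<le> int r" by (rule grid_point(1)[OF r])
    show "?k \<in> zbox (scaled 12 k) 36" using a by (intro grid_point(2)[OF r]) (simp add: X)
    have "sup_dist z X \<le> sup_dist z (scaled r ?k) + sup_dist (scaled r ?k) X" by (rule sup_dist_triangle)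
    moreover have "sup_dist (scaled r ?k) X \<le> sup_dist (scaled r ?k) a + sup_dist a X" by (rule sup_dist_triangle)
    ultimately have "2 * int r < sup_dist z (scaled r ?k)"
      using zX a ak sup_dist_sym[of "scaled r ?k" a] by linarith
    then have "z \<notin> zbox (scaled r ?k) (2 * r)" by (simp add: zbox_def)
    moreover have "a \<in> zbox (scaled r ?k) r" using ak by (simp add: zbox_def)
    ultimately show "crossing r ?k \<omega>" using a by (intro crossing_from_linked[OF r F_def S nw'])
  qed
  obtain a where a: "sup_dist a X = 12 * int r" "linked F a z"
    using linked_level[OF yz(3) Fsub yX] zX by force
  obtain b where b: "sup_dist b X = 21 * int r" "linked F b z"
    using linked_level[OF yz(3) Fsub, of X "21 * int r"] zX yX by force
  obtain k1 where k1: "k1 \<in> zbox (scaled 12 k) 36" "crossing r k1 \<omega>" "sup_dist a (scaled r k1) \<le> int r"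
    using make[of a] a by auto
  obtain k2 where k2: "k2 \<in> zbox (scaled 12 k) 36" "crossing r k2 \<omega>" "sup_dist b (scaled r k2) \<le> int r"
    using make[of b] b by auto
  have "sup_dist b X \<le> sup_dist b a + sup_dist a X" by (rule sup_dist_triangle)
  moreover have "sup_dist b a \<le> sup_dist b (scaled r k2) + sup_dist (scaled r k2) a" by (rule sup_dist_triangle)
  moreover have "sup_dist (scaled r k2) a \<le> sup_dist (scaled r k2) (scaled r k1) + sup_dist (scaled r k1) a" by (rule sup_dist_triangle)
  ultimately have "6 * int r < sup_dist (scaled r k1) (scaled r k2)"
    using a b k1 k2 r sup_dist_sym[of a "scaled r k1"] sup_dist_sym[of "scaled r k1" "scaled r k2"] by linarith
  then show ?thesis using k1 k2 by blast
qed

lemma crossing_base: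
  assumes "crossing 1 k \<omega>"
  shows "\<exists>l\<in>{l\<in>loops UNIV. loop_verts l \<inter> zbox (scaled 1 k) 1 \<noteq> {}}. 0 < \<omega> l"
proof -
  obtain y z where yz: "y \<in> zbox (scaled 1 k) 1" "z \<notin> zbox (scaled 1 k) (2 * 1)"
    "linked (edges_from zd_edges (local_loops (scaled 1 k) (3 * 1)) \<omega>) y z"
    using assms unfolding crossing_def by blast
  have "y \<noteq> z" using yz by (auto simp: zbox_def)
  with yz(3) obtain v where "{y, v} \<in> edges_from zd_edges (local_loops (scaled 1 k) (3 * 1)) \<omega>"
    unfolding linked_def by (cases rule: converse_rtranclpE) auto
  then obtain l where l: "l \<in> local_loops (scaled 1 k) (3 * 1)" "0 < \<omega> l" "{y, v} \<in> traversed_edges l"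
    unfolding edges_from_def by blast
  then show ?thesis using traversed_edge_verts[OF l(3)] yz(1) unfolding local_loops_def by blast
qed

lemma countable_local_loops: "countable (local_loops c s)"
  by (rule countable_subset[OF _ countable_loops[of UNIV]]) (auto simp: local_loops_def)

lemma crossing_measurable:
  assumes "\<And>l. l \<in> local_loops (scaled r k) (3 * r) \<Longrightarrow> (\<lambda>\<omega>. \<omega> l) \<in> measurable M (count_space UNIV)"
  shows "Measurable.pred M (crossing r (k :: int ^ 'd::finite))"
proof -
  note [measurable] = linked_measurable[OF countable_local_loops assms]
  have [measurable]: "Measurable.pred M (\<lambda>\<omega>. \<exists>z. z \<notin> zbox (scaled r k) (2 * r) \<and>
     linked (edges_from zd_edges (local_loops (scaled r k) (3 * r)) \<omega>) y z)" for y
    by measurable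
  have "Measurable.pred M (\<lambda>\<omega>. \<exists>y. y \<in> zbox (scaled r k) r \<and> (\<exists>z. z \<notin> zbox (scaled r k) (2 * r) \<and>
     linked (edges_from zd_edges (local_loops (scaled r k) (3 * r)) \<omega>) y z))"
    by measurable
  then show ?thesis unfolding crossing_def[abs_def] Bex_def .
qed

lemma crossing_restrict:
  "crossing r k (restrict \<omega> (local_loops (scaled r k) (3 * r))) \<longleftrightarrow> crossing r k \<omega>"
proof -
  have "edges_from zd_edges (local_loops (scaled r k) (3 * r)) (restrict \<omega> (local_loops (scaled r k) (3 * r))) =
     edges_from zd_edges (local_loops (scaled r k) (3 * r)) \<omega>"
    by (rule edges_from_cong) simp
  then show ?thesis by (simp add: crossing_def)
qed

lemma crossing_indep:
  fixes k1 k2 :: "int ^ 'd::finite"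
  assumes far: "6 * int r < sup_dist (scaled r k1) (scaled r k2)"
  shows "measure (zsoup \<alpha>) {\<omega>\<in>space (zsoup \<alpha>). crossing r k1 \<omega> \<and> crossing r k2 \<omega>} =
    measure (zsoup \<alpha>) {\<omega>\<in>space (zsoup \<alpha>). crossing r k1 \<omega>} * measure (zsoup \<alpha>) {\<omega>\<in>space (zsoup \<alpha>). crossing r k2 \<omega>}"
proof (rule indep_disjoint_loops)
  show "local_loops (scaled r k1) (3 * r) \<inter> local_loops (scaled r k2) (3 * r) = {}"
  proof (rule ccontr)
    assume "local_loops (scaled r k1) (3 * r) \<inter> local_loops (scaled r k2) (3 * r) \<noteq> {}"
    then obtain l where l: "l \<in> loops UNIV" "loop_verts l \<subseteq> zbox (scaled r k1) (3 * r)" "loop_verts l \<subseteq> zbox (scaled r k2) (3 * r)"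
      by (auto simp: local_loops_def)
    then obtain v where "v \<in> zbox (scaled r k1) (3 * r)" "v \<in> zbox (scaled r k2) (3 * r)"
      using loop_verts_nonempty by blast
    then have "sup_dist v (scaled r k1) \<le> int (3 * r)" "sup_dist v (scaled r k2) \<le> int (3 * r)" by (simp_all add: zbox_def)
    moreover have "sup_dist (scaled r k1) (scaled r k2) \<le> sup_dist (scaled r k1) v + sup_dist v (scaled r k2)"
      by (rule sup_dist_triangle)
    ultimately show False using far sup_dist_sym[of v "scaled r k1"] by simp
  qed
  show "local_loops (scaled r k1) (3 * r) \<subseteq> loops UNIV" "local_loops (scaled r k2) (3 * r) \<subseteq> loops UNIV"
    by (auto simp: local_loops_def)
qed (simp_all add: crossing_restrict crossing_measurable)

text \<open>The choice of \<epsilon> gives N^2 \<epsilon>^2 = \<epsilon>/2 for pairs of crossings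
  and leaves \<epsilon>/2 for the wide loops. The induction treats all centres at once, because the
  two smaller crossings sit at other grid points.\<close>

lemma prob_crossing_small:
  fixes k :: "int ^ 'd::finite"
  assumes C: "\<And>(c :: int ^ 'd) s. 1 \<le> s \<Longrightarrow> emeasure (loop_measure UNIV zd_edges 0)
        {l\<in>loops UNIV. loop_verts l \<inter> zbox c s \<noteq> {} \<and> wide s (loop_verts l)} \<le> ennreal C"
      "\<And>c :: int ^ 'd. emeasure (loop_measure UNIV zd_edges 0) {l\<in>loops UNIV. loop_verts l \<inter> zbox c 1 \<noteq> {}} \<le> ennreal C" "0 \<le> C"
    and N: "N = real (card (zbox (0 :: int ^ 'd) 36))" and \<epsilon>: "\<epsilon> = 1 / (2 * N\<^sup>2)"
    and \<alpha>: "0 \<le> \<alpha>" "N * (\<alpha> * C) \<le> \<epsilon> / 2"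
  shows "measure (zsoup \<alpha>) {\<omega>\<in>space (zsoup \<alpha>). crossing (12 ^ j) k \<omega>} \<le> \<epsilon>"
proof (induction j arbitrary: k)
  let ?P = "zsoup \<alpha> :: ((int ^ 'd) list set \<Rightarrow> nat) measure"
  interpret prob_space ?P by (rule prob_space_loop_soup) simp
  have N1: "1 \<le> N" unfolding N card_zbox by simp
  have cardN: "real (card (zbox k 36)) = N" for k :: "int ^ 'd" unfolding N card_zbox by simp
  have \<epsilon>0: "0 < \<epsilon>" using N1 by (simp add: \<epsilon>)
  have meas: "{\<omega>\<in>space ?P. crossing r k \<omega>} \<in> events" for r and k :: "int ^ 'd"
    using crossing_measurable[of r k ?P] by (simp add: local_loops_def loop_soup_component_measurable pred_def)
  {
    case 0
    let ?S = "{l\<in>loops UNIV. loop_verts l \<inter> zbox (scaled 1 k) 1 \<noteq> {}}"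
    have "prob {\<omega>\<in>space ?P. crossing (12 ^ 0) k \<omega>} \<le> prob {\<omega>\<in>space ?P. \<exists>l\<in>?S. 0 < \<omega> l}"
      using crossing_base[of k] by (intro finite_measure_mono present_in_sets) auto
    also have "\<dots> \<le> \<alpha> * C" by (intro prob_loop_soup_present_le C \<alpha>) auto
    also have "\<dots> \<le> N * (\<alpha> * C)" using mult_right_mono[OF N1, of "\<alpha> * C"] \<alpha> C(3) by simp
    finally show ?case using \<alpha> \<epsilon>0 by linarith
  next
    case (Suc j)
    let ?r = "12 ^ j :: nat"
    let ?k = "scaled 12 k"
    let ?Z = "zbox ?k 36"
    let ?far = "\<lambda>p. 6 * int ?r < sup_dist (scaled ?r (fst p)) (scaled ?r (snd p))"
    let ?I = "{p\<in>?Z \<times> ?Z. ?far p}"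
    let ?ev = "\<lambda>p. {\<omega>\<in>space ?P. crossing ?r (fst p) \<omega> \<and> crossing ?r (snd p) \<omega>}"
    let ?W = "{\<omega>\<in>space ?P. \<exists>l\<in>wide_near ?r ?k 36. 0 < \<omega> l}"
    have fin: "finite ?I"
      by (rule finite_subset[OF _ finite_cartesian_product[OF finite_zbox[of ?k 36] finite_zbox[of ?k 36]]]) auto
    have evm: "?ev p \<in> events" for p
    proof -
      have "?ev p = {\<omega>\<in>space ?P. crossing ?r (fst p) \<omega>} \<inter> {\<omega>\<in>space ?P. crossing ?r (snd p) \<omega>}" by auto
      then show ?thesis using meas[of ?r "fst p"] meas[of ?r "snd p"] by (simp only: sets.Int)
    qed
    have Wm: "?W \<in> events" by (intro present_in_sets) (auto simp: wide_near_def)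
    have "{\<omega>\<in>space ?P. crossing (12 ^ Suc j) k \<omega>} \<subseteq> ?W \<union> (\<Union>p\<in>?I. ?ev p)"
    proof
      fix \<omega> assume w: "\<omega> \<in> {\<omega>\<in>space ?P. crossing (12 ^ Suc j) k \<omega>}"
      then have cr: "crossing (12 * ?r) k \<omega>" by simp
      show "\<omega> \<in> ?W \<union> (\<Union>p\<in>?I. ?ev p)"
      proof (cases "\<exists>l\<in>wide_near ?r ?k 36. 0 < \<omega> l")
        case False
        from crossing_split[OF _ cr this] obtain k1 k2 where "k1 \<in> ?Z" "k2 \<in> ?Z" "?far (k1, k2)"
          "crossing ?r k1 \<omega>" "crossing ?r k2 \<omega>" by auto
        then have "(k1, k2) \<in> ?I" "\<omega> \<in> ?ev (k1, k2)" using w by auto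
        then show ?thesis by blast
      qed (use w in blast)
    qed
    then have "prob {\<omega>\<in>space ?P. crossing (12 ^ Suc j) k \<omega>} \<le> prob (?W \<union> (\<Union>p\<in>?I. ?ev p))"
      using fin evm Wm by (intro finite_measure_mono sets.Un sets.finite_UN) auto
    also have "\<dots> \<le> prob ?W + prob (\<Union>p\<in>?I. ?ev p)"
      using fin evm Wm by (intro measure_Un_le sets.finite_UN) auto
    also have "prob (\<Union>p\<in>?I. ?ev p) \<le> (\<Sum>p\<in>?I. prob (?ev p))"
      using fin evm by (intro finite_measure_subadditive_finite) auto
    also have "\<dots> \<le> (\<Sum>p\<in>?I. \<epsilon> * \<epsilon>)"
    proof (rule sum_mono)
      fix p assume "p \<in> ?I"
      then have "prob (?ev p) = prob {\<omega>\<in>space ?P. crossing ?r (fst p) \<omega>} * prob {\<omega>\<in>space ?P. crossing ?r (snd p) \<omega>}"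
        by (intro crossing_indep) auto
      also have "\<dots> \<le> \<epsilon> * \<epsilon>" using \<epsilon>0 by (intro mult_mono Suc.IH) auto
      finally show "prob (?ev p) \<le> \<epsilon> * \<epsilon>" .
    qed
    also have "\<dots> \<le> N * N * (\<epsilon> * \<epsilon>)"
    proof -
      have "card ?I \<le> card (?Z \<times> ?Z)" using finite_zbox by (intro card_mono) auto
      then have "real (card ?I) \<le> real (card (?Z \<times> ?Z))" by (simp only: of_nat_le_iff)
      also have "\<dots> = N * N" by (simp only: card_cartesian_product of_nat_mult cardN)
      finally show ?thesis by (simp add: mult_right_mono)
    qed
    also have "N * N * (\<epsilon> * \<epsilon>) = \<epsilon> / 2" using N1 by (simp add: \<epsilon> power2_eq_square)
    also have "prob ?W \<le> N * (\<alpha> * C)"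
      using prob_wide_near_le[OF C(1) C(3), of ?r \<alpha> ?k 36] \<alpha> by (simp add: cardN)
    finally show ?case using \<alpha>(2) by linarith
  }
qed

section \<open>Infinite clusters and finite modifications\<close>

definition infinite_cluster_within :: "(int ^ 'd::finite) list set set \<Rightarrow> ((int ^ 'd) list set \<Rightarrow> nat) \<Rightarrow> int ^ 'd \<Rightarrow> bool" where
  "infinite_cluster_within S \<omega> x \<longleftrightarrow> infinite {y. linked (edges_from zd_edges S \<omega>) x y}"

lemma infinite_cluster_crossing:
  fixes y :: "int ^ 'd::finite"
  assumes r: "1 \<le> r" and y: "y \<in> zbox (scaled r k) r" "infinite_cluster_within (loops UNIV) \<omega> y"
    and nw: "\<not> (\<exists>l\<in>wide_near r k 36. 0 < \<omega> l)"
  shows "crossing r k \<omega>"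
proof -
  have "\<not> {z. linked (edges_from zd_edges (loops UNIV) \<omega>) y z} \<subseteq> zbox (scaled r k) (2 * r)"
    using y(2) finite_zbox finite_subset unfolding infinite_cluster_within_def by blast
  then obtain z where z: "linked (edges_from zd_edges (loops UNIV) \<omega>) y z" "z \<notin> zbox (scaled r k) (2 * r)" by blast
  have "zbox (scaled r k) (2 * r) \<subseteq> zbox (scaled r k) (36 * r)" by (auto simp: zbox_def)
  then have "\<not> wide r (loop_verts l)"
    if "l \<in> loops UNIV" "0 < \<omega> l" "loop_verts l \<inter> zbox (scaled r k) (2 * r) \<noteq> {}" for l
    using that nw unfolding wide_near_def by blast
  then show ?thesis by (rule crossing_from_linked[OF r refl subset_refl _ z(1) y(1) z(2)])
qed

text \<open>Without the removed loops an infinite cluster falls into pieces, each containing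
  \<open>x\<close> or a vertex of a removed loop. Loops have finitely many vertices, so there are
  finitely many pieces and one of them is infinite.\<close>

lemma infinite_cluster_cofinite:
  assumes S: "S \<subseteq> loops UNIV" "finite (loops UNIV - S)"
  shows "(\<exists>x. infinite_cluster_within (loops UNIV) \<omega> x) \<longleftrightarrow> (\<exists>x. infinite_cluster_within S \<omega> x)"
proof
  assume "\<exists>x. infinite_cluster_within S \<omega> x"
  then obtain x where x: "infinite {y. linked (edges_from zd_edges S \<omega>) x y}" by (auto simp: infinite_cluster_within_def)
  have "{y. linked (edges_from zd_edges S \<omega>) x y} \<subseteq> {y. linked (edges_from zd_edges (loops UNIV) \<omega>) x y}"
    using linked_mono[OF edges_from_mono[OF S(1)]] by blast
  then have "infinite {y. linked (edges_from zd_edges (loops UNIV) \<omega>) x y}" using x finite_subset by blast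
  then show "\<exists>x. infinite_cluster_within (loops UNIV) \<omega> x" by (auto simp: infinite_cluster_within_def)
next
  assume "\<exists>x. infinite_cluster_within (loops UNIV) \<omega> x"
  then obtain x where x: "infinite {y. linked (edges_from zd_edges (loops UNIV) \<omega>) x y}" by (auto simp: infinite_cluster_within_def)
  show "\<exists>x. infinite_cluster_within S \<omega> x"
  proof (rule ccontr)
    assume "\<not> ?thesis"
    then have fin: "finite {y. linked (edges_from zd_edges S \<omega>) w y}" for w by (auto simp: infinite_cluster_within_def)
    define W where "W = insert x (\<Union>l\<in>loops UNIV - S. loop_verts l)"
    have "finite W" using S(2) loop_verts_finite unfolding W_def by blast
    have "\<exists>w\<in>W. linked (edges_from zd_edges S \<omega>) w y" if "linked (edges_from zd_edges (loops UNIV) \<omega>) x y" for y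
      using that unfolding linked_def
    proof (induction rule: rtranclp_induct)
      case base
      then show ?case by (intro bexI[of _ x]) (auto simp: W_def)
    next
      case (step u v)
      from step.hyps(2) obtain l where l: "{u, v} \<in> zd_edges" "l \<in> loops UNIV" "0 < \<omega> l" "{u, v} \<in> traversed_edges l"
        unfolding edges_from_def by blast
      show ?case
      proof (cases "l \<in> S")
        case True
        then have "{u, v} \<in> edges_from zd_edges S \<omega>" using l unfolding edges_from_def by blast
        then show ?thesis using step.IH by (meson rtranclp.rtrancl_into_rtrancl)
      next
        case False
        then have "v \<in> W" using l traversed_edge_verts[OF l(4)] unfolding W_def by blast
        then show ?thesis by blast
      qed
    qed
    then have "{y. linked (edges_from zd_edges (loops UNIV) \<omega>) x y} \<subseteq> (\<Union>w\<in>W. {y. linked (edges_from zd_edges S \<omega>) w y})" by blast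
    moreover have "finite (\<Union>w\<in>W. {y. linked (edges_from zd_edges S \<omega>) w y})" using \<open>finite W\<close> fin by blast
    ultimately show False using x finite_subset by blast
  qed
qed

text \<open>The zero-one law speaks of a sequence of sigma-algebras, so the loops are enumerated by
  all natural numbers.\<close>

lemma infinite_loops_zd: "infinite (loops (UNIV :: (int ^ 'd::finite) set))"
proof
  assume fin: "finite (loops (UNIV :: (int ^ 'd) set))"
  have "x \<in> (\<Union>l\<in>loops UNIV. loop_verts l)" for x :: "int ^ 'd"
  proof -
    let ?xs = "[x, x + axis undefined 1]"
    have "?xs ! i \<noteq> ?xs ! (Suc i mod length ?xs)" if "i < length ?xs" for i
      using that by (cases i) (auto simp: axis_eq_0_iff)
    then have xs: "?xs \<in> based_loops UNIV" by (auto simp: based_loops_def)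
    then have "rotation_equiv UNIV `` {?xs} \<in> loops UNIV" by (auto simp: loops_def quotientI)
    moreover have "x \<in> loop_verts (rotation_equiv UNIV `` {?xs})" unfolding loop_verts_class[OF xs] by simp
    ultimately show ?thesis by blast
  qed
  then have "(UNIV :: (int ^ 'd) set) \<subseteq> (\<Union>l\<in>loops UNIV. loop_verts l)" by blast
  moreover have "finite (\<Union>l\<in>loops (UNIV :: (int ^ 'd) set). loop_verts l)" using fin loop_verts_finite by blast
  ultimately have f: "finite (UNIV :: (int ^ 'd) set)" by (rule finite_subset)
  have "card (zbox (0 :: int ^ 'd) (card (UNIV :: (int ^ 'd) set))) \<le> card (UNIV :: (int ^ 'd) set)"
    using f by (intro card_mono) auto
  moreover have "2 * n + 1 \<le> (2 * n + 1) ^ CARD('d)" for n :: nat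
    by (rule self_le_power) auto
  ultimately show False unfolding card_zbox by (metis Suc_n_not_le_n add_leD1 le_trans mult_2 Suc_eq_plus1 add.assoc le_add1)
qed

section \<open>Absence of percolation at small intensity\<close>

lemma (in prob_space) indep_sets_reindex:
  assumes ind: "indep_sets F I" and f: "inj_on f J" "f ` J \<subseteq> I"
  shows "indep_sets (\<lambda>j. F (f j)) J"
  unfolding indep_sets_def
proof (intro conjI ballI allI impI)
  show "F (f j) \<subseteq> events" if "j \<in> J" for j using ind f that by (auto simp: indep_sets_def)
  fix K A assume K: "K \<subseteq> J" "K \<noteq> {}" "finite K" and A: "A \<in> (\<Pi> j\<in>K. F (f j))"
  have inj: "inj_on f K" using f(1) K(1) by (rule inj_on_subset)
  let ?B = "\<lambda>l. A (the_inv_into K f l)"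
  have inv: "the_inv_into K f (f j) = j" if "j \<in> K" for j by (rule the_inv_into_f_f[OF inj that])
  have "?B \<in> Pi (f ` K) F" using A inv by auto
  moreover have "f ` K \<subseteq> I" "f ` K \<noteq> {}" "finite (f ` K)" using K f by auto
  ultimately have "prob (\<Inter>l\<in>f ` K. ?B l) = (\<Prod>l\<in>f ` K. prob (?B l))"
    using ind unfolding indep_sets_def by blast
  moreover have "(\<Inter>l\<in>f ` K. ?B l) = (\<Inter>j\<in>K. A j)" using inv by auto
  moreover have "(\<Prod>l\<in>f ` K. prob (?B l)) = (\<Prod>j\<in>K. prob (A j))"
    using inv by (simp add: prod.reindex[OF inj])
  ultimately show "prob (\<Inter>j\<in>K. A j) = (\<Prod>j\<in>K. prob (A j))" by simp
qed

text \<open>The event is unchanged when finitely many loops of an enumeration are ignored, so it is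
  a tail event of the independent multiplicities.\<close>

lemma infinite_cluster_zero_one:
  "measure (zsoup \<alpha>) {\<omega>\<in>space (zsoup \<alpha>). \<exists>x :: int ^ 'd::finite. infinite_cluster_within (loops UNIV) \<omega> x} \<in> {0, 1}"
proof -
  let ?P = "zsoup \<alpha> :: ((int ^ 'd) list set \<Rightarrow> nat) measure"
  let ?L = "loops UNIV :: (int ^ 'd) list set set"
  let ?T = "{\<omega>\<in>space ?P. \<exists>x. infinite_cluster_within ?L \<omega> x}"
  let ?\<nu> = "scale_measure (ennreal \<alpha>) (loop_measure UNIV zd_edges 0) :: (int ^ 'd) list set measure"
  interpret D: discrete_intensity ?\<nu> by (rule discrete_intensity_loop_measure) simp
  interpret prob_space ?P by (rule prob_space_loop_soup) simp
  have sp: "space ?\<nu> = ?L" by (simp add: space_scale_measure space_loop_measure)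
  have cL: "countable ?L" by (rule countable_loops) simp
  define f where "f = from_nat_into ?L"
  have f: "bij_betw f UNIV ?L" unfolding f_def by (rule bij_betw_from_nat_into[OF cL infinite_loops_zd])
  define F where "F = (\<lambda>l. {(\<lambda>\<omega>. \<omega> l) -` A \<inter> space ?P | A. A \<in> sets (count_space (UNIV :: nat set))})"
  have coord: "(\<lambda>\<omega>. \<omega> l) \<in> measurable ?P (count_space UNIV)" if "l \<in> ?L" for l
    using that by (intro loop_soup_component_measurable) auto
  have "indep_vars (\<lambda>_. count_space UNIV) (\<lambda>l \<omega>. \<omega> l) ?L"
    using D.indep_coords by (simp only: sp loop_soup_def)
  then have indF: "indep_sets F ?L" unfolding indep_vars_def2 F_def by (rule conjunct2)
  have ind: "indep_sets (\<lambda>i. F (f i)) UNIV"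
    by (rule indep_sets_reindex[OF indF, of f UNIV]) (use f in \<open>simp_all add: bij_betw_def\<close>)
  have sa: "sigma_algebra (space ?P) (F l)" for l
  proof -
    have "F l = sets (vimage_algebra (space ?P) (\<lambda>\<omega>. \<omega> l) (count_space UNIV))"
      unfolding F_def by (rule sets_vimage_algebra2[symmetric]) simp
    then show ?thesis using sets.sigma_algebra_axioms[of "vimage_algebra (space ?P) (\<lambda>\<omega>. \<omega> l) (count_space UNIV)"] by simp
  qed
  have "?T \<in> sigma_sets (space ?P) (\<Union> ((\<lambda>i. F (f i)) ` {n..}))" for n
  proof -
    \<comment> \<open>The sigma-algebra of the loops from index \<open>n\<close> on, packaged as a
      measure so that the measurability lemmas for arbitrary \<open>M\<close> apply.\<close>
    define M where "M = sigma (space ?P) (\<Union> ((\<lambda>i. F (f i)) ` {n..}))"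
    have pow: "\<Union> ((\<lambda>i. F (f i)) ` {n..}) \<subseteq> Pow (space ?P)" by (auto simp: F_def)
    have M: "space M = space ?P" "sets M = sigma_sets (space ?P) (\<Union> ((\<lambda>i. F (f i)) ` {n..}))"
      unfolding M_def using pow by (auto simp: space_measure_of sets_measure_of)
    define S where "S = f ` {n..}"
    have S: "S \<subseteq> ?L" using f by (auto simp: S_def bij_betw_def)
    have "?L - S = f ` {..<n}"
    proof -
      have "?L = f ` UNIV" using f by (simp add: bij_betw_def)
      moreover have "f ` UNIV - f ` {n..} = f ` (UNIV - {n..})"
        using f by (intro image_set_diff[symmetric]) (auto simp: bij_betw_def)
      moreover have "UNIV - {n..} = {..<n}" by auto
      ultimately show ?thesis by (simp add: S_def)
    qed
    then have fin: "finite (?L - S)" by simp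
    have "(\<lambda>\<omega>. \<omega> l) \<in> measurable M (count_space UNIV)" if lS: "l \<in> S" for l
    proof (rule measurableI)
      fix A :: "nat set"
      obtain i where "i \<ge> n" "l = f i" using lS unfolding S_def by auto
      moreover have "(\<lambda>\<omega>. \<omega> l) -` A \<inter> space ?P \<in> F l" unfolding F_def by (intro CollectI exI[of _ A]) simp
      ultimately have "(\<lambda>\<omega>. \<omega> l) -` A \<inter> space ?P \<in> \<Union> ((\<lambda>i. F (f i)) ` {n..})" by blast
      then show "(\<lambda>\<omega>. \<omega> l) -` A \<inter> space M \<in> sets M" unfolding M by (rule sigma_sets.Basic)
    qed simp
    then have [measurable]: "Measurable.pred M (\<lambda>\<omega>. infinite_cluster_within S \<omega> x)" for x
      unfolding infinite_cluster_within_def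
      by (intro infinite_cluster_measurable countable_subset[OF S cL])
    have "{\<omega>\<in>space M. \<exists>x. infinite_cluster_within S \<omega> x} \<in> sets M" by measurable
    moreover have "{\<omega>\<in>space M. \<exists>x. infinite_cluster_within S \<omega> x} = ?T"
      unfolding M using infinite_cluster_cofinite[OF S fin] by auto
    ultimately show ?thesis unfolding M(2) by simp
  qed
  then have "?T \<in> tail_events (\<lambda>i. F (f i))" unfolding tail_events_def by (intro INT_I)
  from kolmogorov_0_1_law[of "\<lambda>i. F (f i)", OF sa ind this] show ?thesis by simp
qed

lemma theta_eq_0:
  assumes d: "3 \<le> CARD('d::finite)"
  shows "\<exists>\<alpha>0>0. \<forall>\<alpha>. 0 \<le> \<alpha> \<longrightarrow> \<alpha> < \<alpha>0 \<longrightarrow> theta TYPE('d) \<alpha> 0 = 0"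
proof -
  obtain C where C: "0 < C" "\<forall>(c :: int ^ 'd) s. 1 \<le> s \<longrightarrow> emeasure (loop_measure UNIV zd_edges 0)
        {l\<in>loops UNIV. loop_verts l \<inter> zbox c s \<noteq> {} \<and> wide s (loop_verts l)} \<le> ennreal C"
    "\<forall>c :: int ^ 'd. emeasure (loop_measure UNIV zd_edges 0)
        {l\<in>loops UNIV. loop_verts l \<inter> zbox c 1 \<noteq> {}} \<le> ennreal C"
    using loop_measure_bounds[OF d] by (elim exE conjE) (rule that)
  define N where "N = real (card (zbox (0 :: int ^ 'd) 36))"
  define \<epsilon> where "\<epsilon> = 1 / (2 * N\<^sup>2)"
  have N1: "1 \<le> N" unfolding N_def card_zbox by simp
  then have \<epsilon>: "0 < \<epsilon>" "\<epsilon> \<le> 1 / 2" by (auto simp: \<epsilon>_def field_simps)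
  \<comment> \<open>Solves N \<alpha>0 C = \<epsilon>/2, the smallness asked for in
    \<open>prob_crossing_small\<close>.\<close>
  define \<alpha>0 where "\<alpha>0 = \<epsilon> / (2 * N * C)"
  have pos: "0 < \<alpha>0" using N1 \<epsilon> C by (simp add: \<alpha>0_def)
  have main: "theta TYPE('d) \<alpha> 0 = 0" if \<alpha>: "0 \<le> \<alpha>" "\<alpha> < \<alpha>0" for \<alpha>
  proof -
    let ?P = "zsoup \<alpha> :: ((int ^ 'd) list set \<Rightarrow> nat) measure"
    let ?L = "loops UNIV :: (int ^ 'd) list set set"
    interpret prob_space ?P by (rule prob_space_loop_soup) simp
    have small: "N * (\<alpha> * C) \<le> \<epsilon> / 2"
    proof -
      have "\<alpha> * (N * C) \<le> \<alpha>0 * (N * C)" using \<alpha> N1 C by (intro mult_right_mono) auto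
      also have "\<dots> = \<epsilon> / 2" using N1 C by (simp add: \<alpha>0_def)
      finally show ?thesis by (simp add: mult_ac)
    qed
    have cr: "prob {\<omega>\<in>space ?P. crossing (12 ^ j) k \<omega>} \<le> \<epsilon>" for j and k :: "int ^ 'd"
      by (rule prob_crossing_small[OF C(2)[rule_format] C(3)[rule_format] _ N_def \<epsilon>_def \<alpha>(1) small])
        (use C(1) in simp_all)
    have coord: "(\<lambda>\<omega>. \<omega> l) \<in> measurable ?P (count_space UNIV)" if "l \<in> ?L" for l
      using that by (intro loop_soup_component_measurable) auto
    have [measurable]: "Measurable.pred ?P (\<lambda>\<omega>. infinite_cluster_within ?L \<omega> x)" for x
      unfolding infinite_cluster_within_def
      by (intro infinite_cluster_measurable coord countable_loops) auto
    define B where "B j = {\<omega>\<in>space ?P. \<exists>y. y \<in> zbox 0 (12 ^ j) \<and> infinite_cluster_within ?L \<omega> y}" for j :: nat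
    let ?T = "{\<omega>\<in>space ?P. \<exists>x. infinite_cluster_within ?L \<omega> x}"
    have Bm: "B j \<in> events" for j unfolding B_def by measurable
    have Tm: "?T \<in> events" by measurable
    \<comment> \<open>\<epsilon>/2 for a wide loop plus \<epsilon> for a crossing is at most 3/4, as
      \<epsilon> \<le> 1/2. The bound is the same for all boxes, so it passes to their union; being
      below 1, it decides the zero-one alternative.\<close>
    have B: "prob (B j) \<le> 3 / 4" for j
    proof -
      let ?r = "12 ^ j :: nat"
      let ?W = "{\<omega>\<in>space ?P. \<exists>l\<in>wide_near ?r 0 36. 0 < \<omega> l}"
      have Wm: "?W \<in> events" by (intro present_in_sets) (auto simp: wide_near_def)
      have cm: "{\<omega>\<in>space ?P. crossing ?r 0 \<omega>} \<in> events"
        using crossing_measurable[of ?r 0 ?P] coord by (simp add: local_loops_def pred_def)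
      have s0: "scaled ?r (0 :: int ^ 'd) = 0" by (simp add: scaled_def vec_eq_iff)
      have "B j \<subseteq> ?W \<union> {\<omega>\<in>space ?P. crossing ?r 0 \<omega>}"
      proof
        fix \<omega> assume "\<omega> \<in> B j"
        then obtain y where y: "\<omega> \<in> space ?P" "y \<in> zbox (scaled ?r 0) ?r" "infinite_cluster_within ?L \<omega> y"
          by (auto simp: B_def s0)
        have "crossing ?r 0 \<omega>" if "\<not> (\<exists>l\<in>wide_near ?r 0 36. 0 < \<omega> l)"
          by (rule infinite_cluster_crossing[OF _ y(2,3) that]) simp
        then show "\<omega> \<in> ?W \<union> {\<omega>\<in>space ?P. crossing ?r 0 \<omega>}" using y(1) by blast
      qed
      then have "prob (B j) \<le> prob (?W \<union> {\<omega>\<in>space ?P. crossing ?r 0 \<omega>})"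
        using Wm cm by (intro finite_measure_mono sets.Un)
      also have "\<dots> \<le> prob ?W + prob {\<omega>\<in>space ?P. crossing ?r 0 \<omega>}"
        using Wm cm by (intro measure_Un_le)
      also have "prob ?W \<le> N * (\<alpha> * C)"
        unfolding N_def using C(1) \<alpha> by (intro prob_wide_near_le C(2)[rule_format]) auto
      finally show ?thesis using small \<epsilon> cr[of j 0] by linarith
    qed
    have "incseq B"
    proof (rule incseq_SucI)
      fix j
      have "(12 :: nat) ^ j \<le> 12 ^ Suc j" by simp
      then have "int (12 ^ j) \<le> int (12 ^ Suc j)" by (simp only: of_nat_le_iff)
      then have "zbox (0 :: int ^ 'd) (12 ^ j) \<subseteq> zbox 0 (12 ^ Suc j)" unfolding zbox_def using order_trans by blast
      then show "B j \<subseteq> B (Suc j)" unfolding B_def by blast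
    qed
    then have lim: "(\<lambda>j. prob (B j)) \<longlonglongrightarrow> prob (\<Union>j. B j)"
      using Bm by (intro finite_Lim_measure_incseq) auto
    have le: "prob (\<Union>j. B j) \<le> 3 / 4" by (rule LIMSEQ_le_const2[OF lim]) (use B in auto)
    have "?T \<subseteq> (\<Union>j. B j)"
    proof
      fix \<omega> assume "\<omega> \<in> ?T"
      then obtain x where x: "\<omega> \<in> space ?P" "infinite_cluster_within ?L \<omega> x" by auto
      define m where "m = nat (sup_dist x 0)"
      have "m \<le> 12 ^ m" by (rule less_imp_le, rule power_gt_expt) simp
      then have "int m \<le> int (12 ^ m)" by (simp only: of_nat_le_iff)
      then have "x \<in> zbox 0 (12 ^ m)" by (simp add: zbox_def m_def)
      then show "\<omega> \<in> (\<Union>j. B j)" using x unfolding B_def by blast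
    qed
    then have "prob ?T \<le> 3 / 4" using le finite_measure_mono[of ?T "\<Union>j. B j"] Bm by force
    then have T0: "prob ?T = 0" using infinite_cluster_zero_one[where 'd='d, of \<alpha>] by auto
    have "prob {\<omega>\<in>space ?P. infinite (open_cluster UNIV zd_edges \<omega> 0)} \<le> prob ?T"
      by (rule finite_measure_mono[OF _ Tm])
        (auto simp: open_cluster_def infinite_cluster_within_def open_edges_conv_edges_from)
    then show ?thesis using T0 by (simp add: theta_def Let_def measure_le_0_iff)
  qed
  show ?thesis
    by (rule exI[of _ \<alpha>0], rule conjI[OF pos], intro allI impI, rule main)
qed

section \<open>Percolation at negative killing\<close>

lemma locally_finite_zd: "locally_finite_graph UNIV (zd_edges :: (int ^ 'd::finite) set set)"
  unfolding locally_finite_graph_def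
proof (intro conjI ballI)
  fix e :: "(int ^ 'd) set" assume "e \<in> zd_edges"
  then obtain x y where xy: "e = {x, y}" "(\<Sum>i\<in>UNIV. \<bar>x $ i - y $ i\<bar>) = 1" by (auto simp: zd_edges_def)
  then have "x \<noteq> y" by auto
  then show "\<exists>x\<in>UNIV. \<exists>y\<in>UNIV. x \<noteq> y \<and> e = {x, y}" using xy by blast
qed (auto simp: finite_neighbours_zd)

lemma walk_at_add: "walk_at E (m + n) x = bind_pmf (walk_at E m x) (walk_at E n)"
proof (induction m arbitrary: x)
  case (Suc m)
  have "walk_at E (m + n) = (\<lambda>x. bind_pmf (walk_at E m x) (walk_at E n))" using Suc by (simp add: fun_eq_iff)
  then show ?case by (simp add: walk_at_Suc bind_assoc_pmf)
qed (simp add: walk_at_0 bind_return_pmf)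

lemma set_walk_at_zd: "y \<in> set_pmf (walk_at zd_edges n (x :: int ^ 'd::finite)) \<Longrightarrow> y \<in> zbox x n"
proof (induction n arbitrary: x)
  case (Suc n)
  then obtain z where z: "z \<in> neighbours zd_edges x" "y \<in> set_pmf (walk_at zd_edges n z)"
    by (auto simp: walk_at_Suc walk_step_zd neighbours_zd_ne finite_neighbours_zd)
  have "sup_dist z x \<le> 1" using z(1) sup_dist_edge[of x z] sup_dist_sym[of x z] by (simp add: neighbours_def)
  moreover have "sup_dist y z \<le> int n" using Suc.IH[OF z(2)] by (simp add: zbox_def)
  ultimately show ?case using sup_dist_triangle[of y x z] by (simp add: zbox_def)
qed (simp add: walk_at_0 zbox_def)

lemma pmf_bind_ge: "pmf M z * pmf (f z) y \<le> pmf (bind_pmf M f) y"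
proof -
  have "ennreal (pmf M z * pmf (f z) y) = (\<integral>\<^sup>+w. ennreal (pmf (f z) y) * indicator {z} w \<partial>M)"
    by (subst nn_integral_cmult_indicator) (simp_all add: emeasure_pmf_single ennreal_mult mult.commute)
  also have "\<dots> \<le> (\<integral>\<^sup>+w. ennreal (pmf (f w) y) \<partial>M)"
    by (intro nn_integral_mono) (auto simp: indicator_def)
  also have "\<dots> = ennreal (pmf (bind_pmf M f) y)" by (simp add: ennreal_pmf_bind)
  finally show ?thesis by simp
qed

text \<open>By pigeonhole some point of the box reachable in \<open>m\<close> steps carries mass at least the inverse
  of its cardinality; symmetry brings the walk back.\<close>

lemma pmf_return_ge: "1 / (real (2 * m + 1) ^ CARD('d))\<^sup>2 \<le> pmf (walk_at zd_edges (2 * m) (x :: int ^ 'd::finite)) x"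
proof -
  let ?p = "\<lambda>z. pmf (walk_at zd_edges m x) z" and ?c = "1 / real (2 * m + 1) ^ CARD('d)"
  have "\<exists>z. ?c \<le> ?p z"
  proof (rule ccontr)
    assume "\<not> ?thesis"
    then have lt: "?p z < ?c" for z by (simp only: not_ex not_le)
    have ne: "x \<in> zbox x m" by (simp add: zbox_def)
    have "(\<Sum>z\<in>zbox x m. ?p z) = 1"
      by (rule sum_pmf_eq_1[OF finite_zbox]) (use set_walk_at_zd in blast)
    moreover have "(\<Sum>z\<in>zbox x m. ?p z) < (\<Sum>z\<in>zbox x m. ?c)"
      by (rule sum_strict_mono[OF finite_zbox _ lt]) (use ne in blast)
    moreover have "(\<Sum>z\<in>zbox x m. ?c) = real (card (zbox x m)) * ?c" by (rule sum_constant)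
    moreover have "real (card (zbox x m)) = real (2 * m + 1) ^ CARD('d)" unfolding card_zbox by (rule of_nat_power)
    moreover have "real (2 * m + 1) ^ CARD('d) \<noteq> 0" by simp
    ultimately show False by simp
  qed
  then obtain z where z: "?c \<le> ?p z" by blast
  have "?c * ?c \<le> ?p z * pmf (walk_at zd_edges m z) x"
    using z pmf_walk_at_sym[OF transition_zd_sym, of m z x] by (intro mult_mono) auto
  also have "\<dots> \<le> pmf (walk_at zd_edges (m + m) x) x" unfolding walk_at_add by (rule pmf_bind_ge)
  finally show ?thesis by (simp only: power2_eq_square mult_2 times_divide_times_eq mult_1)
qed

lemma emeasure_path_Suc_ge:
  "ennreal (transition E x y) * emeasure (path_pmf E n y) {v. x # v \<in> A} \<le> emeasure (path_pmf E (Suc n) x) A"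
proof -
  have "ennreal (transition E x y) * emeasure (path_pmf E n y) {v. x # v \<in> A} =
     (\<integral>\<^sup>+z. emeasure (path_pmf E n y) {v. x # v \<in> A} * indicator {y} z \<partial>walk_step E x)"
    by (subst nn_integral_cmult_indicator) (simp_all add: emeasure_pmf_single transition_def mult.commute)
  also have "\<dots> \<le> (\<integral>\<^sup>+z. emeasure (path_pmf E n z) {v. x # v \<in> A} \<partial>walk_step E x)"
    by (intro nn_integral_mono) (auto simp: indicator_def)
  also have "\<dots> = emeasure (path_pmf E (Suc n) x) A" by (simp add: emeasure_bind_pmf vimage_def)
  finally show ?thesis .
qed

lemma zd_loops_through_edge:
  fixes x y :: "int ^ 'd::finite"
  assumes \<kappa>: "-1 < \<kappa>" "\<kappa> < 0" and e: "{x, y} \<in> zd_edges"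
  shows "emeasure (based_loop_measure UNIV zd_edges \<kappa>) (loops_through UNIV {x, y}) = \<infinity>"
proof -
  let ?\<mu> = "based_loop_measure UNIV zd_edges \<kappa>"
  let ?d = "CARD('d)"
  define \<beta> where "\<beta> = 1 / (1 + \<kappa>)"
  have \<beta>: "1 < \<beta>" using \<kappa> by (simp add: \<beta>_def)
  define t where "t = transition zd_edges x y"
  have t: "0 < t" "transition zd_edges y x = t" using e by (simp_all add: t_def transition_zd insert_commute)
  \<comment> \<open>A lower bound for the mass of the loops that step to \<open>y\<close>, back to
    \<open>x\<close>, and then follow a closed walk of 2m steps: one over the length, the
    exponential factor, two transitions, and the bound of \<open>pmf_return_ge\<close>.\<close>
  define g where "g m = 1 / real (2 * m + 2) * \<beta> ^ (2 * m + 2) * (t * t * (1 / (real (2 * m + 1) ^ ?d)\<^sup>2))" for m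
  have ge: "ennreal (g m) \<le> emeasure ?\<mu> (loops_through UNIV {x, y})" for m
  proof -
    let ?n = "Suc (Suc (2 * m))"
    define A where "A = {xs\<in>based_loops UNIV. length xs = ?n \<and> hd xs = x \<and> xs ! 1 = y}"
    have A: "A \<subseteq> loops_through UNIV {x, y}"
    proof
      fix xs assume "xs \<in> A"
      then have xs: "xs \<in> based_loops UNIV" "length xs = ?n" "hd xs = x" "xs ! 1 = y" by (auto simp: A_def)
      then have "xs ! 0 = x" by (cases xs) auto
      then show "xs \<in> loops_through UNIV {x, y}" using xs by (intro loops_throughI[of _ _ 0]) auto
    qed
    let ?W = "{w. last w = x \<and> w ! 1 = y}"
    have "t * t * (1 / (real (2 * m + 1) ^ ?d)\<^sup>2) \<le> t * t * pmf (walk_at zd_edges (2 * m) x) x"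
      using t by (intro mult_left_mono pmf_return_ge) auto
    then have "ennreal (t * t * (1 / (real (2 * m + 1) ^ ?d)\<^sup>2)) \<le> ennreal t * (ennreal t * emeasure (path_pmf zd_edges (2 * m) x) {v. last v = x})"
      using t by (simp add: ennreal_mult'[symmetric] walk_at_def emeasure_pmf_single[symmetric] vimage_def mult.assoc
          measure_pmf.emeasure_eq_measure pmf.rep_eq)
    also have "\<dots> \<le> ennreal t * (ennreal t * emeasure (path_pmf zd_edges (2 * m) x) {v. y # v \<in> {v. x # v \<in> ?W}})"
    proof (intro mult_left_mono emeasure_mono_AE AE_pmfI impI)
      fix v assume "v \<in> set_pmf (path_pmf zd_edges (2 * m) x)" "v \<in> {v. last v = x}"
      then show "v \<in> {v. y # v \<in> {v. x # v \<in> ?W}}" using set_path_pmf_length[of v zd_edges "2 * m" x] by auto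
    qed auto
    also have "\<dots> \<le> ennreal t * emeasure (path_pmf zd_edges (Suc (2 * m)) y) {v. x # v \<in> ?W}"
      using emeasure_path_Suc_ge[of zd_edges y x "2 * m" "{v. x # v \<in> ?W}"] by (intro mult_left_mono) (simp_all add: t)
    also have "\<dots> \<le> emeasure (path_pmf zd_edges ?n x) ?W"
      using emeasure_path_Suc_ge[of zd_edges x y "Suc (2 * m)" ?W] by (simp add: t_def del: path_pmf.simps)
    also have "\<dots> \<le> emeasure (path_pmf zd_edges ?n x) {xs @ [x] | xs. xs \<in> A}"
    proof (rule emeasure_mono_AE, rule AE_pmfI, rule impI)
      fix w assume w: "w \<in> set_pmf (path_pmf zd_edges ?n x)" "w \<in> ?W"
      note l = set_path_pmf_length[OF w(1)]
      have ne: "\<forall>i<?n. w ! i \<noteq> w ! Suc i"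
        using set_path_pmf_graph[OF locally_finite_zd neighbours_zd_ne w(1)] by simp
      define xs where "xs = butlast w"
      have wx: "w = xs @ [x]" using w(2) l by (cases w rule: rev_cases) (auto simp: xs_def)
      have len: "length xs = ?n" using l by (simp add: xs_def)
      have h: "xs ! 0 = x" "hd xs = x" using l len wx by (cases xs; auto)+
      have "xs \<in> based_loops UNIV"
        unfolding based_loops_def
      proof (safe)
        fix i assume i: "i < length xs" "xs ! i = xs ! (Suc i mod length xs)"
        have "w ! i \<noteq> w ! Suc i" using ne i len by simp
        then show False using i len h wx by (cases "Suc i = ?n") (auto simp: nth_append)
      qed (simp_all add: len)
      moreover have "xs ! 1 = y" using w(2) wx len by (auto simp: nth_append)
      ultimately have "xs \<in> A" using len h by (simp add: A_def)
      then show "w \<in> {xs @ [x] | xs. xs \<in> A}" using wx by blast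
    qed simp
    finally have "ennreal (1 / real ?n * \<beta> ^ ?n) * ennreal (t * t * (1 / (real (2 * m + 1) ^ ?d)\<^sup>2)) \<le>
      ennreal (1 / real ?n * \<beta> ^ ?n) * emeasure (path_pmf zd_edges ?n x) {xs @ [x] | xs. xs \<in> A}"
      by (rule mult_left_mono) simp
    also have "\<dots> = emeasure ?\<mu> A"
      unfolding \<beta>_def by (rule emeasure_based_loop_measure_rooted[symmetric]) (use \<kappa> in \<open>auto simp: A_def\<close>)
    also have "\<dots> \<le> emeasure ?\<mu> (loops_through UNIV {x, y})"
      by (rule emeasure_mono[OF A]) (auto simp: sets_based_loop_measure loops_through_def)
    also have "ennreal (1 / real ?n * \<beta> ^ ?n) * ennreal (t * t * (1 / (real (2 * m + 1) ^ ?d)\<^sup>2)) = ennreal (g m)"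
      using \<beta> by (subst ennreal_mult'[symmetric]) (simp_all add: g_def)
    finally show ?thesis .
  qed
  \<comment> \<open>The exponential beats the polynomial denominators. Each \<open>g m\<close>
    bounds the same mass from below, so unboundedness already makes it infinite.\<close>
  have "filterlim g at_top sequentially"
    unfolding g_def using \<beta> t(1) by real_asymp
  show ?thesis
  proof (rule ccontr)
    assume "emeasure ?\<mu> (loops_through UNIV {x, y}) \<noteq> \<infinity>"
    then obtain r where r: "0 \<le> r" "emeasure ?\<mu> (loops_through UNIV {x, y}) = ennreal r"
      by (cases "emeasure ?\<mu> (loops_through UNIV {x, y})") auto
    have "\<forall>\<^sub>F m in sequentially. r + 1 \<le> g m" using \<open>filterlim g at_top sequentially\<close> by (simp add: filterlim_at_top)
    then obtain m where "r + 1 \<le> g m" by (auto simp: eventually_sequentially)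
    moreover have "g m \<le> r" using ge[of m] r by simp
    ultimately show False by simp
  qed
qed

lemma theta_pos:
  assumes \<kappa>: "-1 < \<kappa>" "\<kappa> < 0" and \<alpha>: "0 < \<alpha>"
  shows "0 < theta TYPE('d::finite) \<alpha> \<kappa>"
proof -
  let ?E = "zd_edges :: (int ^ 'd) set set"
  let ?P = "loop_soup UNIV ?E \<alpha> \<kappa>"
  interpret prob_space ?P by (rule prob_space_loop_soup) simp
  \<comment> \<open>A ray along one axis: its countably many edges are open simultaneously almost
    surely and already make the cluster of 0 infinite.\<close>
  define p where "p n = (axis undefined (int n) :: int ^ 'd)" for n
  have edge: "{p n, p (Suc n)} \<in> ?E" for n
  proof -
    have "p (Suc n) = p n + axis undefined 1" by (simp add: p_def vec_eq_iff axis_def)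
    then have "p (Suc n) \<in> neighbours ?E (p n)" unfolding neighbours_zd by (auto intro!: image_eqI[of _ _ "(undefined, True)"])
    then show ?thesis by (simp add: neighbours_def)
  qed
  have "AE \<omega> in ?P. \<forall>n. {p n, p (Suc n)} \<in> open_edges UNIV ?E \<omega>"
    unfolding AE_all_countable by (intro allI AE_edge_open zd_loops_through_edge \<kappa> \<alpha> edge) simp
  then have "AE \<omega> in ?P. infinite (open_cluster UNIV ?E \<omega> 0)"
  proof eventually_elim
    case (elim \<omega>)
    have "linked (open_edges UNIV ?E \<omega>) 0 (p n)" for n
    proof (induction n)
      case 0
      have "p 0 = 0" by (simp add: p_def)
      then show ?case by (simp add: linked_def)
    next
      case (Suc n)
      then show ?case using elim unfolding linked_def by (metis (no_types, lifting) rtranclp.rtrancl_into_rtrancl)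
    qed
    then have "range p \<subseteq> open_cluster UNIV ?E \<omega> 0" by (auto simp: open_cluster_def)
    moreover have "inj p" by (auto simp: inj_def p_def axis_eq_axis)
    ultimately show ?case using range_inj_infinite infinite_super by blast
  qed
  moreover have "{\<omega>\<in>space ?P. infinite (open_cluster UNIV ?E \<omega> 0)} \<in> events"
    using infinite_cluster_measurable[of "loops UNIV" ?P ?E 0]
    by (simp add: open_cluster_def open_edges_conv_edges_from countable_loops loop_soup_component_measurable pred_def)
  ultimately have "prob {\<omega>\<in>space ?P. infinite (open_cluster UNIV ?E \<omega> 0)} = 1"
    by (subst prob_Collect_eq_1) auto
  then show ?thesis using \<alpha> by (simp add: theta_def Let_def)
qed


section \<open>The phase transition\<close>

theorem theorem1p1:
  shows "(CARD('d::finite) \<ge> 3 \<longrightarrow>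
            0 < alpha_c TYPE('d) 0 \<and>
            (\<forall>\<alpha>::real. 0 < \<alpha> \<longrightarrow> 0 \<le> kappa_c TYPE('d) \<alpha>)) \<and>
         (\<forall>(V :: 'a set) E \<alpha>.
            locally_finite_graph V E \<and> connected_graph V E \<and> recurrent_graph V E \<and> 0 < \<alpha> \<longrightarrow>
            (AE \<omega> in loop_soup V E \<alpha> 0. \<forall>x\<in>V. \<forall>y\<in>V. y \<in> open_cluster V E \<omega> x))"
proof (intro conjI impI allI)
  assume d: "CARD('d) \<ge> 3"
  obtain \<alpha>0 where \<alpha>0: "0 < \<alpha>0" "\<forall>\<alpha>. 0 \<le> \<alpha> \<longrightarrow> \<alpha> < \<alpha>0 \<longrightarrow> theta TYPE('d) \<alpha> 0 = 0"
    using theta_eq_0[OF d] by (elim exE conjE) (rule that)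
  have "ereal \<alpha>0 \<le> alpha_c TYPE('d) 0"
    unfolding alpha_c_def
  proof (rule Inf_greatest)
    fix u assume "u \<in> {ereal \<alpha> | \<alpha>. 0 \<le> \<alpha> \<and> 0 < theta TYPE('d) \<alpha> 0}"
    then obtain \<alpha> where u: "u = ereal \<alpha>" "0 \<le> \<alpha>" "0 < theta TYPE('d) \<alpha> 0" by blast
    have "\<not> \<alpha> < \<alpha>0"
    proof
      assume "\<alpha> < \<alpha>0"
      then show False using \<alpha>0(2)[rule_format, OF u(2)] u(3) by simp
    qed
    then show "ereal \<alpha>0 \<le> u" using u(1) by simp
  qed
  then show "0 < alpha_c TYPE('d) 0" using \<alpha>0(1) by (metis ereal_less(2) less_le_trans)
next
  fix \<alpha> :: real assume \<alpha>: "0 < \<alpha>"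
  show "0 \<le> kappa_c TYPE('d) \<alpha>"
    unfolding kappa_c_def
  proof (rule Inf_greatest)
    fix u assume "u \<in> {ereal \<kappa> | \<kappa>. -1 < \<kappa> \<and> theta TYPE('d) \<alpha> \<kappa> = 0}"
    then obtain \<kappa> where u: "u = ereal \<kappa>" "-1 < \<kappa>" "theta TYPE('d) \<alpha> \<kappa> = 0" by blast
    have "\<not> \<kappa> < 0"
    proof
      assume "\<kappa> < 0"
      then show False using theta_pos[where 'd='d, OF u(2) _ \<alpha>] u(3) by simp
    qed
    then show "0 \<le> u" using u(1) by simp
  qed
next
  fix V :: "'a set" and E and \<alpha> :: real
  assume "locally_finite_graph V E \<and> connected_graph V E \<and> recurrent_graph V E \<and> 0 < \<alpha>"
  then show "AE \<omega> in loop_soup V E \<alpha> 0. \<forall>x\<in>V. \<forall>y\<in>V. y \<in> open_cluster V E \<omega> x"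
    by (intro recurrent_loop_percolation) auto
qed

end
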